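(* Let $d\ge1$ and $\delta>0$. Suppose that Assumptions 1 and 2 (stated in the context) hold for $S_z$ for each $z\in[z_c-\delta,z_c)$, suppose that $m_z\to0$ as $z\to z_c$, and suppose that there are constants $M,K_{\mathrm{IR}},\zeta$ such that $(J_z^{(\mu)},h_z^{(\mu)})\in\mathcal{Q}_{M,K_{\mathrm{IR}},\zeta}$ and $\hat h_z^{(\mu)}(0)\ge M^{-1}>0$ uniformly in $\mu\in\overline\Omega_z$ and in $z\in[z_c-\delta,z_c)$. Suppose further that $\lim_{z\to z_c}\sigma_z=\sigma_{z_c}$ and $\lim_{z\to z_c}\hat h_z(0)=\hat h_{z_c}(0)$. Then for every $\phi\ge0$, as $z\to z_c$ we have $$\sum_{x\in\mathbb{Z}^d}\|x\|_2^\phi S_z(x)\sim A_\phi\,\frac{d\,\hat h_{z_c}(0)}{\sigma_{z_c}^2}\,\frac{1}{m_z^{2+\phi}}$$ and, for $\phi>0$, $$\xi_\phi(z)\sim\Bigl(\frac{A_\phi}{A_0}\Bigr)^{1/\phi}\frac1{m_z}=2\biggl(\frac{\Gamma(\frac{\phi+2}{2})\Gamma(\frac{\phi+d}{2})}{\Gamma(\frac d2)}\biggr)^{1/\phi}\frac1{m_z}.$$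
   Context: Notation. $|x|=\|x\|_2$ is the Euclidean norm on $\mathbb{R}^d$; $a\wedge b=\min\{a,b\}$; $f\sim g$ means $\lim f/g=1$; $e_1,\dots,e_d$ is the standard basis; $\mathbb{T}^d$ is the $d$-dimensional torus of period $2\pi$. For $f,g:\mathbb{Z}^d\to\mathbb{R}$: $\hat f(k)=\sum_{x}f(x)e^{-ik\cdot x}$, $(f*g)(x)=\sum_{y}f(x-y)g(y)$, and $\|f(y)\|_p$ is the $\ell^p(\mathbb{Z}^d)$ norm. $f$ is $\mathbb{Z}^d$-symmetric if $f(x)$ is unchanged when a component of $x$ is multiplied by $-1$ or the components of $x$ are permuted. The exponential tilt of $f$ by $\mu\in\mathbb{R}^d$ is $f^{(\mu)}(x)=f(x)e^{\mu\cdot x}$. Class $\mathcal{Q}_{M,K_{\mathrm{IR}},\zeta}$ (for $d\ge1$, $M,K_{\mathrm{IR}},\zeta>0$): the set of pairs $(Q,g)$ of functions $\mathbb{Z}^d\to\mathbb{R}$ such that (a) $\|Q(y)\|_1\le M$ and $\||y|^{2+\zeta}Q(y)\|_1\le M$; (b) $\mathrm{Re}[\hat Q(0)-\hat Q(k)]\ge K_{\mathrm{IR}}|k|^2$ for $k\in\mathbb{T}^d$ (represented in $[-\pi,\pi]^d$); (c) $\|g(y)\|_1\le M$, $\||y|^{\zeta}g(y)\|_1\le M$, $\||y|^2g(y)\|_{p_d\wedge2}\le M$, where $p_d=2$ for $d=1$ and $p_d=\frac{d}{d-2+(\zeta\wedge2)}$ for $d\ge2$; (d) if $d\ge4$, additionally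 $\||y|^{d-1}Q(y)\|_{\frac d3\wedge2}\le M$ and $\||y|^{d-1}g(y)\|_2\le M$. Setting: $(S_z)$ is a family of functions $S_z:\mathbb{Z}^d\to[0,\infty)$ indexed by a real parameter $z$ up to a real number $z_c$ (with $J_z,h_z$ defined also at $z=z_c$), with $S_z=h_z+J_z*S_z$. For $z<z_c$, let $\chi^{(\mu)}(z)=\sum_xS_z^{(\mu)}(x)$, $\chi(z)=\chi^{(0)}(z)$, $\Omega_z=\{\mu\in\mathbb{R}^d:\chi^{(\mu)}(z)<\infty\}$ with closure $\overline\Omega_z$, and $m_z=\sup\{t\ge0:\chi^{(te_1)}(z)<\infty\}$. Let $\sigma_z>0$ be given by $\sigma_z^2=\sum_{x}\|x\|_2^2J_z(x)$. Assumption 1 for $S_z$: $S_z$ is $\mathbb{Z}^d$-symmetric, $\Omega_z$ is an open set containing $0$, and $\mu_1e_1\notin\Omega_z$ for some $\mu_1>0$. Assumption 2 for $S_z$: $S_z=h_z+J_z*S_z$ with $\mathbb{Z}^d$-symmetric $J_z,h_z\in\ell^1(\mathbb{Z}^d)$; there are constants such that $(J_z^{(\mu)},h_z^{(\mu)})\in\mathcal{Q}_{M,K_{\mathrm{IR}},\zeta}$ for all $\mu\in\overline\Omega_z$; and $\hat h_z^{(\mu)}(0)>0$ for all $\mu\in\overline\Omega_z$. The correlation length of order $\phi>0$ is $\xi_\phi(z)=\bigl(\frac1{\chi(z)}\sum_{x\in\mathbb{Z}^d}\|x\|_2^\phi S_z(x)\bigr)^{1/\phi}$. For $\phi\ge0$,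 $A_\phi=\int_{\mathbb{R}^d}\|y\|_2^\phi\,\mathbb{G}_1(y)\,dy=2^{\phi+1}\frac{\Gamma(\frac{\phi+2}2)\Gamma(\frac{\phi+d}2)}{\Gamma(\frac d2)}$, where $\mathbb{G}_1(y)=\int_0^\infty(2\pi t)^{-d/2}e^{-\frac{1}{2t}\|y\|_2^2}e^{-\frac12t}\,dt$. *)

theory Defs
  imports "HOL-Analysis.Analysis" "HOL-Library.Landau_Symbols"
begin

text \<open>
  The lattice is \<^typ>\<open>int ^ 'n\<close> and Euclidean space is \<^typ>\<open>real ^ 'n\<close>, with dimension
  \<open>d = CARD('n)\<close>. All lattice sums are unconditional sums \<^const>\<open>infsum\<close>, which are \<open>0\<close> by
  convention when not summable; membership in an \<open>\<ell>\<^sup>p\<close> space and finiteness of the tilted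
  susceptibility are therefore stated through \<^const>\<open>summable_on\<close>.
\<close>

definition rvec :: "int ^ 'n \<Rightarrow> real ^ 'n" where
  "rvec x = (\<chi> i. real_of_int (x $ i))"

text \<open>Real power with \<open>0\<^sup>0 = 1\<close>, in contrast to \<^term>\<open>0 powr (0::real) = 0\<close>.\<close>
definition pow0 :: "real \<Rightarrow> real \<Rightarrow> real" where
  "pow0 r \<phi> = (if \<phi> = 0 then 1 else r powr \<phi>)"

definition fourier :: "(int ^ 'n \<Rightarrow> real) \<Rightarrow> real ^ 'n \<Rightarrow> complex" where
  "fourier f k = (\<Sum>\<^sub>\<infinity>x. complex_of_real (f x) * exp (- (\<i> * complex_of_real (k \<bullet> rvec x))))"

definition conv :: "(int ^ 'n \<Rightarrow> real) \<Rightarrow> (int ^ 'n \<Rightarrow> real) \<Rightarrow> int ^ 'n \<Rightarrow> real" where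
  "conv f g x = (\<Sum>\<^sub>\<infinity>y. f (x - y) * g y)"

definition in_lp :: "real \<Rightarrow> (int ^ 'n \<Rightarrow> real) \<Rightarrow> bool" where
  "in_lp p f \<longleftrightarrow> (\<lambda>x. \<bar>f x\<bar> powr p) summable_on UNIV"

definition lp_norm :: "real \<Rightarrow> (int ^ 'n \<Rightarrow> real) \<Rightarrow> real" where
  "lp_norm p f = (\<Sum>\<^sub>\<infinity>x. \<bar>f x\<bar> powr p) powr (1 / p)"

definition lp_bounded :: "real \<Rightarrow> (int ^ 'n \<Rightarrow> real) \<Rightarrow> real \<Rightarrow> bool" where
  "lp_bounded p f M \<longleftrightarrow> in_lp p f \<and> lp_norm p f \<le> M"

definition lattice_symmetric :: "(int ^ 'n \<Rightarrow> real) \<Rightarrow> bool" where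
  "lattice_symmetric f \<longleftrightarrow>
     (\<forall>x i. f (\<chi> j. if j = i then - (x $ j) else x $ j) = f x) \<and>
     (\<forall>x \<pi>. bij \<pi> \<longrightarrow> f (\<chi> j. x $ \<pi> j) = f x)"

definition tilt :: "real ^ 'n \<Rightarrow> (int ^ 'n \<Rightarrow> real) \<Rightarrow> int ^ 'n \<Rightarrow> real" where
  "tilt \<mu> f x = f x * exp (\<mu> \<bullet> rvec x)"

definition p_exp :: "nat \<Rightarrow> real \<Rightarrow> real" where
  "p_exp d \<zeta> = (if d = 1 then 2 else real d / (real d - 2 + min \<zeta> 2))"

definition class_Q ::
  "real \<Rightarrow> real \<Rightarrow> real \<Rightarrow> ((int ^ 'n \<Rightarrow> real) \<times> (int ^ 'n \<Rightarrow> real)) set" where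
  "class_Q M K \<zeta> = {(Q, g).
     (lp_bounded 1 Q M \<and>
      lp_bounded 1 (\<lambda>y. norm (rvec y) powr (2 + \<zeta>) * Q y) M) \<and>
     (\<forall>k :: real ^ 'n. (\<forall>i. k $ i \<in> {-pi..pi}) \<longrightarrow>
        Re (fourier Q 0 - fourier Q k) \<ge> K * (norm k)\<^sup>2) \<and>
     (lp_bounded 1 g M \<and>
      lp_bounded 1 (\<lambda>y. norm (rvec y) powr \<zeta> * g y) M \<and>
      lp_bounded (min (p_exp CARD('n) \<zeta>) 2) (\<lambda>y. (norm (rvec y))\<^sup>2 * g y) M) \<and>
     (CARD('n) \<ge> 4 \<longrightarrow>
      lp_bounded (min (real CARD('n) / 3) 2) (\<lambda>y. norm (rvec y) ^ (CARD('n) - 1) * Q y) M \<and>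
      lp_bounded 2 (\<lambda>y. norm (rvec y) ^ (CARD('n) - 1) * g y) M)}"

text \<open>
  In the rest, \<open>S\<close>, \<open>J\<close>, \<open>h\<close> are the functions \<open>S\<^sub>z\<close>, \<open>J\<^sub>z\<close>, \<open>h\<^sub>z\<close> at one fixed \<open>z\<close>. The parameter
  \<open>e\<close> is the coordinate playing the role of the first one, so \<^term>\<open>axis e 1\<close> is \<open>e\<^sub>1\<close>
  (a finite index type has no distinguished first element).
\<close>

definition chi_tilt :: "real ^ 'n \<Rightarrow> (int ^ 'n \<Rightarrow> real) \<Rightarrow> real" where
  "chi_tilt \<mu> S = (\<Sum>\<^sub>\<infinity>x. tilt \<mu> S x)"

definition chi0 :: "(int ^ 'n \<Rightarrow> real) \<Rightarrow> real" where
  "chi0 S = chi_tilt 0 S"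

text \<open>For \<open>S \<ge> 0\<close>, summability is the assertion that the tilted susceptibility is finite.\<close>
definition Omega :: "(int ^ 'n \<Rightarrow> real) \<Rightarrow> (real ^ 'n) set" where
  "Omega S = {\<mu>. tilt \<mu> S summable_on UNIV}"

text \<open>Under \<open>assumption1\<close> the set below is nonempty and bounded, so the real supremum is
  the usual one.\<close>
definition mass :: "'n \<Rightarrow> (int ^ 'n \<Rightarrow> real) \<Rightarrow> real" where
  "mass e S = Sup {t. t \<ge> 0 \<and> t *\<^sub>R axis e 1 \<in> Omega S}"

text \<open>The lower bound in \<open>class_Q\<close> at \<open>\<mu> = 0\<close> gives \<open>\<sigma>\<^sup>2 \<ge> 2 d K > 0\<close>, so \<open>sigmaJ\<close> is the
  positive root; a positive value in turn entails that the sum converges.\<close>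
definition sigmaJ :: "(int ^ 'n \<Rightarrow> real) \<Rightarrow> real" where
  "sigmaJ J = sqrt (\<Sum>\<^sub>\<infinity>x. (norm (rvec x))\<^sup>2 * J x)"

definition assumption1 :: "'n \<Rightarrow> (int ^ 'n \<Rightarrow> real) \<Rightarrow> bool" where
  "assumption1 e S \<longleftrightarrow> lattice_symmetric S \<and> open (Omega S) \<and> 0 \<in> Omega S \<and>
     (\<exists>\<mu>1 > 0. \<mu>1 *\<^sub>R axis e 1 \<notin> Omega S)"

text \<open>The Fourier transform of a real function at \<open>0\<close> is real, so its real part is its value.\<close>
definition assumption2 ::
  "(int ^ 'n \<Rightarrow> real) \<Rightarrow> (int ^ 'n \<Rightarrow> real) \<Rightarrow> (int ^ 'n \<Rightarrow> real) \<Rightarrow> bool" where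
  "assumption2 S J h \<longleftrightarrow>
     (\<forall>x. S x = h x + conv J S x) \<and>
     lattice_symmetric J \<and> lattice_symmetric h \<and> in_lp 1 J \<and> in_lp 1 h \<and>
     (\<exists>M K \<zeta>. M > 0 \<and> K > 0 \<and> \<zeta> > 0 \<and>
        (\<forall>\<mu> \<in> closure (Omega S). (tilt \<mu> J, tilt \<mu> h) \<in> class_Q M K \<zeta>)) \<and>
     (\<forall>\<mu> \<in> closure (Omega S). Re (fourier (tilt \<mu> h) 0) > 0)"

definition moment :: "real \<Rightarrow> (int ^ 'n \<Rightarrow> real) \<Rightarrow> real" where
  "moment \<phi> S = (\<Sum>\<^sub>\<infinity>x. pow0 (norm (rvec x)) \<phi> * S x)"

definition corr_length :: "real \<Rightarrow> (int ^ 'n \<Rightarrow> real) \<Rightarrow> real" where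
  "corr_length \<phi> S = (1 / chi0 S * moment \<phi> S) powr (1 / \<phi>)"

definition green1 :: "real ^ 'n \<Rightarrow> real" where
  "green1 y = (LBINT t:{0<..}. (2 * pi * t) powr (- (real CARD('n) / 2))
                 * exp (- (1 / (2 * t)) * (norm y)\<^sup>2) * exp (- (1 / 2) * t))"

definition A_const :: "'n::finite itself \<Rightarrow> real \<Rightarrow> real" where
  "A_const _ \<phi> = (LINT y :: real ^ 'n | lborel. pow0 (norm y) \<phi> * green1 y)"

end

theory Submission
  imports Defs "HOL-Probability.Probability" "HOL-Real_Asymp.Real_Asymp"
begin

text \<open>
  Tilting the convolution equation gives \<open>\<Sum> S\<^sub>\<mu> (1 - \<Sum> J\<^sub>\<mu>) = \<Sum> h\<^sub>\<mu>\<close>, and since the tilted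
  susceptibility must blow up at \<open>\<mu> = m e\<^sub>1\<close>, the tilted sum of \<open>J\<close> equals \<open>1\<close> there. Expanding to
  second order, with an error controlled uniformly by the \<open>2 + \<zeta>\<close> moments of the tilted \<open>J\<close>, one finds
  \<open>1 - \<Sum> J exp (\<nu> \<bullet> x) \<sim> (m\<^sup>2 - \<nu> \<bullet> \<nu>) \<sigma>\<^sup>2 / (2 d)\<close> at complex frequencies \<open>\<nu>\<close> of order \<open>m\<close>.
  Hence the law on \<open>\<real>\<^sup>d\<close> giving weight \<open>S(x) / \<chi>\<close> to the point \<open>m x\<close> has characteristic function converging
  to \<open>1 / (1 + \<bar>k\<bar>\<^sup>2)\<close>, that of the density \<open>\<bbbG>\<^sub>1 / 2\<close>, and has uniformly bounded exponential moments; so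
  its absolute moments converge.
\<close>

section \<open>Gaussian integrals\<close>

text \<open>The hypotheses constrain \<open>J\<close> and \<open>h\<close> on the closure of
  \<open>Omega S\<close> and say nothing pointwise about \<open>S\<close>. So \<open>S\<close> is
  reached through sums against exponentials, where it is the transform of \<open>h\<close> divided
  by one minus that of \<open>J\<close>. The tilt at the mass lies on the boundary of
  \<open>Omega S\<close>: within reach of the uniform bounds, yet outside the domain where
  \<open>S\<close> is summable. The bound there and its mirror image dominate every real tilt along
  the axis up to the mass and every Fourier mode, so one Taylor estimate serves all frequencies.
  Subtracting the expansion at the mass removes the unknown sum of \<open>J\<close>; this is where
  the 1 in 1 + |k|^2 comes from.

  Since radial moments are all that is wanted, weak convergence in several dimensions can be
  bypassed: Gaussian averages of characteristic functions already settle radial test functions.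
  Exponential moments come from the tilt at half the mass, where the susceptibility is still of the
  order of its untilted value. The limit in z is taken along sequences, where dominated convergence
  applies.\<close>

text \<open>Lebesgue measure is the image of a finite product of real lines, so this is Fubini for
  products; complex values let Fourier phases factor too.\<close>

lemma lborel_prod_integral:
  fixes f :: "'a::euclidean_space \<Rightarrow> real \<Rightarrow> complex"
  assumes "\<And>b. b \<in> Basis \<Longrightarrow> integrable lborel (f b)"
  shows "integrable lborel (\<lambda>x::'a. \<Prod>b\<in>Basis. f b (x \<bullet> b))"
    and "(LINT x|lborel. (\<Prod>b\<in>Basis. f b (x \<bullet> b))) = (\<Prod>b\<in>Basis. integral\<^sup>L lborel (f b))"
proof -
  interpret product_sigma_finite "\<lambda>_::'a. lborel :: real measure" ..
  have [measurable]: "f b \<in> borel_measurable borel" if "b \<in> Basis" for b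
    using assms[OF that] by (auto dest: borel_measurable_integrable)
  have meas: "(\<lambda>x::'a. \<Prod>b\<in>Basis. f b (x \<bullet> b)) \<in> borel_measurable borel"
    by (intro borel_measurable_prod) (auto intro!: measurable_compose[of _ _ borel])
  have T: "(\<lambda>f. \<Sum>b\<in>Basis. f b *\<^sub>R b) \<in> (\<Pi>\<^sub>M b\<in>(Basis::'a set). lborel) \<rightarrow>\<^sub>M (borel :: 'a measure)"
    by measurable
  have *: "(\<Prod>b\<in>Basis. f b ((\<Sum>b\<in>Basis. y b *\<^sub>R b) \<bullet> b)) = (\<Prod>b\<in>Basis. f b (y b))" for y :: "'a \<Rightarrow> real"
    by (intro prod.cong) auto
  show "integrable lborel (\<lambda>x::'a. \<Prod>b\<in>Basis. f b (x \<bullet> b))"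
    by (subst lborel_eq, subst integrable_distr_eq[OF T meas])
       (simp add: * product_integrable_prod assms)
  show "(LINT x|lborel. (\<Prod>b\<in>Basis. f b (x \<bullet> b))) = (\<Prod>b\<in>Basis. integral\<^sup>L lborel (f b))"
    by (subst lborel_eq, subst integral_distr[OF T meas])
       (simp add: * product_integral_prod assms)
qed

text \<open>The centred Gaussian density with covariance t times the identity: t is the time of a
  Brownian motion, and \<open>green1\<close> integrates this kernel against exp (- t / 2).\<close>

definition heat_kernel :: "real \<Rightarrow> 'a::euclidean_space \<Rightarrow> real" where
  "heat_kernel t y = (2 * pi * t) powr (- (real DIM('a) / 2)) * exp (- ((norm y)\<^sup>2 / (2 * t)))"

lemma heat_kernel_nonneg [simp]: "heat_kernel t y \<ge> 0"
  by (simp add: heat_kernel_def)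

lemma heat_kernel_measurable [measurable]:
  "(\<lambda>(y::'a::euclidean_space, t). heat_kernel t y) \<in> borel_measurable (borel \<Otimes>\<^sub>M borel)"
  unfolding heat_kernel_def by measurable

lemma heat_kernel_measurable' [measurable]:
  "heat_kernel t \<in> borel_measurable (borel :: 'a::euclidean_space measure)"
  unfolding heat_kernel_def by measurable

lemma heat_kernel_eq_prod:
  assumes "t > 0"
  shows "heat_kernel t (y::'a::euclidean_space) = (\<Prod>b\<in>Basis. normal_density 0 (sqrt t) (y \<bullet> b))"
proof -
  have "(\<Prod>b\<in>(Basis::'a set). normal_density 0 (sqrt t) (y \<bullet> b))
      = (\<Prod>b\<in>(Basis::'a set). 1 / sqrt (2 * pi * t)) * (\<Prod>b\<in>Basis. exp (- (y \<bullet> b)\<^sup>2 / (2 * t)))"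
    using assms by (simp add: normal_density_def prod.distrib[symmetric] del: prod_constant)
  also have "(\<Prod>b\<in>Basis. exp (- (y \<bullet> b)\<^sup>2 / (2 * t))) = exp (\<Sum>b\<in>Basis. - (y \<bullet> b)\<^sup>2 / (2 * t))"
    by (simp add: exp_sum)
  also have "(\<Sum>b\<in>Basis. - (y \<bullet> b)\<^sup>2 / (2 * t)) = - ((norm y)\<^sup>2 / (2 * t))"
    by (simp add: norm_eq_sqrt_inner euclidean_inner[of y y] sum_nonneg sum_negf power2_eq_square
             flip: sum_divide_distrib)
  also have "(\<Prod>b\<in>(Basis::'a set). 1 / sqrt (2 * pi * t)) = (2 * pi * t) powr (- (real DIM('a) / 2))"
    using assms by (simp add: powr_half_sqrt[symmetric] powr_minus powr_realpow[symmetric] powr_powr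
       power_one_over divide_simps)
  finally show ?thesis by (simp add: heat_kernel_def)
qed

text \<open>Rescaling by sqrt t reduces this to the characteristic function of the standard normal
  law.\<close>

lemma normal_density_fourier:
  assumes "t > 0"
  shows "integrable lborel (\<lambda>u. normal_density 0 (sqrt t) u *\<^sub>R iexp (s * u))"
    and "(LINT u|lborel. normal_density 0 (sqrt t) u *\<^sub>R iexp (s * u)) = of_real (exp (- (t * s\<^sup>2 / 2)))"
proof -
  have i: "integrable lborel (\<lambda>u. normal_density 0 (sqrt t) u)"
    using assms by auto
  show "integrable lborel (\<lambda>u. normal_density 0 (sqrt t) u *\<^sub>R iexp (s * u))"
    by (rule Bochner_Integration.integrable_bound[OF i]) (auto simp: normal_density_nonneg)
  have "(LINT u|lborel. normal_density 0 (sqrt t) u *\<^sub>R iexp (s * u))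
      = sqrt t *\<^sub>R (LINT u|lborel. normal_density 0 (sqrt t) (0 + sqrt t * u) *\<^sub>R iexp (s * (0 + sqrt t * u)))"
    using assms by (subst lborel_integral_real_affine[where c = "sqrt t" and t = 0]) auto
  also have "\<dots> = (LINT u|lborel. std_normal_density u *\<^sub>R iexp (s * sqrt t * u))"
    unfolding integral_scaleR_right[symmetric] using assms
    by (intro Bochner_Integration.integral_cong)
       (auto simp: normal_density_def real_sqrt_mult power_mult_distrib mult.assoc)
  also have "\<dots> = char std_normal_distribution (s * sqrt t)"
    unfolding char_def by (subst integral_density) (auto simp: normal_density_nonneg)
  also have "\<dots> = of_real (exp (- (t * s\<^sup>2 / 2)))"
    using assms unfolding char_std_normal_distribution by (simp add: power_mult_distrib mult.commute)
  finally show "(LINT u|lborel. normal_density 0 (sqrt t) u *\<^sub>R iexp (s * u)) = of_real (exp (- (t * s\<^sup>2 / 2)))" .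
qed

text \<open>Kernel and phase both factor over the coordinates, leaving one-dimensional normal
  integrals; the cosine is the real part.\<close>

lemma heat_kernel_fourier:
  fixes k :: "'a::euclidean_space"
  assumes "t > 0"
  shows "integrable lborel (heat_kernel t :: 'a \<Rightarrow> real)"
    and "(LINT y|lborel. heat_kernel t y * cos (k \<bullet> y)) = exp (- (t * (norm k)\<^sup>2 / 2))"
proof -
  have eq: "heat_kernel t y *\<^sub>R iexp (k \<bullet> y) = (\<Prod>b\<in>Basis. normal_density 0 (sqrt t) (y \<bullet> b) *\<^sub>R iexp ((k \<bullet> b) * (y \<bullet> b)))" for k y :: 'a
  proof -
    have "iexp (k \<bullet> y) = exp (\<Sum>b\<in>Basis. \<i> * complex_of_real ((k \<bullet> b) * (y \<bullet> b)))"
      by (subst euclidean_inner) (simp add: sum_distrib_left)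
    also have "\<dots> = (\<Prod>b\<in>Basis. iexp ((k \<bullet> b) * (y \<bullet> b)))" by (simp add: exp_sum)
    finally show ?thesis
      by (simp add: heat_kernel_eq_prod[OF assms] scaleR_conv_of_real prod.distrib)
  qed
  have I: "integrable lborel (\<lambda>y. heat_kernel t y *\<^sub>R iexp (k \<bullet> y))" for k :: 'a
    unfolding eq by (intro lborel_prod_integral(1) normal_density_fourier assms)
  from I[of 0] have "integrable lborel (\<lambda>y::'a. complex_of_real (heat_kernel t y))"
    by (simp add: scaleR_conv_of_real)
  then show "integrable lborel (heat_kernel t :: 'a \<Rightarrow> real)"
    by (auto dest: integrable_Re)
  have "(LINT y|lborel. heat_kernel t y *\<^sub>R iexp (k \<bullet> y)) =
      (\<Prod>b\<in>Basis. LINT u|lborel. normal_density 0 (sqrt t) u *\<^sub>R iexp ((k \<bullet> b) * u))"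
    unfolding eq by (intro lborel_prod_integral(2) normal_density_fourier assms)
  also have "\<dots> = (\<Prod>b\<in>Basis. of_real (exp (- (t * (k \<bullet> b)\<^sup>2 / 2))))"
    by (intro prod.cong refl normal_density_fourier(2) assms)
  also have "\<dots> = of_real (exp (\<Sum>b\<in>Basis. - (t * (k \<bullet> b)\<^sup>2 / 2)))"
    by (simp add: exp_sum)
  also have "(\<Sum>b\<in>Basis. - (t * (k \<bullet> b)\<^sup>2 / 2)) = - (t * (norm k)\<^sup>2 / 2)"
    by (simp add: norm_eq_sqrt_inner euclidean_inner[of k k] sum_nonneg sum_negf power2_eq_square
             flip: sum_divide_distrib sum_distrib_left)
  finally have "Re (LINT y|lborel. heat_kernel t y *\<^sub>R iexp (k \<bullet> y)) = exp (- (t * (norm k)\<^sup>2 / 2))"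
    by (simp del: of_real_exp)
  then show "(LINT y|lborel. heat_kernel t y * cos (k \<bullet> y)) = exp (- (t * (norm k)\<^sup>2 / 2))"
    by (subst (asm) integral_Re[symmetric, OF I]) (simp add: Re_exp)
qed

section \<open>Polar coordinates and Gaussian moments\<close>

text \<open>The density is the derivative of the volume of a ball in its radius, so both measures
  agree on the half-lines \<open>{..a}\<close>; these are stable under intersection and generate the
  Borel sets.\<close>

lemma distr_norm_lborel:
  "distr (lborel :: 'a::euclidean_space measure) borel norm =
   density lborel (\<lambda>r. ennreal (indicator {0..} r * (unit_ball_vol (real DIM('a)) * real DIM('a) * r ^ (DIM('a) - 1))))"
  (is "?L = density lborel ?g")
proof (rule measure_eqI_generator_eq[where E = "range (\<lambda>a::real. {..a})" and \<Omega> = UNIV and A = "\<lambda>n. {..real n}"])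
  let ?c = "unit_ball_vol (real DIM('a))"
  show "Int_stable (range (\<lambda>a::real. {..a}))"
    by (auto simp: Int_stable_def)
  have em: "emeasure ?L {..a} = ennreal (if a \<ge> 0 then ?c * a ^ DIM('a) else 0)" for a
  proof -
    have "emeasure ?L {..a} = emeasure lborel (cball (0::'a) a)"
      by (subst emeasure_distr) (auto simp: cball_def intro!: arg_cong[where f = "emeasure lborel"])
    then show ?thesis by (simp add: emeasure_cball)
  qed
  then show "emeasure ?L {..real n} \<noteq> \<infinity>" for n by simp
  show "emeasure ?L X = emeasure (density lborel ?g) X" if "X \<in> range (\<lambda>a::real. {..a})" for X
  proof -
    from that obtain a where X: "X = {..a}" by auto
    have "emeasure (density lborel ?g) {..a} = (\<integral>\<^sup>+ r. ennreal (?c * real DIM('a) * r ^ (DIM('a) - 1)) * indicator {0..a} r \<partial>lborel)"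
      by (subst emeasure_density) (auto intro!: nn_integral_cong split: split_indicator)
    also have "\<dots> = ennreal (if a \<ge> 0 then ?c * a ^ DIM('a) else 0)"
    proof (cases "a \<ge> 0")
      case True
      have "(\<integral>\<^sup>+ r. ennreal (?c * real DIM('a) * r ^ (DIM('a) - 1)) * indicator {0..a} r \<partial>lborel)
          = ?c * a ^ DIM('a) - ?c * 0 ^ DIM('a)"
        using True by (intro nn_integral_FTC_Icc) (auto intro!: derivative_eq_intros)
      with True show ?thesis by simp
    qed (simp add: not_le)
    finally show ?thesis by (simp add: X em)
  qed
  show "sets ?L = sigma_sets UNIV (range (\<lambda>a::real. {..a}))"
    using borel_eq_atMost[where 'a = real] by (metis sets_distr sets_measure_of subset_UNIV Pow_UNIV)
  show "sets (density lborel ?g) = sigma_sets UNIV (range (\<lambda>a::real. {..a}))"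
    using borel_eq_atMost[where 'a = real] by (metis sets_density sets_lborel sets_measure_of subset_UNIV Pow_UNIV)
  show "(\<Union>n. {..real n}) = UNIV"
    using real_arch_simple by auto
qed auto

lemma Gamma_has_bochner_integral:
  assumes "p > (0::real)"
  shows "has_bochner_integral lborel (\<lambda>u. indicator {0<..} u * (u powr (p - 1) * exp (- u))) (Gamma p)"
proof (rule has_bochner_integral_nn_integral)
  have "(\<lambda>t. indicator {0..} t * t powr (p - 1) / exp t) = (\<lambda>u. indicator {0<..} u * (u powr (p - 1) * exp (- u)))"
    by (auto simp: fun_eq_iff exp_minus field_simps split: split_indicator)
  then show "(\<integral>\<^sup>+ u. ennreal (indicator {0<..} u * (u powr (p - 1) * exp (- u))) \<partial>lborel) = ennreal (Gamma p)"
    using Gamma_conv_nn_integral_real[OF assms] by metis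
qed (use assms in \<open>auto simp: Gamma_real_pos less_imp_le\<close>)

lemma Gamma_scaled_has_bochner_integral:
  assumes "p > (0::real)" and a: "a > 0"
  shows "has_bochner_integral lborel (\<lambda>t. indicator {0<..} t * (t powr (p - 1) * exp (- (a * t)))) (Gamma p / a powr p)"
proof -
  have "has_bochner_integral lborel (\<lambda>t. indicator {0<..} (0 + a * t) * ((0 + a * t) powr (p - 1) * exp (- (0 + a * t))))
     (Gamma p /\<^sub>R \<bar>a\<bar>)"
    using a Gamma_has_bochner_integral[OF assms(1)]
    by (subst (asm) lborel_has_bochner_integral_real_affine_iff[of a _ _ 0]) auto
  then have "has_bochner_integral lborel (\<lambda>t. a powr (1 - p) * (indicator {0<..} (0 + a * t) * ((0 + a * t) powr (p - 1) * exp (- (0 + a * t)))))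
     (a powr (1 - p) * (Gamma p /\<^sub>R \<bar>a\<bar>))"
    by (rule has_bochner_integral_mult_right)
  moreover have "a powr (1 - p) * (indicator {0<..} (0 + a * t) * ((0 + a * t) powr (p - 1) * exp (- (0 + a * t))))
      = indicator {0<..} t * (t powr (p - 1) * exp (- (a * t)))" for t
    using a by (auto simp: powr_mult powr_diff zero_less_mult_iff split: split_indicator)
  moreover have "a powr (1 - p) * (Gamma p /\<^sub>R \<bar>a\<bar>) = Gamma p / a powr p"
    using a by (simp add: powr_diff field_simps)
  ultimately show ?thesis by (simp only:)
qed

lemma gauss_radial_integral:
  assumes p: "p > (0::real)" and t: "t > 0"
  shows "has_bochner_integral lborel (\<lambda>r. indicator {0<..} r * (r powr (p - 1) * exp (- (r\<^sup>2 / (2 * t)))))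
          ((2 * t) powr (p / 2) * Gamma (p / 2) / 2)"
proof -
  define f where "f = (\<lambda>r. r powr (p - 1) * exp (- (r\<^sup>2 / (2 * t))))"
  \<comment> \<open>The substitution r = sqrt (2 t u) turns the Gaussian into exp (- u) and the
    integral into a Gamma integral.\<close>
  define g where "g = (\<lambda>u. sqrt (2 * t * u))"
  define g' where "g' = (\<lambda>u. t / sqrt (2 * t * u))"
  have fg: "f (g u) * g' u = (t * (2 * t) powr (p / 2 - 1)) * (u powr (p / 2 - 1) * exp (- u))" if "u > 0" for u
  proof -
    have "f (g u) * g' u = ((2 * t * u) powr (1/2)) powr (p - 1) * exp (- u) * t * (2 * t * u) powr (- (1/2))"
      using that t by (simp add: f_def g_def g'_def powr_half_sqrt powr_minus field_simps)
    also have "((2 * t * u) powr (1/2)) powr (p - 1) * exp (- u) * t * (2 * t * u) powr (- (1/2)) =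
        t * ((2 * t * u) powr ((p - 1) / 2) * (2 * t * u) powr (- (1/2))) * exp (- u)"
      by (simp add: powr_powr)
    also have "(2 * t * u) powr ((p - 1) / 2) * (2 * t * u) powr (- (1/2)) = (2 * t * u) powr (p / 2 - 1)"
      by (simp add: diff_divide_distrib flip: powr_add)
    finally show ?thesis using that t by (simp add: powr_mult)
  qed
  have B: "has_bochner_integral lborel (\<lambda>u. indicator {0<..} u * (f (g u) * g' u)) (t * (2 * t) powr (p / 2 - 1) * Gamma (p / 2))"
  proof -
    have "has_bochner_integral lborel (\<lambda>u. (t * (2 * t) powr (p / 2 - 1)) * (indicator {0<..} u * (u powr (p / 2 - 1) * exp (- u))))
       (t * (2 * t) powr (p / 2 - 1) * Gamma (p / 2))"
      using p by (intro has_bochner_integral_mult_right Gamma_has_bochner_integral) auto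
    also have "(\<lambda>u. (t * (2 * t) powr (p / 2 - 1)) * (indicator {0<..} u * (u powr (p / 2 - 1) * exp (- u))))
       = (\<lambda>u. indicator {0<..} u * (f (g u) * g' u))"
      by (auto simp: fun_eq_iff fg split: split_indicator)
    finally show ?thesis .
  qed
  have E: "einterval 0 \<infinity> = {0::real<..}" by (auto simp: einterval_def)
  have I: "set_integrable lborel (einterval 0 \<infinity>) (\<lambda>u. f (g u) * g' u)"
    unfolding E set_integrable_def using B by (auto dest: has_bochner_integral_integrable integrable.intros)
  have lim0: "((ereal \<circ> g \<circ> real_of_ereal) \<longlongrightarrow> 0) (at_right 0)"
  proof -
    have "(g \<longlongrightarrow> g 0) (at_right 0)"
      unfolding g_def by (intro tendsto_intros)
    then show ?thesis unfolding zero_ereal_def ereal_tendsto_simps by (simp add: g_def)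
  qed
  have lim1: "((ereal \<circ> g \<circ> real_of_ereal) \<longlongrightarrow> \<infinity>) (at_left \<infinity>)"
  proof -
    have "filterlim g at_top at_top"
      unfolding g_def using t
      by (intro filterlim_compose[OF sqrt_at_top] filterlim_tendsto_pos_mult_at_top[OF tendsto_const] filterlim_ident) auto
    then show ?thesis unfolding ereal_tendsto_simps .
  qed
  have D: "DERIV g x :> g' x" if "0 < ereal x" for x
    using that t unfolding g_def g'_def by (auto intro!: derivative_eq_intros simp: divide_simps mult_less_0_iff)
  have c1: "isCont f (g x)" if "0 < ereal x" for x
    using that t unfolding f_def g_def by (auto intro!: continuous_intros)
  have c2: "isCont g' x" if "0 < ereal x" for x
    using that t unfolding g'_def by (auto intro!: continuous_intros)
  note S = interval_integral_substitution_nonneg[of 0 \<infinity> g g' f, OF _ D c1 c2 _ _ lim0 lim1 I]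
  have S1: "set_integrable lborel (einterval 0 \<infinity>) f"
    using t by (intro S(1)) (auto simp: f_def g'_def)
  have "(LBINT x=0..\<infinity>. f x) = (LBINT x=0..\<infinity>. f (g x) * g' x)"
    using t by (intro S(2)) (auto simp: f_def g'_def)
  then have "(LINT x|lborel. indicator {0<..} x * f x) = t * (2 * t) powr (p / 2 - 1) * Gamma (p / 2)"
    using has_bochner_integral_integral_eq[OF B]
    by (simp add: interval_lebesgue_integral_def E set_lebesgue_integral_def)
  also have "\<dots> = (2 * t) powr (p / 2) * Gamma (p / 2) / 2"
    using t by (simp add: powr_diff)
  finally show ?thesis
    using S1 by (simp add: has_bochner_integral_iff E set_integrable_def f_def)
qed

text \<open>In polar coordinates this is \<open>gauss_radial_integral\<close> with p = \<phi> + d.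
  At \<phi> = 0 the integrand differs from the kernel only at the origin, a null set, since 0 powr 0
  = 0.\<close>

lemma heat_kernel_moment:
  assumes t: "t > 0" and \<phi>: "\<phi> \<ge> 0"
  shows "has_bochner_integral lborel (\<lambda>y::'a::euclidean_space. norm y powr \<phi> * heat_kernel t y)
     ((2 * t) powr (\<phi> / 2) * Gamma ((\<phi> + real DIM('a)) / 2) / Gamma (real DIM('a) / 2))"
proof -
  let ?d = "real DIM('a)"
  have d: "?d > 0" by simp
  define G where "G r = r powr \<phi> * ((2 * pi * t) powr (- (?d / 2)) * exp (- (r\<^sup>2 / (2 * t))))" for r
  define w where "w = (\<lambda>r::real. indicator {0..} r * (unit_ball_vol ?d * ?d * r ^ (DIM('a) - 1)))"
  define C where "C = (2 * pi * t) powr (- (?d / 2)) * unit_ball_vol ?d * ?d"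
  have [measurable]: "G \<in> borel_measurable borel" "w \<in> borel_measurable borel"
    unfolding G_def w_def by measurable
  have w0: "w r \<ge> 0" for r by (auto simp: w_def split: split_indicator)
  have "w r * G r = C * (indicator {0<..} r * (r powr (\<phi> + ?d - 1) * exp (- (r\<^sup>2 / (2 * t)))))" for r
  proof (cases "r > 0")
    case True
    have "r ^ (DIM('a) - 1) = r powr (?d - 1)"
      using True by (simp add: powr_realpow[symmetric] of_nat_diff Suc_leI)
    moreover have "r powr (?d - 1) * r powr \<phi> = r powr (\<phi> + ?d - 1)"
      by (simp add: algebra_simps flip: powr_add)
    ultimately show ?thesis using True
      by (simp add: w_def G_def C_def algebra_simps)
  qed (auto simp: w_def G_def split: split_indicator)
  moreover have "has_bochner_integral lborel (\<lambda>r. C * (indicator {0<..} r * (r powr (\<phi> + ?d - 1) * exp (- (r\<^sup>2 / (2 * t))))))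
      (C * ((2 * t) powr ((\<phi> + ?d) / 2) * Gamma ((\<phi> + ?d) / 2) / 2))"
    using t \<phi> d by (intro has_bochner_integral_mult_right gauss_radial_integral) linarith+
  ultimately have "has_bochner_integral lborel (\<lambda>r. w r *\<^sub>R G r) (C * ((2 * t) powr ((\<phi> + ?d) / 2) * Gamma ((\<phi> + ?d) / 2) / 2))"
    by simp
  then have "has_bochner_integral (density lborel w) G (C * ((2 * t) powr ((\<phi> + ?d) / 2) * Gamma ((\<phi> + ?d) / 2) / 2))"
    using w0 by (intro has_bochner_integral_density) auto
  then have "has_bochner_integral lborel (\<lambda>y::'a. G (norm y)) (C * ((2 * t) powr ((\<phi> + ?d) / 2) * Gamma ((\<phi> + ?d) / 2) / 2))"
    unfolding w_def distr_norm_lborel[symmetric]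
    by (simp add: has_bochner_integral_iff integrable_distr_eq integral_distr)
  \<comment> \<open>The ball volume is pi powr (d / 2) / Gamma (d / 2 + 1): its power of pi cancels
    that of the kernel, and the functional equation of Gamma turns d / Gamma (d / 2 + 1) into 2 /
    Gamma (d / 2).\<close>
  moreover have "C * ((2 * t) powr ((\<phi> + ?d) / 2) * Gamma ((\<phi> + ?d) / 2) / 2) =
     (2 * t) powr (\<phi> / 2) * Gamma ((\<phi> + ?d) / 2) / Gamma (?d / 2)"
  proof -
    have "Gamma (?d / 2 + 1) = ?d / 2 * Gamma (?d / 2)"
      by (rule Gamma_plus1) (use d in \<open>auto elim!: nonpos_Ints_cases' simp del: of_nat_0_less_iff DIM_positive\<close>)
    moreover have "(2 * pi * t) powr (- (?d / 2)) = 1 / (pi powr (?d / 2) * (2 * t) powr (?d / 2))"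
      using t by (simp add: powr_minus_divide powr_mult)
    moreover have "(2 * t) powr ((\<phi> + ?d) / 2) = (2 * t) powr (\<phi> / 2) * (2 * t) powr (?d / 2)"
      by (simp add: add_divide_distrib powr_add)
    ultimately show ?thesis
      using t d by (simp add: C_def unit_ball_vol_def)
  qed
  ultimately show ?thesis
    by (simp add: G_def heat_kernel_def)
qed

section \<open>The massive Green function and convergence of moments\<close>

lemma green1_conv_heat_kernel:
  "green1 (y :: real ^ 'n) = (LINT t|lborel. indicator {0<..} t * (exp (- (t / 2)) * heat_kernel t y))"
  unfolding green1_def set_lebesgue_integral_def heat_kernel_def
  by (intro Bochner_Integration.integral_cong) (auto split: split_indicator)

lemma green1_nonneg: "green1 (y :: real ^ 'n) \<ge> 0"
  unfolding green1_conv_heat_kernel by (intro Bochner_Integration.integral_nonneg) (auto split: split_indicator)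

lemma green1_measurable [measurable]: "(green1 :: real ^ 'n \<Rightarrow> real) \<in> borel_measurable borel"
  unfolding green1_conv_heat_kernel[abs_def]
  by (rule lborel.borel_measurable_lebesgue_integral) measurable

text \<open>Fubini in time and space. \<open>B\<close> majorises the integral of |G| against the
  kernel at each time, and \<open>BI\<close> makes this majorant integrable against the
  weight.\<close>

lemma green1_integral:
  fixes G :: "real ^ 'n \<Rightarrow> real"
  assumes [measurable]: "G \<in> borel_measurable borel"
    and I: "\<And>t. t > 0 \<Longrightarrow> integrable lborel (\<lambda>y. G y * heat_kernel t y)"
    and B: "\<And>t. t > 0 \<Longrightarrow> (LINT y|lborel. \<bar>G y\<bar> * heat_kernel t y) \<le> B t"
    and BI: "integrable lborel (\<lambda>t. indicator {0<..} t * (exp (- (t / 2)) * B t))"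
  shows "has_bochner_integral lborel (\<lambda>y. G y * green1 y)
     (LINT t|lborel. indicator {0<..} t * (exp (- (t / 2)) * (LINT y|lborel. G y * heat_kernel t y)))"
proof -
  define F :: "real \<Rightarrow> real ^ 'n \<Rightarrow> real" where
    "F t y = indicator {0<..} t * (exp (- (t / 2)) * (G y * heat_kernel t y))" for t y
  have [measurable]: "case_prod F \<in> borel_measurable (borel \<Otimes>\<^sub>M borel)"
    unfolding F_def by measurable
  have nF: "(LINT y|lborel. norm (F t y)) = indicator {0<..} t * (exp (- (t / 2)) * (LINT y|lborel. \<bar>G y\<bar> * heat_kernel t y))" for t
    by (auto simp: F_def abs_mult split: split_indicator)
  have FI: "integrable (lborel \<Otimes>\<^sub>M lborel) (case_prod F)"
  proof (rule lborel_pair.Fubini_integrable)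
    show "integrable lborel (\<lambda>t. LINT y|lborel. norm (case_prod F (t, y)))"
    proof (rule Bochner_Integration.integrable_bound[OF BI])
      show "(\<lambda>t. LINT y|lborel. norm (case_prod F (t, y))) \<in> borel_measurable lborel"
        by (rule lborel.borel_measurable_lebesgue_integral) measurable
      show "AE t in lborel. norm (LINT y|lborel. norm (case_prod F (t, y))) \<le> norm (indicator {0<..} t * (exp (- (t / 2)) * B t))"
      proof (rule AE_I2)
        fix t :: real
        have "0 \<le> (LINT y|lborel. \<bar>G y\<bar> * heat_kernel t y)"
          by (intro Bochner_Integration.integral_nonneg) auto
        then show "norm (LINT y|lborel. norm (case_prod F (t, y))) \<le> norm (indicator {0<..} t * (exp (- (t / 2)) * B t))"
          using B[of t] unfolding nF case_prod_conv by (auto simp: abs_mult split: split_indicator)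
      qed
    qed
    show "AE t in lborel. integrable lborel (\<lambda>y. case_prod F (t, y))"
      using I by (intro AE_I2) (auto simp: F_def split: split_indicator)
  qed simp
  have F': "F t y = G y * (indicator {0<..} t * (exp (- (t / 2)) * heat_kernel t y))" for t y
    by (simp add: F_def)
  have inner: "(LINT t|lborel. F t y) = G y * green1 y" for y
    unfolding green1_conv_heat_kernel F' by (rule integral_mult_right_zero)
  have "integrable lborel (\<lambda>y. LINT t|lborel. F t y)"
    using lborel_pair.integrable_snd[OF FI] .
  moreover have "(LINT y|lborel. LINT t|lborel. F t y) = (LINT t|lborel. LINT y|lborel. F t y)"
    by (rule lborel_pair.Fubini_integral[OF FI])
  moreover have "(LINT y|lborel. F t y) = indicator {0<..} t * (exp (- (t / 2)) * (LINT y|lborel. G y * heat_kernel t y))" for t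
    by (simp add: F_def)
  ultimately show ?thesis
    by (simp add: inner has_bochner_integral_iff)
qed

text \<open>The Gaussian moment is proportional to t powr (\<phi> / 2), so the time integral is a
  Gamma integral at (\<phi> + 2) / 2 with rate 1/2. The powers 2 powr (\<phi> / 2) and 2 powr
  ((\<phi> + 2) / 2) combine to 2 powr (\<phi> + 1).\<close>

lemma green1_moment:
  assumes "\<phi> \<ge> 0"
  shows "has_bochner_integral lborel (\<lambda>y::real ^ 'n. norm y powr \<phi> * green1 y)
    (2 powr (\<phi> + 1) * (Gamma ((\<phi> + 2) / 2) * Gamma ((\<phi> + real CARD('n)) / 2) / Gamma (real CARD('n) / 2)))"
proof -
  let ?d = "real CARD('n)"
  define C where "C = 2 powr (\<phi> / 2) * (Gamma ((\<phi> + ?d) / 2) / Gamma (?d / 2))"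
  have H: "has_bochner_integral lborel (\<lambda>y::real ^ 'n. norm y powr \<phi> * heat_kernel t y) (C * t powr (\<phi> / 2))" if "t > 0" for t
    using heat_kernel_moment[OF that assms, where 'a = "real ^ 'n"] that by (simp add: C_def powr_mult mult_ac)
  have eq: "indicator {0<..} t * (exp (- (t / 2)) * (C * t powr (\<phi> / 2))) =
     C * (indicator {0<..} t * (t powr ((\<phi> + 2) / 2 - 1) * exp (- ((1/2) * t))))" for t
    by (simp add: add_divide_distrib mult_ac)
  have T: "has_bochner_integral lborel (\<lambda>t. indicator {0<..} t * (exp (- (t / 2)) * (C * t powr (\<phi> / 2))))
      (C * (Gamma ((\<phi> + 2) / 2) / (1/2) powr ((\<phi> + 2) / 2)))"
    unfolding eq using assms by (intro has_bochner_integral_mult_right Gamma_scaled_has_bochner_integral) auto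
  have "has_bochner_integral lborel (\<lambda>y::real ^ 'n. norm y powr \<phi> * green1 y)
     (LINT t|lborel. indicator {0<..} t * (exp (- (t / 2)) * (LINT y|lborel. norm (y :: real ^ 'n) powr \<phi> * heat_kernel t y)))"
    using H T by (intro green1_integral[where B = "\<lambda>t. C * t powr (\<phi> / 2)"]) (auto simp: has_bochner_integral_iff)
  also have "(LINT t|lborel. indicator {0<..} t * (exp (- (t / 2)) * (LINT y|lborel. norm (y :: real ^ 'n) powr \<phi> * heat_kernel t y)))
     = (LINT t|lborel. indicator {0<..} t * (exp (- (t / 2)) * (C * t powr (\<phi> / 2))))"
    using H by (intro Bochner_Integration.integral_cong) (auto simp: has_bochner_integral_iff split: split_indicator)
  also have "\<dots> = C * (Gamma ((\<phi> + 2) / 2) / (1/2) powr ((\<phi> + 2) / 2))"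
    using T by (simp add: has_bochner_integral_iff)
  also have "\<dots> = (2 powr (\<phi> / 2) * 2 powr ((\<phi> + 2) / 2)) * (Gamma ((\<phi> + 2) / 2) * Gamma ((\<phi> + ?d) / 2) / Gamma (?d / 2))"
    by (simp add: C_def powr_divide)
  also have "2 powr (\<phi> / 2) * 2 powr ((\<phi> + 2) / 2) = 2 powr (\<phi> + 1)"
    by (simp add: add_divide_distrib flip: powr_add)
  finally show ?thesis .
qed

text \<open>The spatial Fourier transform leaves exp (- t (1 + |k|^2) / 2) to be integrated over
  time. At k = 0 this yields the total mass 2.\<close>

lemma green1_fourier:
  fixes k :: "real ^ 'n"
  shows "has_bochner_integral lborel (\<lambda>y. cos (k \<bullet> y) * green1 y) (2 / (1 + (norm k)\<^sup>2))"
proof -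
  have E: "has_bochner_integral lborel (\<lambda>t. indicator {0<..} t * exp (- (a * t))) (1 / a)" if "a > 0" for a :: real
  proof -
    have "indicator {0<..} t * (t powr (1 - 1) * exp (- (a * t))) = indicator {0<..} t * exp (- (a * t))" for t :: real
      by (auto split: split_indicator)
    then show ?thesis
      using Gamma_scaled_has_bochner_integral[of 1 a, OF _ that] that by (simp only:) simp
  qed
  have HI: "integrable lborel (heat_kernel t :: real ^ 'n \<Rightarrow> real)" if "t > 0" for t
    by (rule heat_kernel_fourier(1)[OF that])
  have H1: "(LINT y|lborel. heat_kernel t (y :: real ^ 'n)) = 1" if "t > 0" for t
    using heat_kernel_fourier(2)[OF that, of "0 :: real ^ 'n"] by simp
  have CI: "integrable lborel (\<lambda>y. cos (k \<bullet> y) * heat_kernel t y)" if "t > 0" for t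
    by (rule Bochner_Integration.integrable_bound[OF HI[OF that]]) (auto simp: abs_mult mult_left_le_one_le)
  have "(LINT y|lborel. \<bar>cos (k \<bullet> y)\<bar> * heat_kernel t y) \<le> 1" if "t > 0" for t
  proof -
    have "(LINT y|lborel. \<bar>cos (k \<bullet> y)\<bar> * heat_kernel t y) \<le> (LINT y|lborel. heat_kernel t (y :: real ^ 'n))"
      using integrable_abs[OF CI[OF that]]
      by (intro integral_mono HI that) (auto simp: abs_mult mult_left_le_one_le)
    then show ?thesis using H1[OF that] by simp
  qed
  then have "has_bochner_integral lborel (\<lambda>y. cos (k \<bullet> y) * green1 y)
     (LINT t|lborel. indicator {0<..} t * (exp (- (t / 2)) * (LINT y|lborel. cos (k \<bullet> y) * heat_kernel t y)))"
    using E[of "1/2"] CI by (intro green1_integral[where B = "\<lambda>_. 1"]) (auto simp: has_bochner_integral_iff)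
  also have "(LINT t|lborel. indicator {0<..} t * (exp (- (t / 2)) * (LINT y|lborel. cos (k \<bullet> y) * heat_kernel t y)))
      = (LINT t|lborel. indicator {0<..} t * exp (- ((1 + (norm k)\<^sup>2) / 2 * t)))"
    using heat_kernel_fourier(2)[of _ k]
    by (intro Bochner_Integration.integral_cong refl)
       (auto simp: mult.commute[of "cos _"] exp_add[symmetric] algebra_simps add_divide_distrib split: split_indicator)
  also have "\<dots> = 2 / (1 + (norm k)\<^sup>2)"
    using E[of "(1 + (norm k)\<^sup>2) / 2"] by (simp add: has_bochner_integral_iff add_pos_nonneg)
  finally show ?thesis .
qed

section \<open>Radial moments from characteristic functions\<close>

text \<open>The approximation error must be uniform in n, while the sequence and its limit may
  depend on \<epsilon>. It serves both polynomial approximation and truncation.\<close>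

lemma LIMSEQ_approx:
  fixes s :: "nat \<Rightarrow> real"
  assumes "\<And>\<epsilon>. \<epsilon> > 0 \<Longrightarrow> \<exists>c L'. c \<longlonglongrightarrow> L' \<and> (\<forall>n. \<bar>s n - c n\<bar> \<le> \<epsilon>) \<and> \<bar>L - L'\<bar> \<le> \<epsilon>"
  shows "s \<longlonglongrightarrow> L"
proof (rule LIMSEQ_I)
  fix r :: real assume "r > 0"
  then obtain c L' where c: "c \<longlonglongrightarrow> L'" "\<And>n. \<bar>s n - c n\<bar> \<le> r / 4" "\<bar>L - L'\<bar> \<le> r / 4"
    using assms[of "r / 4"] by auto
  obtain N where N: "\<And>n. n \<ge> N \<Longrightarrow> norm (c n - L') < r / 4"
    using LIMSEQ_D[OF c(1), of "r / 4"] \<open>r > 0\<close> by auto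
  have "norm (s n - L) < r" if "n \<ge> N" for n
    using c(2)[of n] c(3) N[OF that] \<open>r > 0\<close> unfolding real_norm_def by linarith
  then show "\<exists>N. \<forall>n\<ge>N. norm (s n - L) < r" by blast
qed

text \<open>The Gaussian in x is itself the Fourier transform of the heat kernel, which here lives
  on the frequency side; Fubini then exposes the real part of the characteristic function.\<close>

lemma gaussian_average:
  fixes P :: "'a::euclidean_space measure"
  assumes P: "prob_space P" and S: "sets P = sets borel" and t: "t > 0"
  shows "(LINT x|P. exp (- (t * (norm x)\<^sup>2 / 2))) = (LINT g|lborel. heat_kernel t g * (LINT x|P. cos (g \<bullet> x)))"
proof -
  interpret P: prob_space P by fact
  note S[measurable_cong]
  interpret pair_sigma_finite lborel P ..
  have I: "integrable (lborel \<Otimes>\<^sub>M P) (\<lambda>(g, x). heat_kernel t g * cos (g \<bullet> x))"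
  proof (rule Fubini_integrable)
    show "integrable lborel (\<lambda>g. LINT x|P. norm (case (g, x) of (g, x) \<Rightarrow> heat_kernel t g * cos (g \<bullet> x)))"
    proof (rule Bochner_Integration.integrable_bound[OF heat_kernel_fourier(1)[OF t]])
      show "(\<lambda>g. LINT x|P. norm (case (g, x) of (g, x) \<Rightarrow> heat_kernel t g * cos (g \<bullet> x))) \<in> borel_measurable lborel"
        unfolding prod.case by measurable
      show "AE g in lborel. norm (LINT x|P. norm (case (g, x) of (g, x) \<Rightarrow> heat_kernel t g * cos (g \<bullet> x))) \<le> norm (heat_kernel t g)"
      proof (rule AE_I2)
        fix g :: 'a
        have "(LINT x|P. \<bar>cos (g \<bullet> x)\<bar>) \<le> (LINT x|P. 1)"
          by (intro integral_mono P.integrable_const_bound[where B = 1]) auto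
        then have "(LINT x|P. \<bar>cos (g \<bullet> x)\<bar>) \<le> 1" by (simp add: P.prob_space)
        moreover have "(LINT x|P. \<bar>cos (g \<bullet> x)\<bar>) \<ge> 0" by simp
        ultimately show "norm (LINT x|P. norm (case (g, x) of (g, x) \<Rightarrow> heat_kernel t g * cos (g \<bullet> x))) \<le> norm (heat_kernel t g)"
          by (simp add: abs_mult mult_left_le)
      qed
    qed
    show "AE g in lborel. integrable P (\<lambda>x. case (g, x) of (g, x) \<Rightarrow> heat_kernel t g * cos (g \<bullet> x))"
      by (intro AE_I2) (auto intro!: P.integrable_const_bound[where B = 1])
  qed measurable
  have "(LINT g|lborel. heat_kernel t g * cos (g \<bullet> x)) = exp (- (t * (norm x)\<^sup>2 / 2))" for x :: 'a
    using heat_kernel_fourier(2)[OF t, of x] by (simp add: inner_commute)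
  then have "(LINT x|P. exp (- (t * (norm x)\<^sup>2 / 2))) = (LINT x|P. LINT g|lborel. heat_kernel t g * cos (g \<bullet> x))"
    by simp
  also have "\<dots> = (LINT g|lborel. LINT x|P. heat_kernel t g * cos (g \<bullet> x))"
    by (rule Fubini_integral[OF I])
  finally show ?thesis by simp
qed

text \<open>By Gaussian averaging, the characteristic functions control the expectations of
  \<open>exp (- t \<bar>x\<bar>\<^sup>2)\<close> for all \<open>t\<close>, that is, of all polynomials in \<open>u = exp (- \<bar>x\<bar>\<^sup>2)\<close>, and by Weierstrass
  of all continuous functions of \<open>u \<in> [0, 1]\<close>. The power \<open>\<bar>x\<bar>\<^sup>\<phi>\<close> truncated at a large radius is one of these.\<close>
theorem norm_powr_moment_convergence:
  fixes P :: "nat \<Rightarrow> 'a::euclidean_space measure" and Q :: "'a measure"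
  assumes P: "\<And>n. prob_space (P n)" and SP: "\<And>n. sets (P n) = sets borel"
    and Q: "prob_space Q" and SQ: "sets Q = sets borel"
    and char: "\<And>k. (\<lambda>n. LINT x|P n. cos (k \<bullet> x)) \<longlonglongrightarrow> (LINT x|Q. cos (k \<bullet> x))"
    and momP: "\<And>q. q > 0 \<Longrightarrow> \<exists>B. \<forall>n. integrable (P n) (\<lambda>x. norm x powr q) \<and> (LINT x|P n. norm x powr q) \<le> B"
    and momQ: "\<And>q. q > 0 \<Longrightarrow> integrable Q (\<lambda>x. norm x powr q)"
    and \<phi>: "\<phi> > 0"
  shows "(\<lambda>n. LINT x|P n. norm x powr \<phi>) \<longlonglongrightarrow> (LINT x|Q. norm x powr \<phi>)"
proof -
  have bdd: "integrable N (\<lambda>x. f x)" if "prob_space N" "sets N = sets borel" "f \<in> borel_measurable borel" "\<And>x. \<bar>f x\<bar> \<le> B"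
    for N :: "'a measure" and f :: "'a \<Rightarrow> real" and B
  proof -
    interpret prob_space N by fact
    show ?thesis using that(2-) by (intro integrable_const_bound[where B = B]) auto
  qed
  have close: "\<bar>(LINT x|N. f x) - (LINT x|N. g x)\<bar> \<le> \<epsilon>"
    if "prob_space N" "integrable N f" "integrable N g" "\<And>x. \<bar>f x - g x\<bar> \<le> \<epsilon>"
    for N :: "'a measure" and f g :: "'a \<Rightarrow> real" and \<epsilon>
  proof -
    interpret prob_space N by fact
    have "\<bar>(LINT x|N. f x) - (LINT x|N. g x)\<bar> = \<bar>LINT x|N. f x - g x\<bar>"
      using that by simp
    also have "\<dots> \<le> (LINT x|N. \<bar>f x - g x\<bar>)" by (rule integral_abs_bound)
    also have "\<dots> \<le> (LINT x|N. \<epsilon>)" using that by (intro integral_mono) auto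
    finally show ?thesis by (simp add: prob_space)
  qed
  have gauss: "(\<lambda>n. LINT x|P n. exp (- (t * (norm x)\<^sup>2 / 2))) \<longlonglongrightarrow> (LINT x|Q. exp (- (t * (norm x)\<^sup>2 / 2)))"
    if t: "t > 0" for t
  proof -
    have cm: "(\<lambda>g. LINT x|N. cos (g \<bullet> x)) \<in> borel_measurable borel" "\<bar>LINT x|N. cos (g \<bullet> x)\<bar> \<le> 1"
      if "prob_space N" "sets N = sets borel" for N :: "'a measure" and g
    proof -
      interpret prob_space N by fact
      note that(2)[measurable_cong]
      show "(\<lambda>g. LINT x|N. cos (g \<bullet> x)) \<in> borel_measurable borel"
        by measurable
      have "integrable N (\<lambda>x. cos (g \<bullet> x))"
        by (rule bdd[OF that, where B = 1]) auto
      from close[OF that(1) this, of "\<lambda>_. 0" 1] show "\<bar>LINT x|N. cos (g \<bullet> x)\<bar> \<le> 1"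
        by simp
    qed
    \<comment> \<open>Characteristic functions are bounded by 1, so the kernel dominates and
      pointwise convergence in the frequency is enough.\<close>
    show ?thesis
      unfolding gaussian_average[OF P SP t] gaussian_average[OF Q SQ t]
      by (rule integral_dominated_convergence[where w = "heat_kernel t"])
         (auto intro!: heat_kernel_fourier(1) t tendsto_mult char cm P Q SP SQ borel_measurable_times AE_I2 simp: abs_mult mult_left_le cm(2)[OF P SP])
  qed
  have cont: "(\<lambda>n. LINT x|P n. f (exp (- (norm x)\<^sup>2))) \<longlonglongrightarrow> (LINT x|Q. f (exp (- (norm x)\<^sup>2)))"
    if f: "continuous_on UNIV f" for f :: "real \<Rightarrow> real"
  proof (rule LIMSEQ_approx)
    fix \<epsilon> :: real assume "\<epsilon> > 0"
    obtain g where g: "real_polynomial_function g" "\<And>u. u \<in> {0..1} \<Longrightarrow> \<bar>f u - g u\<bar> < \<epsilon>"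
      using Stone_Weierstrass_real_polynomial_function[of "{0..1}" f \<epsilon>] f \<open>\<epsilon> > 0\<close>
      by (auto intro: continuous_on_subset)
    then obtain a N where gs: "g = (\<lambda>u. \<Sum>i\<le>N. a i * u ^ i)"
      using real_polynomial_function_iff_sum by blast
    have power: "exp (- (norm x)\<^sup>2) ^ i = exp (- (2 * real i * (norm x)\<^sup>2 / 2))" for x :: 'a and i
      by (simp flip: exp_of_nat_mult)
    have pI: "integrable N (\<lambda>x. exp (- (norm x)\<^sup>2) ^ i)" if "prob_space N" "sets N = sets borel" for N :: "'a measure" and i
      by (rule bdd[OF that, of _ 1]) (auto simp: power_le_one)
    have p: "(\<lambda>n. LINT x|P n. exp (- (norm x)\<^sup>2) ^ i) \<longlonglongrightarrow> (LINT x|Q. exp (- (norm x)\<^sup>2) ^ i)" for i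
    \<comment> \<open>The power i is the Gaussian with t = 2 i, which has to be positive; the
      constant term is 1 on both sides.\<close>
    proof (cases "i = 0")
      case True then show ?thesis using P Q by (simp add: prob_space.prob_space)
    next
      case False then show ?thesis unfolding power by (intro gauss) auto
    qed
    have gi: "(LINT x|\<mu>. g (exp (- (norm x)\<^sup>2))) = (\<Sum>i\<le>N. a i * (LINT x|\<mu>. exp (- (norm x)\<^sup>2) ^ i))"
      if "prob_space \<mu>" "sets \<mu> = sets borel" for \<mu> :: "'a measure"
      unfolding gs using pI[OF that] by (subst Bochner_Integration.integral_sum) auto
    have lim: "(\<lambda>n. LINT x|P n. g (exp (- (norm x)\<^sup>2))) \<longlonglongrightarrow> (LINT x|Q. g (exp (- (norm x)\<^sup>2)))"
      unfolding gi[OF P SP] gi[OF Q SQ] by (intro tendsto_intros p)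
    have u: "exp (- (norm x)\<^sup>2) \<in> {0..1}" for x :: 'a by auto
    have bf: "\<exists>B. \<forall>u\<in>{0..1}. \<bar>h u\<bar> \<le> B" if "continuous_on UNIV h" for h :: "real \<Rightarrow> real"
      using compact_imp_bounded[OF compact_continuous_image[of "{0..1::real}" h]] that
      by (auto simp: bounded_iff intro: continuous_on_subset)
    have hI: "integrable N (\<lambda>x. h (exp (- (norm x)\<^sup>2)))"
      if N: "prob_space N" "sets N = sets borel" and h: "continuous_on UNIV h" for N :: "'a measure" and h :: "real \<Rightarrow> real"
    proof -
      obtain B where "\<forall>u\<in>{0..1}. \<bar>h u\<bar> \<le> B" using bf[OF h] by blast
      moreover have [measurable]: "h \<in> borel_measurable borel" by (rule borel_measurable_continuous_onI[OF h])
      ultimately show ?thesis using u by (intro bdd[OF N, of _ B]) auto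
    qed
    have gc: "continuous_on UNIV g" unfolding gs by (intro continuous_intros)
    have "\<bar>(LINT x|N. f (exp (- (norm x)\<^sup>2))) - (LINT x|N. g (exp (- (norm x)\<^sup>2)))\<bar> \<le> \<epsilon>"
      if N: "prob_space N" "sets N = sets borel" for N :: "'a measure"
      using g(2)[OF u] by (intro close hI N f gc) (auto intro: less_imp_le)
    then show "\<exists>c L'. c \<longlonglongrightarrow> L' \<and> (\<forall>n. \<bar>(LINT x|P n. f (exp (- (norm x)\<^sup>2))) - c n\<bar> \<le> \<epsilon>) \<and>
        \<bar>(LINT x|Q. f (exp (- (norm x)\<^sup>2))) - L'\<bar> \<le> \<epsilon>"
      using lim P Q SP SQ by (intro exI conjI allI) blast+
  qed
  \<comment> \<open>One moment beyond \<phi> controls the tails uniformly in n.\<close>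
  obtain B where B: "\<And>n. integrable (P n) (\<lambda>x. norm x powr (\<phi> + 1))" "\<And>n. (LINT x|P n. norm x powr (\<phi> + 1)) \<le> B"
    using momP[of "\<phi> + 1"] \<phi> by auto
  \<comment> \<open>The 1 keeps the truncation radius R = B' / \<epsilon> positive.\<close>
  define B' where "B' = max 1 (max B (LINT x|Q. norm x powr (\<phi> + 1)))"
  have trunc: "\<bar>r powr \<phi> - min r R powr \<phi>\<bar> \<le> r powr (\<phi> + 1) / R" if "r \<ge> 0" "R > 0" for r R :: real
  proof (cases "r \<le> R")
    case True
    then show ?thesis using that by (simp add: min_def)
  next
    case False
    have "R powr \<phi> \<le> r powr \<phi>" using False that \<phi> by (intro powr_mono2) auto
    moreover have "r powr \<phi> \<le> r powr \<phi> * (r / R)" using False that by (simp add: mult_le_cancel_left1 divide_simps)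
    moreover have "r powr (\<phi> + 1) / R = r powr \<phi> * (r / R)" using that by (simp add: powr_add)
    moreover have "min r R = R" "0 \<le> R powr \<phi>" using False by simp_all
    ultimately show ?thesis by linarith
  qed
  show ?thesis
  proof (rule LIMSEQ_approx)
    fix \<epsilon> :: real assume \<epsilon>: "\<epsilon> > 0"
    define R where "R = B' / \<epsilon>"
    have R: "R > 0" using \<epsilon> by (simp add: R_def B'_def)
    \<comment> \<open>Inverts u = exp (- |x|^2) to recover the truncated power. Clipping u to
      [exp (- R^2), 1] keeps the logarithm defined and makes f continuous on the whole line.\<close>
    define f where "f u = sqrt (- ln (max (min u 1) (exp (- R\<^sup>2)))) powr \<phi>" for u
    have pos: "max (min u 1) (exp (- R\<^sup>2)) > 0" for u by (simp add: less_max_iff_disj)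
    then have "ln (max (min u 1) (exp (- R\<^sup>2))) \<le> 0" for u by simp
    then have fc: "continuous_on UNIV f"
      unfolding f_def using \<phi> pos
      by (intro continuous_on_powr' continuous_intros) (auto simp: less_imp_neq[symmetric])
    have fe: "f (exp (- (norm x)\<^sup>2)) = min (norm x) R powr \<phi>" for x :: 'a
    proof -
      have "max (min (exp (- (norm x)\<^sup>2)) 1) (exp (- R\<^sup>2)) = exp (- (min (norm x) R)\<^sup>2)"
        using R by (auto simp: max_def min_def abs_le_square_iff[symmetric])
      then show ?thesis using R by (simp add: f_def)
    qed
    have lim: "(\<lambda>n. LINT x|P n. min (norm x) R powr \<phi>) \<longlonglongrightarrow> (LINT x|Q. min (norm x) R powr \<phi>)"
      using cont[OF fc] unfolding fe .
    have est: "\<bar>(LINT x|N. norm x powr \<phi>) - (LINT x|N. min (norm x) R powr \<phi>)\<bar> \<le> \<epsilon>"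
      if N: "prob_space N" "sets N = sets borel" "integrable N (\<lambda>x. norm x powr \<phi>)" "integrable N (\<lambda>x. norm x powr (\<phi> + 1))"
        "(LINT x|N. norm x powr (\<phi> + 1)) \<le> B'" for N :: "'a measure"
    proof -
      have I2: "integrable N (\<lambda>x. min (norm x) R powr \<phi>)"
        using R \<phi> by (intro bdd[OF N(1,2), of _ "R powr \<phi>"]) (auto intro!: powr_mono2)
      have "\<bar>(LINT x|N. norm x powr \<phi>) - (LINT x|N. min (norm x) R powr \<phi>)\<bar> = \<bar>LINT x|N. norm x powr \<phi> - min (norm x) R powr \<phi>\<bar>"
        using N I2 by simp
      also have "\<dots> \<le> (LINT x|N. \<bar>norm x powr \<phi> - min (norm x) R powr \<phi>\<bar>)" by (rule integral_abs_bound)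
      also have "\<dots> \<le> (LINT x|N. norm x powr (\<phi> + 1) / R)"
        using N I2 R by (intro integral_mono trunc) auto
      also have "\<dots> \<le> B' / R" using N(5) R by (simp add: divide_right_mono)
      also have "\<dots> = \<epsilon>" using \<epsilon> by (simp add: R_def B'_def max_def)
      finally show ?thesis .
    qed
    have "\<forall>n. \<bar>(LINT x|P n. norm x powr \<phi>) - (LINT x|P n. min (norm x) R powr \<phi>)\<bar> \<le> \<epsilon>"
    proof
      fix n
      have "(LINT x|P n. norm x powr (\<phi> + 1)) \<le> B'" using B(2)[of n] by (simp add: B'_def)
      then show "\<bar>(LINT x|P n. norm x powr \<phi>) - (LINT x|P n. min (norm x) R powr \<phi>)\<bar> \<le> \<epsilon>"
        using momP[OF \<phi>] P SP B(1) by (intro est) blast+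
    qed
    moreover have "\<bar>(LINT x|Q. norm x powr \<phi>) - (LINT x|Q. min (norm x) R powr \<phi>)\<bar> \<le> \<epsilon>"
      using \<phi> by (intro est Q SQ momQ) (auto simp: B'_def)
    ultimately show "\<exists>c L'. c \<longlonglongrightarrow> L' \<and> (\<forall>n. \<bar>(LINT x|P n. norm x powr \<phi>) - c n\<bar> \<le> \<epsilon>) \<and> \<bar>(LINT x|Q. norm x powr \<phi>) - L'\<bar> \<le> \<epsilon>"
      using lim by (intro exI conjI)
  qed
qed

section \<open>Lattice sums\<close>

lemma infsum_dominated:
  fixes f :: "'a \<Rightarrow> 'b::banach"
  assumes g: "g summable_on A" and le: "\<And>x. x \<in> A \<Longrightarrow> norm (f x) \<le> g x"
  shows "(\<lambda>x. norm (f x)) summable_on A" and "f summable_on A" and "norm (infsum f A) \<le> infsum g A"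
proof -
  show n: "(\<lambda>x. norm (f x)) summable_on A"
    by (rule summable_on_comparison_test[OF g]) (use le in auto)
  then show s: "f summable_on A" by (rule Infinite_Sum.abs_summable_summable)
  show "norm (infsum f A) \<le> infsum g A"
    by (rule norm_infsum_le[OF has_sum_infsum[OF s] has_sum_infsum[OF g] le])
qed

lemma has_sum_finite_sum:
  assumes "finite I" and "\<And>i. i \<in> I \<Longrightarrow> (f i has_sum s i) A"
  shows "((\<lambda>x. \<Sum>i\<in>I. f i x) has_sum (\<Sum>i\<in>I. s i :: 'b::topological_comm_monoid_add)) A"
  using assms by (induction I rule: finite_induct) (auto intro: has_sum_add)

text \<open>The shear (x, y) to (x - y, y) is a bijection relating the convolution summand to a
  product; absolute summability justifies the iterated sums.\<close>

lemma infsum_convolution: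
  fixes f g :: "'a::ab_group_add \<Rightarrow> 'b::{banach,real_normed_field,second_countable_topology}"
  assumes f: "(\<lambda>x. norm (f x)) summable_on UNIV" and g: "(\<lambda>x. norm (g x)) summable_on UNIV"
  shows "(\<Sum>\<^sub>\<infinity>x. \<Sum>\<^sub>\<infinity>y. f (x - y) * g y) = infsum f UNIV * infsum g UNIV"
proof -
  have n: "(\<lambda>z. norm (case z of (x, y) \<Rightarrow> f x * g y)) summable_on UNIV \<times> UNIV"
  proof (subst Infinite_Sum.abs_summable_on_Sigma_iff, intro conjI ballI)
    show "(\<lambda>y. norm (case (x, y) of (x, y) \<Rightarrow> f x * g y)) summable_on UNIV" for x
      using summable_on_cmult_right[OF g] by (simp add: norm_mult)
    show "(\<lambda>x. norm (\<Sum>\<^sub>\<infinity>y. norm (case (x, y) of (x, y) \<Rightarrow> f x * g y))) summable_on UNIV"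
      using summable_on_cmult_left[OF f, of "\<Sum>\<^sub>\<infinity>y. norm (g y)"]
      by (simp add: norm_mult infsum_cmult_right' infsum_nonneg)
  qed
  then have s: "(\<lambda>(x, y). f x * g y) summable_on UNIV \<times> UNIV"
    by (rule Infinite_Sum.abs_summable_summable)
  have bij: "bij_betw (\<lambda>(x, y). (x - y, y)) (UNIV \<times> UNIV) (UNIV \<times> UNIV :: ('a \<times> 'a) set)"
    by (rule bij_betwI[where g = "\<lambda>(x, y). (x + y, y)"]) auto
  have s': "(\<lambda>(x, y). f (x - y) * g y) summable_on UNIV \<times> UNIV"
    using summable_on_reindex_bij_betw[OF bij, of "\<lambda>(x, y). f x * g y"] s by (simp add: case_prod_unfold)
  have "(\<Sum>\<^sub>\<infinity>x. \<Sum>\<^sub>\<infinity>y. f (x - y) * g y) = infsum (\<lambda>(x, y). f (x - y) * g y) (UNIV \<times> UNIV)"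
    by (rule infsum_Sigma'_banach[OF s'])
  also have "\<dots> = infsum (\<lambda>(x, y). f x * g y) (UNIV \<times> UNIV)"
    using infsum_reindex_bij_betw[OF bij, of "\<lambda>(x, y). f x * g y"] by (simp add: case_prod_unfold)
  also have "\<dots> = (\<Sum>\<^sub>\<infinity>x. \<Sum>\<^sub>\<infinity>y. f x * g y)"
    by (rule infsum_Sigma'_banach[OF s, symmetric])
  finally show ?thesis by (simp add: infsum_cmult_right' infsum_cmult_left')
qed

text \<open>No summability is assumed: without it both sides are the default 0.\<close>

lemma infsum_complex_of_real: "(\<Sum>\<^sub>\<infinity>x\<in>A. complex_of_real (f x)) = of_real (infsum f A)"
proof (cases "f summable_on A")
  case True
  then show ?thesis by (intro infsumI) (simp add: has_sum_of_real_iff)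
next
  case False
  then have "\<not> (\<lambda>x. complex_of_real (f x)) summable_on A"
    using summable_on_Re[of "\<lambda>x. complex_of_real (f x)" A] by auto
  with False show ?thesis by (simp add: infsum_not_exists)
qed

lemma lp_bounded_1:
  assumes "lp_bounded 1 f M"
  shows "(\<lambda>x. \<bar>f x\<bar>) summable_on UNIV" and "(\<Sum>\<^sub>\<infinity>x. \<bar>f x\<bar>) \<le> M"
  using assms by (auto simp: lp_bounded_def in_lp_def lp_norm_def infsum_nonneg)

text \<open>Two regimes are joined. For |w| \<le> 1 the third-order remainder suffices because
  \<eta> \<le> 1; beyond that, each of the four terms is at most |w|^2 exp |Re w|, whence the
  4.\<close>

lemma exp_taylor2_bound:
  assumes "0 \<le> \<eta>" "\<eta> \<le> 1"
  shows "cmod (exp w - 1 - w - w\<^sup>2 / 2) \<le> 4 * cmod w powr (2 + \<eta>) * exp \<bar>Re w\<bar>"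
proof (cases "cmod w \<le> 1")
  case True
  have "cmod (exp w - 1 - w - w\<^sup>2 / 2) = cmod (exp w - (\<Sum>k\<le>2. w ^ k / fact k))"
    by (simp add: numeral_2_eq_2 algebra_simps)
  also have "\<dots> \<le> exp \<bar>Re w\<bar> * cmod w ^ Suc 2 / fact 2" by (rule Taylor_exp)
  also have "\<dots> \<le> exp \<bar>Re w\<bar> * cmod w ^ 3" by (simp add: numeral_3_eq_3)
  also have "cmod w ^ 3 \<le> cmod w powr (2 + \<eta>)"
  proof (cases "w = 0")
    case False
    then have "cmod w ^ 3 = cmod w powr 3" by (simp add: powr_numeral)
    also have "\<dots> \<le> cmod w powr (2 + \<eta>)" using assms True by (intro powr_mono') auto
    finally show ?thesis .
  qed auto
  finally have "cmod (exp w - 1 - w - w\<^sup>2 / 2) \<le> 1 * (exp \<bar>Re w\<bar> * cmod w powr (2 + \<eta>))"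
    by simp
  also have "\<dots> \<le> 4 * (exp \<bar>Re w\<bar> * cmod w powr (2 + \<eta>))" by (intro mult_right_mono) auto
  finally show ?thesis by (simp only: mult_ac)
next
  case False
  have e: "exp \<bar>Re w\<bar> \<ge> 1" by simp
  have w: "cmod w \<ge> 1" using False by simp
  have w1: "1 \<le> (cmod w)\<^sup>2" "cmod w \<le> (cmod w)\<^sup>2"
    using w by (auto simp: power2_eq_square intro: mult_ge1_I mult_le_cancel_left1[THEN iffD2])
  have "cmod (exp w - 1 - w - w\<^sup>2 / 2) \<le> cmod (exp w) + 1 + cmod w + (cmod w)\<^sup>2 / 2"
    using norm_triangle_ineq4[of "exp w - 1 - w" "w\<^sup>2 / 2"] norm_triangle_ineq4[of "exp w - 1" w] norm_triangle_ineq4[of "exp w" 1]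
    by (simp add: norm_divide norm_power)
  also have "cmod (exp w) \<le> exp \<bar>Re w\<bar>" by simp
  also have "exp \<bar>Re w\<bar> + 1 + cmod w + (cmod w)\<^sup>2 / 2 \<le> (cmod w)\<^sup>2 * exp \<bar>Re w\<bar> + (cmod w)\<^sup>2 * exp \<bar>Re w\<bar> + (cmod w)\<^sup>2 * exp \<bar>Re w\<bar> + (cmod w)\<^sup>2 * exp \<bar>Re w\<bar>"
  proof -
    have "(cmod w)\<^sup>2 \<le> (cmod w)\<^sup>2 * exp \<bar>Re w\<bar>" using e mult_left_mono[OF e, of "(cmod w)\<^sup>2"] by simp
    moreover have "exp \<bar>Re w\<bar> \<le> (cmod w)\<^sup>2 * exp \<bar>Re w\<bar>" using w1 by simp
    ultimately show ?thesis using w1 zero_le_power2[of "cmod w"] by linarith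
  qed
  also have "\<dots> = 4 * (cmod w)\<^sup>2 * exp \<bar>Re w\<bar>" by simp
  also have "(cmod w)\<^sup>2 \<le> cmod w powr (2 + \<eta>)"
  proof -
    have "(cmod w)\<^sup>2 = cmod w powr 2" using w by (simp add: powr_numeral)
    also have "\<dots> \<le> cmod w powr (2 + \<eta>)" using assms w by (intro powr_mono) auto
    finally show ?thesis .
  qed
  finally show ?thesis by simp
qed

section \<open>Lattice norms and symmetries\<close>

lemma rvec_eq_0_iff [simp]: "rvec x = 0 \<longleftrightarrow> x = 0"
  by (auto simp: rvec_def vec_eq_iff)

lemma rvec_0 [simp]: "rvec 0 = 0"
  by simp

lemma norm_rvec_ge_1: "x \<noteq> 0 \<Longrightarrow> norm (rvec x) \<ge> 1"
proof -
  assume "x \<noteq> 0"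
  then obtain i where "x $ i \<noteq> 0" by (auto simp: vec_eq_iff)
  then have "1 \<le> \<bar>rvec x $ i\<bar>" by (simp add: rvec_def)
  then show ?thesis using component_le_norm_cart[of "rvec x" i] by linarith
qed

text \<open>Nonzero lattice points have norm at least 1, so powers grow with the exponent; at the
  origin every \<open>powr\<close> is 0.\<close>

lemma norm_rvec_powr_mono: "a \<le> b \<Longrightarrow> norm (rvec x) powr a \<le> norm (rvec x) powr b"
  using norm_rvec_ge_1[of x] rvec_eq_0_iff[of x] by (cases "x = 0") (auto intro: powr_mono)

text \<open>The condition \<open>0 < n\<close> matters at the origin, where the zeroth power is 1
  but \<open>powr\<close> gives 0.\<close>

lemma norm_rvec_power_le: "real n \<le> b \<Longrightarrow> 0 < n \<Longrightarrow> norm (rvec x) ^ n \<le> norm (rvec x) powr b"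
proof (cases "x = 0")
  case False
  assume "real n \<le> b"
  then show ?thesis
    using norm_rvec_powr_mono[of "real n" b x] powr_realpow[of "norm (rvec x)" n] False by simp
qed (auto simp: zero_power)

text \<open>Reflections and the transpositions below are the symmetries through which lattice sums
  get reindexed.\<close>

definition flip :: "'n \<Rightarrow> int ^ 'n \<Rightarrow> int ^ 'n" where
  "flip i x = (\<chi> j. if j = i then - (x $ j) else x $ j)"

definition swap :: "'n \<Rightarrow> 'n \<Rightarrow> int ^ 'n \<Rightarrow> int ^ 'n" where
  "swap i j x = (\<chi> l. x $ Transposition.transpose i j l)"

lemma bij_flip: "bij (flip i)"
  by (rule o_bij[where g = "flip i"]) (auto simp: flip_def fun_eq_iff vec_eq_iff)

lemma bij_swap: "bij (swap i j)"
  by (rule o_bij[where g = "swap i j"]) (auto simp: swap_def fun_eq_iff vec_eq_iff)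

lemma flip_nth: "flip i x $ j = (if j = i then - (x $ j) else x $ j)"
  by (simp add: flip_def)

lemma swap_nth: "swap i j x $ l = x $ Transposition.transpose i j l"
  by (simp add: swap_def)

lemma norm_rvec_flip [simp]: "norm (rvec (flip i x)) = norm (rvec x)"
  unfolding norm_eq_sqrt_inner inner_vec_def
  by (intro arg_cong[where f = sqrt] sum.cong) (auto simp: rvec_def flip_def)

lemma lattice_symmetric_flip: "lattice_symmetric f \<Longrightarrow> f (flip i x) = f x"
  by (simp add: lattice_symmetric_def flip_def)

lemma lattice_symmetric_swap: "lattice_symmetric f \<Longrightarrow> f (swap i j x) = f x"
  by (simp add: lattice_symmetric_def swap_def)

text \<open>The Fourier--Laplace transform at the complex frequency \<open>c k\<close>. Tilts are the case of real \<open>c\<close>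
  and Fourier modes the case of imaginary \<open>c\<close>.\<close>
definition laplace :: "(int ^ 'n \<Rightarrow> real) \<Rightarrow> complex \<Rightarrow> real ^ 'n \<Rightarrow> complex" where
  "laplace f c k = (\<Sum>\<^sub>\<infinity>x. of_real (f x) * exp (c * of_real (k \<bullet> rvec x)))"

lemma fourier_eq_laplace: "fourier f k = laplace f (- \<i>) k"
  by (simp add: fourier_def laplace_def)

lemma norm_laplace_term: "cmod (of_real (f x) * exp (c * of_real (k \<bullet> rvec x))) = \<bar>tilt (Re c *\<^sub>R k) f x\<bar>"
  by (simp add: norm_mult tilt_def abs_mult)

text \<open>The exponential is multiplicative along x = (x - y) + y, so the convolution becomes a
  product. Summability has to be checked for the real tilt, as the imaginary part of
  \<open>c\<close> contributes a phase.\<close>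

lemma laplace_convolution:
  assumes S: "\<And>x. S x = h x + conv J S x"
    and sh: "(\<lambda>x. \<bar>tilt (Re c *\<^sub>R k) h x\<bar>) summable_on UNIV"
    and sJ: "(\<lambda>x. \<bar>tilt (Re c *\<^sub>R k) J x\<bar>) summable_on UNIV"
    and sS: "(\<lambda>x. \<bar>tilt (Re c *\<^sub>R k) S x\<bar>) summable_on UNIV"
  shows "(1 - laplace J c k) * laplace S c k = laplace h c k"
proof -
  define w where "w x = exp (c * of_real (k \<bullet> rvec x))" for x
  have w0: "w x \<noteq> 0" for x by (simp add: w_def)
  have w_add: "w x = w (x - y) * w y" for x y
  proof -
    have "rvec x = rvec (x - y) + rvec y" by (simp add: rvec_def vec_eq_iff)
    then show ?thesis by (simp add: w_def inner_add_right distrib_left exp_add)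
  qed
  have abs: "(\<lambda>x. norm (of_real (f x) * w x)) summable_on UNIV" if "(\<lambda>x. \<bar>tilt (Re c *\<^sub>R k) f x\<bar>) summable_on UNIV" for f
    using that unfolding w_def norm_laplace_term .
  have conv: "of_real (conv J S x) * w x = (\<Sum>\<^sub>\<infinity>y. (of_real (J (x - y)) * w (x - y)) * (of_real (S y) * w y))" for x
  proof -
    have "of_real (conv J S x) * w x = (\<Sum>\<^sub>\<infinity>y. of_real (J (x - y) * S y)) * w x"
      by (simp only: conv_def infsum_complex_of_real)
    also have "\<dots> = (\<Sum>\<^sub>\<infinity>y. of_real (J (x - y) * S y) * w x)"
      by (rule infsum_cmult_left'[symmetric])
    also have "\<dots> = (\<Sum>\<^sub>\<infinity>y. (of_real (J (x - y)) * w (x - y)) * (of_real (S y) * w y))"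
    proof (intro infsum_cong)
      fix y
      show "of_real (J (x - y) * S y) * w x = (of_real (J (x - y)) * w (x - y)) * (of_real (S y) * w y)"
        by (simp add: w_add[of x y])
    qed
    finally show ?thesis .
  qed
  have ss: "(\<lambda>x. of_real (S x) * w x) summable_on UNIV" "(\<lambda>x. of_real (h x) * w x) summable_on UNIV"
    using abs[OF sS] abs[OF sh] by (auto intro: Infinite_Sum.abs_summable_summable)
  have "(\<Sum>\<^sub>\<infinity>x. of_real (conv J S x) * w x) = (\<Sum>\<^sub>\<infinity>x. of_real (S x) * w x + - (of_real (h x) * w x))"
    using S by (intro infsum_cong) (simp add: distrib_right)
  also have "\<dots> = laplace S c k - laplace h c k"
    using infsum_add[OF ss(1) summable_on_uminus[THEN iffD2, OF ss(2)]]
    by (simp add: laplace_def w_def infsum_uminus)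
  finally have "laplace S c k - laplace h c k = (\<Sum>\<^sub>\<infinity>x. of_real (conv J S x) * w x)" ..
  also have "\<dots> = laplace J c k * laplace S c k"
    unfolding conv infsum_convolution[OF abs[OF sJ] abs[OF sS]] by (simp add: laplace_def w_def)
  finally show ?thesis by (simp add: algebra_simps)
qed

lemma tilt_axis: "tilt (t *\<^sub>R axis e 1) f x = f x * exp (t * real_of_int (x $ e))"
  by (simp add: tilt_def inner_axis' rvec_def)

lemma abs_rvec_le_norm: "\<bar>real_of_int (x $ i)\<bar> \<le> norm (rvec x)"
  using component_le_norm_cart[of "rvec x" i] by (simp add: rvec_def)

lemma tilt_0 [simp]: "tilt 0 f x = f x"
  by (simp add: tilt_def)

lemma inner_rvec: "k \<bullet> rvec x = (\<Sum>i\<in>UNIV. k $ i * real_of_int (x $ i))"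
  by (simp add: inner_vec_def rvec_def)

text \<open>Otherwise the absolute components would add up to less than the Euclidean norm. This
  reduces exponential moments of the norm to those along the axes.\<close>

lemma norm_le_component: "\<exists>i. norm (rvec x) \<le> real CARD('n) * \<bar>real_of_int (x $ i)\<bar>"
  for x :: "int ^ 'n"
proof (rule ccontr)
  assume "\<nexists>i. norm (rvec x) \<le> real CARD('n) * \<bar>real_of_int (x $ i)\<bar>"
  then have "\<bar>rvec x $ i\<bar> < norm (rvec x) / real CARD('n)" for i
    by (auto simp: not_le rvec_def field_simps)
  then have "(\<Sum>i\<in>UNIV. \<bar>rvec x $ i\<bar>) < (\<Sum>i\<in>(UNIV::'n set). norm (rvec x) / real CARD('n))"
    by (intro sum_strict_mono) auto
  then show False using norm_le_l1_cart[of "rvec x"] by simp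
qed

lemma exp_diff_le:
  fixes a b c :: real
  assumes "a \<le> c" "b \<le> c"
  shows "\<bar>exp a - exp b\<bar> \<le> \<bar>a - b\<bar> * exp c"
proof -
  have *: "\<bar>exp a - exp b\<bar> \<le> \<bar>a - b\<bar> * exp c" if "a \<le> b" "b \<le> c" for a b :: real
  proof -
    have "1 + (a - b) \<le> exp (a - b)" by (rule exp_ge_add_one_self)
    then have "(1 + (a - b)) * exp b \<le> exp (a - b) * exp b" by (intro mult_right_mono) auto
    then have "exp b - exp a \<le> (b - a) * exp b" by (simp add: algebra_simps flip: exp_add)
    also have "\<dots> \<le> (b - a) * exp c" using that by (intro mult_left_mono) auto
    finally show ?thesis using that by simp
  qed
  show ?thesis using *[of a b] *[of b a] assms by (cases "a \<le> b") (auto simp: abs_minus_commute)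
qed

section \<open>Subcritical two-point functions\<close>

text \<open>The constants are parameters here, not existentially chosen as in
  \<open>assumption2\<close>, so the estimates are uniform over the family.\<close>

locale subcritical =
  fixes S J h :: "int ^ 'n \<Rightarrow> real" and e :: 'n and M K \<zeta> :: real
  assumes pos: "M > 0" "K > 0" "\<zeta> > 0"
    and S_nonneg: "S x \<ge> 0"
    and A1: "assumption1 e S"
    and S_eq: "S x = h x + conv J S x"
    and symJ: "lattice_symmetric J"
    and class_Q: "\<mu> \<in> closure (Omega S) \<Longrightarrow> (tilt \<mu> J, tilt \<mu> h) \<in> class_Q M K \<zeta>"
    and h_pos: "\<mu> \<in> closure (Omega S) \<Longrightarrow> Re (fourier (tilt \<mu> h) 0) \<ge> inverse M"
begin

section \<open>The mass and the critical tilt\<close>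

definition "m = mass e S"

lemma zero_in_Omega: "0 \<in> Omega S" and open_Omega: "open (Omega S)" and symS: "lattice_symmetric S"
  using A1 by (auto simp: assumption1_def)

text \<open>For s between 0 and t, exp (s y) is at most exp (t y) + 1, so finiteness at 0 and at t
  gives finiteness at s. Hence the half-axis meets \<open>Omega S\<close> in an interval.\<close>

lemma Omega_axis_antimono:
  assumes "t *\<^sub>R axis e 1 \<in> Omega S" "0 \<le> s" "s \<le> t"
  shows "s *\<^sub>R axis e 1 \<in> Omega S"
proof -
  have le: "tilt (s *\<^sub>R axis e 1) S x \<le> tilt (t *\<^sub>R axis e 1) S x + tilt 0 S x" for x
  proof -
    have "exp (s * real_of_int (x $ e)) \<le> exp (t * real_of_int (x $ e)) + 1"
    proof (cases "x $ e \<ge> 0")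
      case True
      then have "exp (s * real_of_int (x $ e)) \<le> exp (t * real_of_int (x $ e))"
        using assms by (auto intro: mult_right_mono)
      then show ?thesis by linarith
    next
      case False
      then have "exp (s * real_of_int (x $ e)) \<le> 1"
        using assms by (auto simp: mult_nonneg_nonpos)
      then show ?thesis using exp_ge_zero[of "t * real_of_int (x $ e)"] by linarith
    qed
    from mult_left_mono[OF this S_nonneg[of x]] show ?thesis
      by (simp add: tilt_axis distrib_left tilt_def[of 0])
  qed
  have sm: "(\<lambda>x. tilt (t *\<^sub>R axis e 1) S x + tilt 0 S x) summable_on UNIV"
    using assms(1) zero_in_Omega by (intro summable_on_add) (auto simp: Omega_def simp del: tilt_0)
  have "tilt (s *\<^sub>R axis e 1) S summable_on UNIV"
    by (rule summable_on_comparison_test[OF sm le]) (simp add: tilt_def S_nonneg)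
  then show ?thesis by (simp add: Omega_def)
qed

lemma bdd_above_axis: "bdd_above {t. t \<ge> 0 \<and> t *\<^sub>R axis e 1 \<in> Omega S}"
proof -
  obtain \<mu>1 where "\<mu>1 > 0" "\<mu>1 *\<^sub>R axis e 1 \<notin> Omega S" using A1 by (auto simp: assumption1_def)
  then have "t \<le> \<mu>1" if "t \<ge> 0" "t *\<^sub>R axis e 1 \<in> Omega S" for t
    using Omega_axis_antimono[OF that(2), of \<mu>1] by (meson less_imp_le not_le)
  then show ?thesis by (auto simp: bdd_above_def)
qed

lemma le_mass: "t \<ge> 0 \<Longrightarrow> t *\<^sub>R axis e 1 \<in> Omega S \<Longrightarrow> t \<le> m"
  unfolding m_def mass_def by (rule cSup_upper[OF _ bdd_above_axis]) auto

lemma mass_pos: "m > 0"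
proof -
  obtain \<epsilon> where \<epsilon>: "\<epsilon> > 0" "ball 0 \<epsilon> \<subseteq> Omega S"
    using zero_in_Omega open_Omega by (meson open_contains_ball)
  then have "(\<epsilon> / 2) *\<^sub>R axis e 1 \<in> Omega S" by (intro subsetD[OF \<epsilon>(2)]) (simp add: norm_axis_1)
  then show ?thesis using le_mass[of "\<epsilon> / 2"] \<epsilon> by simp
qed

lemma below_mass:
  assumes "0 \<le> t" "t < m"
  shows "t *\<^sub>R axis e 1 \<in> Omega S"
proof -
  obtain t' where "t' \<ge> 0" "t' *\<^sub>R axis e 1 \<in> Omega S" "t < t'"
    using assms less_cSup_iff[OF _ bdd_above_axis, of t] zero_in_Omega
    by (force simp: m_def mass_def)
  then show ?thesis using Omega_axis_antimono[of t' t] assms by auto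
qed

text \<open>An open set cannot contain its last point on a ray.\<close>

lemma mass_notin_Omega: "m *\<^sub>R axis e 1 \<notin> Omega S"
proof
  assume "m *\<^sub>R axis e 1 \<in> Omega S"
  then obtain \<epsilon> where \<epsilon>: "\<epsilon> > 0" "ball (m *\<^sub>R axis e 1) \<epsilon> \<subseteq> Omega S"
    using open_Omega by (meson open_contains_ball)
  have "(m + \<epsilon> / 2) *\<^sub>R axis e 1 \<in> Omega S"
    by (rule subsetD[OF \<epsilon>(2)]) (use \<epsilon>(1) in \<open>simp add: dist_norm algebra_simps norm_axis_1\<close>)
  then show False using le_mass[of "m + \<epsilon> / 2"] mass_pos \<epsilon>(1) by simp
qed

text \<open>Approached from below along the axis. This makes the \<open>class_Q\<close> bounds
  available at the critical tilt, although \<open>S\<close> is not summable there.\<close>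

lemma mass_in_closure: "m *\<^sub>R axis e 1 \<in> closure (Omega S)"
  unfolding closure_approachable
proof (intro allI impI)
  fix \<epsilon> :: real assume "\<epsilon> > 0"
  \<comment> \<open>The maximum with 0 matters when \<epsilon> exceeds 2 m.\<close>
  define t where "t = max 0 (m - \<epsilon> / 2)"
  have "t *\<^sub>R axis e 1 \<in> Omega S"
    using below_mass[of t] mass_pos \<open>\<epsilon> > 0\<close> by (simp add: t_def)
  moreover have "dist (t *\<^sub>R axis e 1 :: real ^ 'n) (m *\<^sub>R axis e 1) < \<epsilon>"
    using mass_pos \<open>\<epsilon> > 0\<close> by (auto simp: dist_norm t_def max_def norm_axis_1 simp flip: scaleR_left_diff_distrib)
  ultimately show "\<exists>y\<in>Omega S. dist y (m *\<^sub>R axis e 1) < \<epsilon>" by blast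
qed

lemma zero_in_closure: "0 \<in> closure (Omega S)"
  using zero_in_Omega closure_subset by blast

lemma class_Q_bounds:
  assumes "\<mu> \<in> closure (Omega S)"
  shows "(\<lambda>x. \<bar>tilt \<mu> J x\<bar>) summable_on UNIV" "(\<Sum>\<^sub>\<infinity>x. \<bar>tilt \<mu> J x\<bar>) \<le> M"
    and "(\<lambda>x. norm (rvec x) powr (2 + \<zeta>) * \<bar>tilt \<mu> J x\<bar>) summable_on UNIV"
    and "(\<Sum>\<^sub>\<infinity>x. norm (rvec x) powr (2 + \<zeta>) * \<bar>tilt \<mu> J x\<bar>) \<le> M"
    and "(\<lambda>x. \<bar>tilt \<mu> h x\<bar>) summable_on UNIV" "(\<Sum>\<^sub>\<infinity>x. \<bar>tilt \<mu> h x\<bar>) \<le> M"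
    and "(\<lambda>x. norm (rvec x) powr \<zeta> * \<bar>tilt \<mu> h x\<bar>) summable_on UNIV"
    and "(\<Sum>\<^sub>\<infinity>x. norm (rvec x) powr \<zeta> * \<bar>tilt \<mu> h x\<bar>) \<le> M"
proof -
  have b: "lp_bounded 1 (tilt \<mu> J) M" "lp_bounded 1 (\<lambda>y. norm (rvec y) powr (2 + \<zeta>) * tilt \<mu> J y) M"
    "lp_bounded 1 (tilt \<mu> h) M" "lp_bounded 1 (\<lambda>y. norm (rvec y) powr \<zeta> * tilt \<mu> h y) M"
    using class_Q[OF assms] by (auto simp: class_Q_def)
  show "(\<lambda>x. \<bar>tilt \<mu> J x\<bar>) summable_on UNIV" "(\<Sum>\<^sub>\<infinity>x. \<bar>tilt \<mu> J x\<bar>) \<le> M"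
    "(\<lambda>x. \<bar>tilt \<mu> h x\<bar>) summable_on UNIV" "(\<Sum>\<^sub>\<infinity>x. \<bar>tilt \<mu> h x\<bar>) \<le> M"
    using lp_bounded_1[OF b(1)] lp_bounded_1[OF b(3)] by auto
  show "(\<lambda>x. norm (rvec x) powr (2 + \<zeta>) * \<bar>tilt \<mu> J x\<bar>) summable_on UNIV"
    "(\<Sum>\<^sub>\<infinity>x. norm (rvec x) powr (2 + \<zeta>) * \<bar>tilt \<mu> J x\<bar>) \<le> M"
    "(\<lambda>x. norm (rvec x) powr \<zeta> * \<bar>tilt \<mu> h x\<bar>) summable_on UNIV"
    "(\<Sum>\<^sub>\<infinity>x. norm (rvec x) powr \<zeta> * \<bar>tilt \<mu> h x\<bar>) \<le> M"
    using lp_bounded_1[OF b(2)] lp_bounded_1[OF b(4)] by (auto simp: abs_mult)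
qed

section \<open>First and second moments of J\<close>

lemma J_weight: "(\<lambda>x. norm (rvec x) powr (2 + \<zeta>) * \<bar>J x\<bar>) summable_on UNIV"
  using class_Q_bounds(3)[OF zero_in_closure] by simp

lemma J_component_le:
  "\<bar>J x * real_of_int (x $ i)\<bar> \<le> norm (rvec x) powr (2 + \<zeta>) * \<bar>J x\<bar>"
  "\<bar>J x * (real_of_int (x $ i) * real_of_int (x $ j))\<bar> \<le> norm (rvec x) powr (2 + \<zeta>) * \<bar>J x\<bar>"
proof -
  have "\<bar>real_of_int (x $ i)\<bar> \<le> norm (rvec x) powr (2 + \<zeta>)"
    using norm_rvec_power_le[of 1 "2 + \<zeta>" x] abs_rvec_le_norm[of x i] pos by simp
  then show "\<bar>J x * real_of_int (x $ i)\<bar> \<le> norm (rvec x) powr (2 + \<zeta>) * \<bar>J x\<bar>"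
    by (simp add: abs_mult mult.commute mult_left_mono)
  have "\<bar>real_of_int (x $ i) * real_of_int (x $ j)\<bar> \<le> norm (rvec x) ^ 2"
    unfolding abs_mult power2_eq_square by (intro mult_mono abs_rvec_le_norm) auto
  also have "\<dots> \<le> norm (rvec x) powr (2 + \<zeta>)"
    using norm_rvec_power_le[of 2 "2 + \<zeta>" x] pos by simp
  finally show "\<bar>J x * (real_of_int (x $ i) * real_of_int (x $ j))\<bar> \<le> norm (rvec x) powr (2 + \<zeta>) * \<bar>J x\<bar>"
    by (metis abs_mult abs_ge_zero mult.commute mult_left_mono)
qed

lemma J_component_summable:
  "(\<lambda>x. J x * real_of_int (x $ i)) summable_on UNIV"
  "(\<lambda>x. J x * (real_of_int (x $ i) * real_of_int (x $ j))) summable_on UNIV"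
  by (rule infsum_dominated(2)[OF J_weight], use J_component_le in \<open>simp add: real_norm_def\<close>)+

text \<open>Reflecting coordinate i changes the sign of the summand.\<close>

lemma J_first_moment: "((\<lambda>x. J x * real_of_int (x $ i)) has_sum 0) UNIV"
proof -
  let ?f = "\<lambda>x. J x * real_of_int (x $ i)"
  have "infsum ?f UNIV = (\<Sum>\<^sub>\<infinity>x. ?f (flip i x))"
    by (rule infsum_reindex_bij_betw[OF bij_flip, symmetric])
  also have "\<dots> = - infsum ?f UNIV"
    by (simp add: lattice_symmetric_flip[OF symJ] flip_nth infsum_uminus)
  finally show ?thesis
    using has_sum_infsum[OF J_component_summable(1)[of i]] by simp
qed

definition "\<sigma>2 = (\<Sum>\<^sub>\<infinity>x. (norm (rvec x))\<^sup>2 * J x)"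

text \<open>A reflection kills the off-diagonal entries, transpositions make the diagonal ones
  equal, and their trace is \<open>\<sigma>2\<close>: the covariance is isotropic.\<close>

lemma J_second_moment:
  "((\<lambda>x. J x * (real_of_int (x $ i) * real_of_int (x $ j))) has_sum (if i = j then \<sigma>2 / real CARD('n) else 0)) UNIV"
proof -
  let ?f = "\<lambda>i j x. J x * (real_of_int (x $ i) * real_of_int (x $ j))"
  have off: "infsum (?f i j) UNIV = 0" if "i \<noteq> j"
  proof -
    have "infsum (?f i j) UNIV = (\<Sum>\<^sub>\<infinity>x. ?f i j (flip i x))"
      by (rule infsum_reindex_bij_betw[OF bij_flip, symmetric])
    also have "\<dots> = - infsum (?f i j) UNIV"
      using that by (simp add: lattice_symmetric_flip[OF symJ] flip_nth infsum_uminus)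
    finally show ?thesis by simp
  qed
  have eq: "infsum (?f i i) UNIV = infsum (?f l l) UNIV" for l
  proof -
    have "infsum (?f i i) UNIV = (\<Sum>\<^sub>\<infinity>x. ?f i i (swap i l x))"
      by (rule infsum_reindex_bij_betw[OF bij_swap, symmetric])
    then show ?thesis by (simp add: lattice_symmetric_swap[OF symJ] swap_nth)
  qed
  have "((\<lambda>x. \<Sum>l\<in>UNIV. ?f l l x) has_sum (\<Sum>l\<in>UNIV. infsum (?f l l) UNIV)) UNIV"
    by (intro has_sum_finite_sum has_sum_infsum J_component_summable) auto
  moreover have "(\<Sum>l\<in>UNIV. ?f l l x) = (norm (rvec x))\<^sup>2 * J x" for x
    by (simp add: norm_eq_sqrt_inner inner_vec_def rvec_def sum_nonneg sum_distrib_left mult.commute)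
  moreover have "(\<Sum>l\<in>UNIV. infsum (?f l l) UNIV) = (\<Sum>l\<in>(UNIV :: 'n set). infsum (?f i i) UNIV)"
    by (intro sum.cong refl eq[symmetric])
  ultimately have "((\<lambda>x. (norm (rvec x))\<^sup>2 * J x) has_sum (\<Sum>l\<in>(UNIV :: 'n set). infsum (?f i i) UNIV)) UNIV"
    by (simp only:)
  then have "\<sigma>2 = real CARD('n) * infsum (?f i i) UNIV"
    by (simp add: \<sigma>2_def infsumI)
  then have "infsum (?f i j) UNIV = (if i = j then \<sigma>2 / real CARD('n) else 0)"
    using off by auto
  then show ?thesis
    using has_sum_infsum[OF J_component_summable(2)[of i j]] by simp
qed

lemma J_linear_moment: "((\<lambda>x. J x * (k \<bullet> rvec x)) has_sum 0) UNIV"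
proof -
  have "((\<lambda>x. \<Sum>i\<in>UNIV. k $ i * (J x * real_of_int (x $ i))) has_sum (\<Sum>i\<in>UNIV. k $ i * 0)) UNIV"
    by (intro has_sum_finite_sum has_sum_cmult_right J_first_moment) auto
  then show ?thesis by (simp add: inner_rvec sum_distrib_left mult_ac)
qed

lemma J_quadratic_moment: "((\<lambda>x. J x * (k \<bullet> rvec x)\<^sup>2) has_sum ((norm k)\<^sup>2 * \<sigma>2 / real CARD('n))) UNIV"
proof -
  have "((\<lambda>x. \<Sum>i\<in>UNIV. \<Sum>j\<in>UNIV. (k $ i * k $ j) * (J x * (real_of_int (x $ i) * real_of_int (x $ j)))) has_sum
     (\<Sum>i\<in>UNIV. \<Sum>j\<in>UNIV. (k $ i * k $ j) * (if i = j then \<sigma>2 / real CARD('n) else 0))) UNIV"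
    by (intro has_sum_finite_sum has_sum_cmult_right J_second_moment) auto
  moreover have "(\<Sum>i\<in>UNIV. \<Sum>j\<in>UNIV. (k $ i * k $ j) * (J x * (real_of_int (x $ i) * real_of_int (x $ j)))) = J x * (k \<bullet> rvec x)\<^sup>2" for x
    by (simp add: inner_rvec power2_eq_square sum_product) (simp add: sum_distrib_left mult_ac)
  moreover have "(\<Sum>i\<in>UNIV. \<Sum>j\<in>UNIV. (k $ i * k $ j) * (if i = j then \<sigma>2 / real CARD('n) else 0)) = (norm k)\<^sup>2 * \<sigma>2 / real CARD('n)"
  proof -
    have "(\<Sum>i\<in>UNIV. \<Sum>j\<in>UNIV. (k $ i * k $ j) * (if i = j then \<sigma>2 / real CARD('n) else 0))
        = (\<Sum>i\<in>UNIV. k $ i * k $ i * (\<sigma>2 / real CARD('n)))"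
      by (intro sum.cong refl) (simp add: if_distrib cong: if_cong)
    also have "\<dots> = (norm k)\<^sup>2 * (\<sigma>2 / real CARD('n))"
      by (simp add: norm_eq_sqrt_inner inner_vec_def sum_nonneg sum_distrib_right sum_divide_distrib)
    finally show ?thesis by simp
  qed
  ultimately show ?thesis by simp
qed

section \<open>Uniform second-order expansion of the transform of J\<close>

text \<open>At most 1 because the Taylor remainder is at best of third order; at most \<zeta>
  because the available weight has order 2 + \<zeta>.\<close>

definition "\<eta> = min \<zeta> 1"

lemma \<eta>: "0 < \<eta>" "\<eta> \<le> 1" "\<eta> \<le> \<zeta>"
  using pos by (auto simp: \<eta>_def)

text \<open>The tilt at the mass controls the first exponential and its mirror image the second; by
  symmetry of \<open>J\<close> each costs \<open>M\<close>. By \<open>exp_abs_le\<close> their sum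
  dominates every smaller exponent, of either sign.\<close>

lemma J_envelope:
  fixes w :: "int ^ 'n \<Rightarrow> real"
  assumes w: "\<And>x. w (flip e x) = w x"
    and s: "(\<lambda>x. w x * \<bar>tilt (m *\<^sub>R axis e 1) J x\<bar>) summable_on UNIV"
    and b: "(\<Sum>\<^sub>\<infinity>x. w x * \<bar>tilt (m *\<^sub>R axis e 1) J x\<bar>) \<le> M"
  defines "E \<equiv> \<lambda>x. w x * \<bar>J x\<bar> * (exp (m * real_of_int (x $ e)) + exp (- (m * real_of_int (x $ e))))"
  shows "E summable_on UNIV" and "infsum E UNIV \<le> 2 * M"
proof -
  let ?f = "\<lambda>x. w x * \<bar>tilt (m *\<^sub>R axis e 1) J x\<bar>"
  have eq: "E = (\<lambda>x. ?f x + ?f (flip e x))"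
    by (simp add: E_def fun_eq_iff tilt_axis abs_mult w lattice_symmetric_flip[OF symJ] flip_nth algebra_simps)
  have s': "(\<lambda>x. ?f (flip e x)) summable_on UNIV"
    using s summable_on_reindex_bij_betw[OF bij_flip[of e], of ?f] by simp
  show "E summable_on UNIV" unfolding eq by (rule summable_on_add[OF s s'])
  have "infsum E UNIV = infsum ?f UNIV + (\<Sum>\<^sub>\<infinity>x. ?f (flip e x))"
    unfolding eq by (rule infsum_add[OF s s'])
  also have "(\<Sum>\<^sub>\<infinity>x. ?f (flip e x)) = infsum ?f UNIV"
    by (rule infsum_reindex_bij_betw[OF bij_flip])
  finally show "infsum E UNIV \<le> 2 * M" using b by simp
qed

lemmas J_envelope0 = J_envelope[where w = "\<lambda>_. 1", simplified, OF class_Q_bounds(1,2)[OF mass_in_closure]]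
lemmas J_envelope2 = J_envelope[where w = "\<lambda>x. norm (rvec x) powr (2 + \<zeta>)", simplified, OF class_Q_bounds(3,4)[OF mass_in_closure]]

lemma exp_abs_le: "\<bar>s\<bar> \<le> m * \<bar>real_of_int (x $ e)\<bar> \<Longrightarrow> exp \<bar>s\<bar> \<le> exp (m * real_of_int (x $ e)) + exp (- (m * real_of_int (x $ e)))"
proof -
  assume "\<bar>s\<bar> \<le> m * \<bar>real_of_int (x $ e)\<bar>"
  also have "\<dots> = \<bar>m * real_of_int (x $ e)\<bar>" using mass_pos by (simp add: abs_mult)
  finally have "exp \<bar>s\<bar> \<le> exp \<bar>m * real_of_int (x $ e)\<bar>" by simp
  also have "exp \<bar>y\<bar> \<le> exp y + exp (- y)" for y :: real by (simp add: abs_if)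
  finally show ?thesis .
qed

text \<open>The condition admits real \<open>c\<close> up to the mass along the axis, and imaginary
  \<open>c\<close> with an arbitrary vector \<open>k\<close>.\<close>

lemma J_tilt_summable:
  assumes "\<And>x. \<bar>Re c * (k \<bullet> rvec x)\<bar> \<le> m * \<bar>real_of_int (x $ e)\<bar>"
  shows "(\<lambda>x. \<bar>tilt (Re c *\<^sub>R k) J x\<bar>) summable_on UNIV"
proof -
  have "norm \<bar>tilt (Re c *\<^sub>R k) J x\<bar> \<le> \<bar>J x\<bar> * (exp (m * real_of_int (x $ e)) + exp (- (m * real_of_int (x $ e))))" for x
  proof -
    have "\<bar>tilt (Re c *\<^sub>R k) J x\<bar> = \<bar>J x\<bar> * exp (Re c * (k \<bullet> rvec x))" by (simp add: tilt_def abs_mult)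
    also have "\<dots> \<le> \<bar>J x\<bar> * exp \<bar>Re c * (k \<bullet> rvec x)\<bar>" by (intro mult_left_mono) auto
    also have "\<dots> \<le> \<bar>J x\<bar> * (exp (m * real_of_int (x $ e)) + exp (- (m * real_of_int (x $ e))))"
      using exp_abs_le[OF assms] by (intro mult_left_mono) auto
    finally show ?thesis by simp
  qed
  from infsum_dominated(2)[OF J_envelope0(1) this] show ?thesis by simp
qed

text \<open>The linear term vanishes by reflection and the quadratic one is isotropic, so the Taylor
  remainder is what is left. Its factor 4 times the bound \<open>2 * M\<close> on the envelope gives
  \<open>8 * M\<close>.\<close>

lemma J_taylor:
  assumes c: "\<And>x. \<bar>Re c * (k \<bullet> rvec x)\<bar> \<le> m * \<bar>real_of_int (x $ e)\<bar>"
  shows "cmod (laplace J c k - laplace J 0 k - c\<^sup>2 * of_real ((norm k)\<^sup>2 * (\<sigma>2 / (2 * real CARD('n)))))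
      \<le> 8 * M * (cmod c * norm k) powr (2 + \<eta>)"
proof -
  define w where "w x = c * of_real (k \<bullet> rvec x)" for x
  define E where "E x = norm (rvec x) powr (2 + \<zeta>) * \<bar>J x\<bar> * (exp (m * real_of_int (x $ e)) + exp (- (m * real_of_int (x $ e))))" for x
  have E: "E summable_on UNIV" "infsum E UNIV \<le> 2 * M"
    unfolding E_def by (fact J_envelope2)+
  have "((\<lambda>x. of_real (J x) * exp (w x)) has_sum laplace J c k) UNIV"
    unfolding laplace_def w_def
    by (rule has_sum_infsum[OF Infinite_Sum.abs_summable_summable])
       (use J_tilt_summable[OF c] in \<open>simp only: norm_laplace_term[of J _ c k]\<close>)
  moreover have "((\<lambda>x. of_real (J x)) has_sum laplace J 0 k) UNIV"
  proof -
    have "(\<lambda>x. cmod (of_real (J x))) summable_on UNIV"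
      using class_Q_bounds(1)[OF zero_in_closure] by simp
    from has_sum_infsum[OF Infinite_Sum.abs_summable_summable[OF this]] show ?thesis
      by (simp add: laplace_def)
  qed
  moreover have "((\<lambda>x. c * of_real (J x * (k \<bullet> rvec x))) has_sum (c * of_real 0)) UNIV"
    by (intro has_sum_cmult_right has_sum_of_real J_linear_moment)
  moreover have "((\<lambda>x. c\<^sup>2 / 2 * of_real (J x * (k \<bullet> rvec x)\<^sup>2)) has_sum (c\<^sup>2 / 2 * of_real ((norm k)\<^sup>2 * \<sigma>2 / real CARD('n)))) UNIV"
    by (intro has_sum_cmult_right has_sum_of_real J_quadratic_moment)
  ultimately have "((\<lambda>x. of_real (J x) * exp (w x) + - of_real (J x) + - (c * of_real (J x * (k \<bullet> rvec x))) + - (c\<^sup>2 / 2 * of_real (J x * (k \<bullet> rvec x)\<^sup>2)))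
     has_sum (laplace J c k + - laplace J 0 k + - (c * of_real 0) + - (c\<^sup>2 / 2 * of_real ((norm k)\<^sup>2 * \<sigma>2 / real CARD('n))))) UNIV"
    by (intro has_sum_add has_sum_uminusI)
  also have "(\<lambda>x. of_real (J x) * exp (w x) + - of_real (J x) + - (c * of_real (J x * (k \<bullet> rvec x))) + - (c\<^sup>2 / 2 * of_real (J x * (k \<bullet> rvec x)\<^sup>2)))
      = (\<lambda>x. of_real (J x) * (exp (w x) - 1 - w x - (w x)\<^sup>2 / 2))"
    by (simp add: fun_eq_iff w_def algebra_simps power_mult_distrib)
  also have "laplace J c k + - laplace J 0 k + - (c * of_real 0) + - (c\<^sup>2 / 2 * of_real ((norm k)\<^sup>2 * \<sigma>2 / real CARD('n)))
      = laplace J c k - laplace J 0 k - c\<^sup>2 * of_real ((norm k)\<^sup>2 * (\<sigma>2 / (2 * real CARD('n))))"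
    by simp
  finally have hs: "((\<lambda>x. of_real (J x) * (exp (w x) - 1 - w x - (w x)\<^sup>2 / 2)) has_sum
     (laplace J c k - laplace J 0 k - c\<^sup>2 * of_real ((norm k)\<^sup>2 * (\<sigma>2 / (2 * real CARD('n)))))) UNIV" .
  have le: "cmod (of_real (J x) * (exp (w x) - 1 - w x - (w x)\<^sup>2 / 2)) \<le> 4 * (cmod c * norm k) powr (2 + \<eta>) * E x" for x
  proof -
    have "cmod (w x) \<le> (cmod c * norm k) * norm (rvec x)"
      using Cauchy_Schwarz_ineq2[of k "rvec x"] by (simp add: w_def norm_mult mult.assoc mult_left_mono)
    then have "cmod (w x) powr (2 + \<eta>) \<le> ((cmod c * norm k) * norm (rvec x)) powr (2 + \<eta>)"
      using \<eta> by (intro powr_mono2) auto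
    also have "\<dots> = (cmod c * norm k) powr (2 + \<eta>) * norm (rvec x) powr (2 + \<eta>)"
      by (simp add: powr_mult)
    also have "\<dots> \<le> (cmod c * norm k) powr (2 + \<eta>) * norm (rvec x) powr (2 + \<zeta>)"
      using \<eta> by (intro mult_left_mono norm_rvec_powr_mono) auto
    finally have 1: "cmod (w x) powr (2 + \<eta>) \<le> (cmod c * norm k) powr (2 + \<eta>) * norm (rvec x) powr (2 + \<zeta>)" .
    have 2: "exp \<bar>Re (w x)\<bar> \<le> exp (m * real_of_int (x $ e)) + exp (- (m * real_of_int (x $ e)))"
      using exp_abs_le[OF c] by (simp add: w_def)
    have "cmod (exp (w x) - 1 - w x - (w x)\<^sup>2 / 2) \<le> 4 * (cmod (w x) powr (2 + \<eta>) * exp \<bar>Re (w x)\<bar>)"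
      using exp_taylor2_bound[of \<eta> "w x"] \<eta> by simp
    also have "\<dots> \<le> 4 * (((cmod c * norm k) powr (2 + \<eta>) * norm (rvec x) powr (2 + \<zeta>)) * (exp (m * real_of_int (x $ e)) + exp (- (m * real_of_int (x $ e)))))"
      by (intro mult_left_mono mult_mono 1 2) auto
    finally have "\<bar>J x\<bar> * cmod (exp (w x) - 1 - w x - (w x)\<^sup>2 / 2) \<le> \<bar>J x\<bar> * (4 * (((cmod c * norm k) powr (2 + \<eta>) * norm (rvec x) powr (2 + \<zeta>)) * (exp (m * real_of_int (x $ e)) + exp (- (m * real_of_int (x $ e))))))"
      by (intro mult_left_mono) auto
    then show ?thesis by (simp add: E_def norm_mult mult_ac)
  qed
  have "cmod (laplace J c k - laplace J 0 k - c\<^sup>2 * of_real ((norm k)\<^sup>2 * (\<sigma>2 / (2 * real CARD('n)))))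
     \<le> 4 * (cmod c * norm k) powr (2 + \<eta>) * infsum E UNIV"
    by (rule norm_infsum_le[OF hs has_sum_cmult_right[OF has_sum_infsum[OF E(1)]] le])
  also have "\<dots> \<le> 4 * (cmod c * norm k) powr (2 + \<eta>) * (2 * M)"
    using E(2) by (intro mult_left_mono) auto
  finally show ?thesis by (simp add: mult_ac)
qed

section \<open>The susceptibility along the axis\<close>

definition axis_laplace :: "(int ^ 'n \<Rightarrow> real) \<Rightarrow> real \<Rightarrow> real" where
  "axis_laplace f t = (\<Sum>\<^sub>\<infinity>x. f x * exp (t * real_of_int (x $ e)))"

lemma axis_laplace_tilt: "axis_laplace f t = (\<Sum>\<^sub>\<infinity>x. tilt (t *\<^sub>R axis e 1) f x)"
  by (simp add: axis_laplace_def tilt_axis)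

lemma laplace_axis: "laplace f (of_real t) (axis e 1) = of_real (axis_laplace f t)"
proof -
  have "of_real (f x) * exp (of_real t * of_real (axis e 1 \<bullet> rvec x)) = complex_of_real (f x * exp (t * real_of_int (x $ e)))" for x
    by (simp add: inner_axis' rvec_def exp_of_real[symmetric])
  then show ?thesis
    unfolding laplace_def axis_laplace_def infsum_complex_of_real[symmetric] by (intro infsum_cong) simp
qed

lemma laplace_0: "laplace f 0 k = of_real (axis_laplace f 0)"
  by (simp add: laplace_def axis_laplace_def infsum_complex_of_real)

lemma axis_condition: "\<bar>t\<bar> \<le> m \<Longrightarrow> \<bar>Re (of_real t) * (axis e 1 \<bullet> rvec x)\<bar> \<le> m * \<bar>real_of_int (x $ e)\<bar>"
  by (simp add: inner_axis' rvec_def abs_mult mult_right_mono)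

lemma imaginary_condition: "\<bar>Re \<i> * (k \<bullet> rvec x)\<bar> \<le> m * \<bar>real_of_int (x $ e)\<bar>"
  using mass_pos by simp

lemma S_tilt_summable:
  assumes "0 \<le> t" "t < m"
  shows "(\<lambda>x. \<bar>tilt (t *\<^sub>R axis e 1) S x\<bar>) summable_on UNIV"
proof -
  have "\<bar>tilt (t *\<^sub>R axis e 1) S x\<bar> = tilt (t *\<^sub>R axis e 1) S x" for x
    by (simp add: tilt_def S_nonneg)
  then show ?thesis using below_mass[OF assms] by (simp add: Omega_def)
qed

lemma below_mass_closure: "0 \<le> t \<Longrightarrow> t < m \<Longrightarrow> t *\<^sub>R axis e 1 \<in> closure (Omega S)"
  using below_mass closure_subset by blast

text \<open>The range stops short of the mass: there \<open>S\<close> is not summable and its sum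
  would be the default 0. The two-sided bound on the right-hand side makes the susceptibility
  comparable to the inverse of the gap \<open>1 - axis_laplace J t\<close>.\<close>

lemma susceptibility_identity:
  assumes t: "0 \<le> t" "t < m"
  shows "(1 - axis_laplace J t) * axis_laplace S t = axis_laplace h t"
    and "inverse M \<le> axis_laplace h t" and "axis_laplace h t \<le> M"
proof -
  let ?u = "t *\<^sub>R axis e 1 :: real ^ 'n"
  have cl: "?u \<in> closure (Omega S)" using below_mass_closure[OF t] .
  have "(1 - laplace J (of_real t) (axis e 1)) * laplace S (of_real t) (axis e 1) = laplace h (of_real t) (axis e 1)"
    using class_Q_bounds(1,5)[OF cl] S_tilt_summable[OF t] by (intro laplace_convolution S_eq) simp_all
  then have "complex_of_real ((1 - axis_laplace J t) * axis_laplace S t) = of_real (axis_laplace h t)"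
    by (simp add: laplace_axis)
  then show "(1 - axis_laplace J t) * axis_laplace S t = axis_laplace h t"
    by (simp only: of_real_eq_iff)
  have "fourier (tilt ?u h) 0 = of_real (axis_laplace h t)"
    by (simp add: fourier_def axis_laplace_tilt infsum_complex_of_real)
  then show "inverse M \<le> axis_laplace h t" using h_pos[OF cl] by simp
  have "norm (axis_laplace h t) \<le> (\<Sum>\<^sub>\<infinity>x. \<bar>tilt ?u h x\<bar>)"
    unfolding axis_laplace_tilt by (rule infsum_dominated(3)[OF class_Q_bounds(5)[OF cl]]) simp
  then show "axis_laplace h t \<le> M" using class_Q_bounds(6)[OF cl] by simp
qed

lemma axis_laplace_S_nonneg: "axis_laplace S t \<ge> 0"
  unfolding axis_laplace_def by (intro infsum_nonneg) (simp add: S_nonneg)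

text \<open>The product in \<open>susceptibility_identity\<close> is positive and the susceptibility
  is nonnegative, which fixes the sign of the gap.\<close>

lemma axis_laplace_J_less_1:
  assumes t: "0 \<le> t" "t < m"
  shows "axis_laplace J t < 1"
proof -
  have "(1 - axis_laplace J t) * axis_laplace S t > 0"
    using susceptibility_identity(1,2)[OF t] pos(1) by (metis less_le_trans positive_imp_inverse_positive)
  then show ?thesis using axis_laplace_S_nonneg[of t] by (simp add: zero_less_mult_iff)
qed

text \<open>The coordinate produced by the mean value bound is absorbed by the weight of order 2 +
  \<zeta>, so the envelope bounds the slope. This supplies continuity up to the mass.\<close>

lemma axis_laplace_J_lipschitz:
  assumes t: "0 \<le> t" "t \<le> m"
  shows "\<bar>axis_laplace J t - axis_laplace J m\<bar> \<le> (m - t) * (2 * M)"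
proof -
  define E where "E x = norm (rvec x) powr (2 + \<zeta>) * \<bar>J x\<bar> * (exp (m * real_of_int (x $ e)) + exp (- (m * real_of_int (x $ e))))" for x
  have E: "E summable_on UNIV" "infsum E UNIV \<le> 2 * M"
    unfolding E_def by (fact J_envelope2)+
  have s: "((\<lambda>x. J x * exp (s * real_of_int (x $ e))) has_sum axis_laplace J s) UNIV" if "0 \<le> s" "s \<le> m" for s
  proof -
    have "(\<lambda>x. norm (tilt (s *\<^sub>R axis e 1) J x)) summable_on UNIV"
      using J_tilt_summable[of "of_real s" "axis e 1"] axis_condition[of s] that by simp
    from has_sum_infsum[OF Infinite_Sum.abs_summable_summable[OF this]] show ?thesis
      by (simp add: axis_laplace_def tilt_axis)
  qed
  have d: "((\<lambda>x. J x * exp (t * real_of_int (x $ e)) + - (J x * exp (m * real_of_int (x $ e)))) has_sum (axis_laplace J t + - axis_laplace J m)) UNIV"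
    using t mass_pos by (intro has_sum_add has_sum_uminusI s) auto
  have le: "norm (J x * exp (t * real_of_int (x $ e)) + - (J x * exp (m * real_of_int (x $ e)))) \<le> (m - t) * E x" for x
  proof -
    let ?y = "real_of_int (x $ e)"
    have y: "\<bar>?y\<bar> \<le> norm (rvec x) powr (2 + \<zeta>)"
      using norm_rvec_power_le[of 1 "2 + \<zeta>" x] abs_rvec_le_norm[of x e] pos by simp
    have "t * ?y \<le> \<bar>m * ?y\<bar>"
    proof -
      have "t * ?y \<le> t * \<bar>?y\<bar>" using t by (intro mult_left_mono) auto
      also have "\<dots> \<le> m * \<bar>?y\<bar>" using t by (intro mult_right_mono) auto
      finally show ?thesis using mass_pos by (simp add: abs_mult)
    qed
    then have "\<bar>exp (t * ?y) - exp (m * ?y)\<bar> \<le> \<bar>t * ?y - m * ?y\<bar> * exp \<bar>m * ?y\<bar>"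
      by (intro exp_diff_le) auto
    also have "\<dots> = (m - t) * (\<bar>?y\<bar> * exp \<bar>m * ?y\<bar>)"
      using t by (simp add: abs_mult flip: left_diff_distrib)
    also have "\<dots> \<le> (m - t) * (norm (rvec x) powr (2 + \<zeta>) * (exp (m * ?y) + exp (- (m * ?y))))"
      using t mass_pos by (intro mult_left_mono mult_mono y exp_abs_le) (auto simp: abs_mult)
    finally have "\<bar>J x\<bar> * \<bar>exp (t * ?y) - exp (m * ?y)\<bar> \<le> \<bar>J x\<bar> * ((m - t) * (norm (rvec x) powr (2 + \<zeta>) * (exp (m * ?y) + exp (- (m * ?y)))))"
      by (intro mult_left_mono) auto
    moreover have "J x * exp (t * ?y) + - (J x * exp (m * ?y)) = J x * (exp (t * ?y) - exp (m * ?y))"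
      by (simp add: algebra_simps)
    ultimately show ?thesis by (simp add: E_def abs_mult mult_ac)
  qed
  have "norm (axis_laplace J t + - axis_laplace J m) \<le> (m - t) * infsum E UNIV"
    by (rule norm_infsum_le[OF d has_sum_cmult_right[OF has_sum_infsum[OF E(1)]] le])
  also have "\<dots> \<le> (m - t) * (2 * M)" using E(2) t by (intro mult_left_mono) auto
  finally show ?thesis by simp
qed

text \<open>Otherwise the susceptibility would stay bounded up to the mass, and the mass would not lie
  outside the open set \<^term>\<open>Omega S\<close>.\<close>
lemma axis_laplace_J_mass: "axis_laplace J m = 1"
proof (rule ccontr)
  assume ne: "axis_laplace J m \<noteq> 1"
  define c where "c = 1 - axis_laplace J m"
  \<comment> \<open>Within |c| / (4 M) of the mass, the Lipschitz constant \<open>2 * M\<close>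
    moves the gap by at most |c| / 2.\<close>
  define t0 where "t0 = max 0 (m - \<bar>c\<bar> / (4 * M))"
  have c: "\<bar>c\<bar> > 0" using ne by (simp add: c_def)
  have t0: "0 \<le> t0" "t0 < m" using mass_pos c pos by (auto simp: t0_def)
  have half: "1 - axis_laplace J t \<ge> c - \<bar>c\<bar> / 2" "1 - axis_laplace J t \<le> c + \<bar>c\<bar> / 2" if "t0 \<le> t" "t < m" for t
  proof -
    have t: "0 \<le> t" "t \<le> m" using that t0 by auto
    have "m - t \<le> \<bar>c\<bar> / (4 * M)" using that by (simp add: t0_def)
    then have "(m - t) * (2 * M) \<le> \<bar>c\<bar> / (4 * M) * (2 * M)" using pos by (intro mult_right_mono) auto
    also have "\<dots> = \<bar>c\<bar> / 2" using pos by simp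
    finally have "\<bar>axis_laplace J t - axis_laplace J m\<bar> \<le> \<bar>c\<bar> / 2" using axis_laplace_J_lipschitz[OF t] by linarith
    then show "1 - axis_laplace J t \<ge> c - \<bar>c\<bar> / 2" "1 - axis_laplace J t \<le> c + \<bar>c\<bar> / 2"
      unfolding c_def by linarith+
  qed
  \<comment> \<open>A negative limit of the gap would force negative gaps before the mass.\<close>
  have "c > 0"
    using half(2)[of t0] t0 axis_laplace_J_less_1[of t0] c by linarith
  have bound: "axis_laplace S t \<le> 2 * M / c" if "t0 \<le> t" "t < m" for t
  proof -
    have t: "0 \<le> t" "t < m" using that t0 by auto
    have "c / 2 * axis_laplace S t \<le> (1 - axis_laplace J t) * axis_laplace S t"
      using half(1)[OF that] \<open>c > 0\<close> axis_laplace_S_nonneg by (intro mult_right_mono) auto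
    also have "\<dots> \<le> M" using susceptibility_identity(1,3)[OF t] by simp
    finally show ?thesis using \<open>c > 0\<close> by (simp add: field_simps)
  qed
  \<comment> \<open>Finite partial sums are continuous in t, so the bound survives at the mass,
    where the full sum is not yet known to converge.\<close>
  have fin: "(\<Sum>x\<in>F. tilt (m *\<^sub>R axis e 1) S x) \<le> 2 * M / c" if "finite F" for F
  proof (rule tendsto_upperbound)
    show "((\<lambda>t. \<Sum>x\<in>F. S x * exp (t * real_of_int (x $ e))) \<longlongrightarrow> (\<Sum>x\<in>F. tilt (m *\<^sub>R axis e 1) S x)) (at_left m)"
      unfolding tilt_axis by (intro tendsto_intros)
    show "\<forall>\<^sub>F t in at_left m. (\<Sum>x\<in>F. S x * exp (t * real_of_int (x $ e))) \<le> 2 * M / c"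
      unfolding eventually_at_left[OF t0(2)]
    proof (intro exI[of _ t0] conjI t0(2) allI impI)
      fix t assume t: "t0 < t" "t < m"
      then have t': "0 \<le> t" using t0 by simp
      have "(\<Sum>x\<in>F. S x * exp (t * real_of_int (x $ e))) \<le> axis_laplace S t"
        unfolding axis_laplace_def
        using S_tilt_summable[OF t' t(2)] that S_nonneg
        by (intro finite_sum_le_infsum) (auto simp: tilt_axis)
      then show "(\<Sum>x\<in>F. S x * exp (t * real_of_int (x $ e))) \<le> 2 * M / c"
        using bound[of t] t by linarith
    qed
  qed simp
  have "tilt (m *\<^sub>R axis e 1) S summable_on UNIV"
  proof (rule nonneg_bdd_above_summable_on)
    show "bdd_above (sum (tilt (m *\<^sub>R axis e 1) S) ` {F. F \<subseteq> UNIV \<and> finite F})"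
      using fin by (auto intro!: bdd_aboveI2)
  qed (simp add: tilt_def S_nonneg)
  then show False using mass_notin_Omega by (simp add: Omega_def)
qed

section \<open>The gap and the transform of h near criticality\<close>

text \<open>Half the variance of \<open>J\<close> in one coordinate: the leading coefficient of the
  gap in m^2 - t^2.\<close>

definition "D2 = \<sigma>2 / (2 * real CARD('n))"

lemma J_taylor_axis:
  assumes "0 \<le> t" "t \<le> m"
  shows "\<bar>axis_laplace J t - axis_laplace J 0 - t\<^sup>2 * D2\<bar> \<le> 8 * M * m powr (2 + \<eta>)"
proof -
  have "cmod (laplace J (of_real t) (axis e 1) - laplace J 0 (axis e 1) - (of_real t)\<^sup>2 * of_real ((norm (axis e 1 :: real ^ 'n))\<^sup>2 * (\<sigma>2 / (2 * real CARD('n)))))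
      \<le> 8 * M * (cmod (of_real t) * norm (axis e 1 :: real ^ 'n)) powr (2 + \<eta>)"
    using assms by (intro J_taylor axis_condition) auto
  then have "cmod (of_real (axis_laplace J t - axis_laplace J 0 - t\<^sup>2 * D2)) \<le> 8 * M * \<bar>t\<bar> powr (2 + \<eta>)"
    by (simp only: laplace_axis laplace_0) (simp add: D2_def)
  also have "\<dots> \<le> 8 * M * m powr (2 + \<eta>)"
    using assms pos \<eta> by (intro mult_left_mono powr_mono2) auto
  finally show ?thesis by (simp only: norm_of_real)
qed

text \<open>Subtracting the expansions at t and at m, where the transform is 1, eliminates
  \<open>axis_laplace J 0\<close>; the two remainders of size 8 add up to 16.\<close>

lemma gap_axis:
  assumes "0 \<le> t" "t \<le> m"
  shows "\<bar>1 - axis_laplace J t - (m\<^sup>2 - t\<^sup>2) * D2\<bar> \<le> 16 * M * m powr (2 + \<eta>)"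
  using J_taylor_axis[OF assms] J_taylor_axis[of m] mass_pos axis_laplace_J_mass
  by (simp add: left_diff_distrib)

text \<open>The same subtraction at an imaginary frequency, whose square is negative, so that |k|^2
  is added to m^2. The two error terms stay separate because \<open>k\<close> need not be of the
  size of m.\<close>

lemma gap_imaginary:
  "cmod (1 - laplace J \<i> k - of_real ((m\<^sup>2 + (norm k)\<^sup>2) * D2)) \<le> 8 * M * (m powr (2 + \<eta>) + norm k powr (2 + \<eta>))"
proof -
  have "cmod (laplace J \<i> k - laplace J 0 k - \<i>\<^sup>2 * of_real ((norm k)\<^sup>2 * (\<sigma>2 / (2 * real CARD('n)))))
      \<le> 8 * M * (cmod \<i> * norm k) powr (2 + \<eta>)"
    by (intro J_taylor imaginary_condition)
  then have 1: "cmod (laplace J \<i> k - of_real (axis_laplace J 0) + of_real ((norm k)\<^sup>2 * D2)) \<le> 8 * M * norm k powr (2 + \<eta>)"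
    by (simp add: laplace_0 D2_def)
  have 2: "cmod (of_real (1 - axis_laplace J 0 - m\<^sup>2 * D2)) \<le> 8 * M * m powr (2 + \<eta>)"
    using J_taylor_axis[of m] mass_pos axis_laplace_J_mass by (simp del: of_real_diff)
  have "1 - laplace J \<i> k - of_real ((m\<^sup>2 + (norm k)\<^sup>2) * D2)
     = of_real (1 - axis_laplace J 0 - m\<^sup>2 * D2) - (laplace J \<i> k - of_real (axis_laplace J 0) + of_real ((norm k)\<^sup>2 * D2))"
    by (simp add: algebra_simps)
  also have "cmod \<dots> \<le> 8 * M * m powr (2 + \<eta>) + 8 * M * norm k powr (2 + \<eta>)"
    by (rule order_trans[OF norm_triangle_ineq4 add_mono[OF 2 1]])
  finally show ?thesis by (simp add: distrib_left)
qed

text \<open>A phase differs from 1 by at most 2 |y| powr \<eta>: linearly for |y| \<le> 1, and by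
  the trivial bound 2 beyond. The moment of \<open>h\<close> of order \<zeta> sums this up.\<close>

lemma h_imaginary: "cmod (laplace h \<i> k - of_real (axis_laplace h 0)) \<le> 2 * M * norm k powr \<eta>"
proof -
  let ?c = "\<lambda>x. k \<bullet> rvec x"
  have h1: "(\<lambda>x. \<bar>h x\<bar>) summable_on UNIV" using class_Q_bounds(5)[OF zero_in_closure] by simp
  have a: "((\<lambda>x. of_real (h x) * iexp (?c x)) has_sum laplace h \<i> k) UNIV"
    unfolding laplace_def
    by (rule has_sum_infsum[OF Infinite_Sum.abs_summable_summable]) (use h1 in \<open>simp add: norm_mult\<close>)
  have "(\<lambda>x. cmod (of_real (h x))) summable_on UNIV" using h1 by simp
  from has_sum_infsum[OF Infinite_Sum.abs_summable_summable[OF this]]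
  have b: "((\<lambda>x. of_real (h x)) has_sum (complex_of_real (axis_laplace h 0))) UNIV"
    by (simp add: axis_laplace_def infsum_complex_of_real)
  have d: "((\<lambda>x. of_real (h x) * iexp (?c x) + - of_real (h x)) has_sum (laplace h \<i> k + - of_real (axis_laplace h 0))) UNIV"
    by (intro has_sum_add has_sum_uminusI a b)
  have le: "cmod (of_real (h x) * iexp (?c x) + - of_real (h x)) \<le> 2 * norm k powr \<eta> * (norm (rvec x) powr \<zeta> * \<bar>tilt 0 h x\<bar>)" for x
  proof -
    have "cmod (iexp y - 1) \<le> 2 * \<bar>y\<bar> powr \<eta>" for y :: real
    proof (cases "\<bar>y\<bar> \<le> 1")
      case True
      have "cmod (iexp y - 1) \<le> \<bar>y\<bar>" using iexp_approx1[of y 0] by simp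
      also have "\<bar>y\<bar> \<le> \<bar>y\<bar> powr \<eta>"
      proof (cases "y = 0")
        case False
        then have "\<bar>y\<bar> powr 1 \<le> \<bar>y\<bar> powr \<eta>" using True \<eta> by (intro powr_mono') auto
        then show ?thesis by simp
      qed simp
      also have "\<dots> \<le> 2 * \<bar>y\<bar> powr \<eta>" by simp
      finally show ?thesis .
    next
      case False
      have "cmod (iexp y - 1) \<le> cmod (iexp y) + cmod 1" by (rule norm_triangle_ineq4)
      also have "\<dots> = 2" by simp
      also have "\<dots> \<le> 2 * \<bar>y\<bar> powr \<eta>" using False \<eta> by (simp add: ge_one_powr_ge_zero)
      finally show ?thesis .
    qed
    also have "\<bar>?c x\<bar> powr \<eta> \<le> (norm k * norm (rvec x)) powr \<eta>"
      using \<eta> Cauchy_Schwarz_ineq2[of k "rvec x"] by (intro powr_mono2) auto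
    also have "\<dots> = norm k powr \<eta> * norm (rvec x) powr \<eta>" by (simp add: powr_mult)
    also have "\<dots> \<le> norm k powr \<eta> * norm (rvec x) powr \<zeta>"
      using \<eta> by (intro mult_left_mono norm_rvec_powr_mono) auto
    finally have *: "cmod (iexp (?c x) - 1) \<le> 2 * (norm k powr \<eta> * norm (rvec x) powr \<zeta>)" by simp
    have "of_real (h x) * iexp (?c x) + - of_real (h x) = of_real (h x) * (iexp (?c x) - 1)"
      by (simp add: right_diff_distrib)
    then have "cmod (of_real (h x) * iexp (?c x) + - of_real (h x)) = \<bar>h x\<bar> * cmod (iexp (?c x) - 1)"
      by (simp add: norm_mult)
    also have "\<dots> \<le> \<bar>h x\<bar> * (2 * (norm k powr \<eta> * norm (rvec x) powr \<zeta>))"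
      using * by (intro mult_left_mono) auto
    finally show ?thesis by (simp add: mult_ac)
  qed
  have "cmod (laplace h \<i> k + - of_real (axis_laplace h 0)) \<le> 2 * norm k powr \<eta> * (\<Sum>\<^sub>\<infinity>x. norm (rvec x) powr \<zeta> * \<bar>tilt 0 h x\<bar>)"
    by (rule norm_infsum_le[OF d has_sum_cmult_right[OF has_sum_infsum[OF class_Q_bounds(7)[OF zero_in_closure]]] le])
  also have "\<dots> \<le> 2 * norm k powr \<eta> * M"
    using class_Q_bounds(8)[OF zero_in_closure] by (intro mult_left_mono) auto
  finally show ?thesis by (simp add: mult_ac)
qed

lemma S_summable: "(\<lambda>x. \<bar>S x\<bar>) summable_on UNIV"
  using S_tilt_summable[of 0] mass_pos by simp

lemma imaginary_identity: "(1 - laplace J \<i> k) * laplace S \<i> k = laplace h \<i> k"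
  using class_Q_bounds(1,5)[OF zero_in_closure] S_summable
  by (intro laplace_convolution S_eq) simp_all

text \<open>Compare the infrared bound at s times the unit vector with the expansion of
  \<open>J\<close> and divide by s^2: the error vanishes as s tends to 0. The variance thus has a
  lower bound common to the family.\<close>

lemma D2_ge: "D2 \<ge> K"
proof -
  have ev: "eventually (\<lambda>s::real. K \<le> D2 + 8 * M * s powr \<eta>) (at_right 0)"
    unfolding eventually_at_right_field
  \<comment> \<open>Below pi the vector stays in the box representing the torus.\<close>
  proof (intro exI[of _ pi] conjI allI impI pi_gt_zero)
    fix s :: real assume s: "0 < s" "s < pi"
    let ?k = "s *\<^sub>R axis e 1 :: real ^ 'n"
    have "\<forall>k :: real ^ 'n. (\<forall>i. k $ i \<in> {- pi..pi}) \<longrightarrow> Re (fourier J 0 - fourier J k) \<ge> K * (norm k)\<^sup>2"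
      using class_Q[OF zero_in_closure] by (simp add: class_Q_def tilt_0[abs_def])
    moreover have "\<forall>i. ?k $ i \<in> {- pi..pi}" using s by (auto simp: axis_def)
    ultimately have lo: "K * (norm ?k)\<^sup>2 \<le> Re (fourier J 0 - fourier J ?k)" by blast
    have "cmod (laplace J (- \<i>) ?k - laplace J 0 ?k - (- \<i>)\<^sup>2 * of_real ((norm ?k)\<^sup>2 * (\<sigma>2 / (2 * real CARD('n)))))
        \<le> 8 * M * (cmod (- \<i>) * norm ?k) powr (2 + \<eta>)"
      using mass_pos by (intro J_taylor) simp
    then have "cmod (laplace J (- \<i>) ?k - laplace J 0 ?k + of_real (s\<^sup>2 * D2)) \<le> 8 * M * s powr (2 + \<eta>)"
      using s by (simp add: D2_def)
    moreover have "fourier J 0 = laplace J 0 ?k" by (simp add: fourier_def laplace_def)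
    ultimately have "cmod (- (fourier J 0 - fourier J ?k) + of_real (s\<^sup>2 * D2)) \<le> 8 * M * s powr (2 + \<eta>)"
      by (simp add: fourier_eq_laplace)
    then have "Re (fourier J 0 - fourier J ?k) \<le> s\<^sup>2 * D2 + 8 * M * s powr (2 + \<eta>)"
      using abs_Re_le_cmod[of "- (fourier J 0 - fourier J ?k) + of_real (s\<^sup>2 * D2)"] by simp
    with lo have "K * s\<^sup>2 \<le> s\<^sup>2 * D2 + 8 * M * s powr (2 + \<eta>)" using s by simp
    also have "s powr (2 + \<eta>) = s\<^sup>2 * s powr \<eta>" using s by (simp add: powr_add powr_numeral)
    finally have "s\<^sup>2 * K \<le> s\<^sup>2 * (D2 + 8 * M * s powr \<eta>)" by (simp add: algebra_simps)
    then show "K \<le> D2 + 8 * M * s powr \<eta>" using s by (simp add: mult_le_cancel_left)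
  qed
  have "eventually (\<lambda>s::real. 0 \<le> s) (at_right 0)"
    by (rule eventually_mono[OF eventually_at_right_less[of 0]]) simp
  then have lim: "((\<lambda>s. D2 + 8 * M * s powr \<eta>) \<longlongrightarrow> D2 + 8 * M * 0 powr \<eta>) (at_right 0)"
    using \<eta> by (intro tendsto_intros tendsto_powr') auto
  show ?thesis
    using tendsto_lowerbound[OF lim ev] by simp
qed

text \<open>Squaring undoes the root only when the sum is nonnegative; its positivity comes from
  \<open>D2_ge\<close>.\<close>

lemma D2_eq_sigmaJ: "D2 = (sigmaJ J)\<^sup>2 / (2 * real CARD('n))"
proof -
  have "D2 > 0" using D2_ge pos by simp
  then have "\<sigma>2 > 0" by (simp add: D2_def zero_less_divide_iff)
  then show ?thesis by (simp add: D2_def sigmaJ_def flip: \<sigma>2_def)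
qed

lemma axis_laplace_h_0: "axis_laplace h 0 = Re (fourier h 0)"
  by (simp add: fourier_def axis_laplace_def infsum_complex_of_real)

lemma axis_laplace_S_0: "axis_laplace S 0 = moment 0 S" "chi0 S = moment 0 S"
  by (simp_all add: axis_laplace_def moment_def pow0_def chi0_def chi_tilt_def)

section \<open>Fourier and exponential sums of S\<close>

lemma Re_laplace_S: "((\<lambda>x. S x * cos (k \<bullet> rvec x)) has_sum Re (laplace S \<i> k)) UNIV"
proof -
  have "((\<lambda>x. of_real (S x) * iexp (k \<bullet> rvec x)) has_sum laplace S \<i> k) UNIV"
    unfolding laplace_def
    by (rule has_sum_infsum[OF Infinite_Sum.abs_summable_summable]) (use S_summable in \<open>simp add: norm_mult\<close>)
  from has_sum_Re[OF this] show ?thesis by (simp add: Re_exp)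
qed

text \<open>A transposition moves the distinguished axis to coordinate i, and a reflection reverses
  it.\<close>

lemma S_exp_component:
  assumes t: "0 \<le> t" "t < m"
  shows "((\<lambda>x. S x * exp (t * real_of_int (x $ i))) has_sum axis_laplace S t) UNIV"
    and "((\<lambda>x. S x * exp (- (t * real_of_int (x $ i)))) has_sum axis_laplace S t) UNIV"
proof -
  let ?f = "\<lambda>i x. S x * exp (t * real_of_int (x $ i))"
  have "?f e summable_on UNIV"
    using below_mass[OF t] by (simp add: Omega_def tilt_axis[abs_def])
  then have 1: "(?f e has_sum axis_laplace S t) UNIV"
    by (simp add: axis_laplace_def)
  then have "((\<lambda>x. ?f e (swap e i x)) has_sum axis_laplace S t) UNIV"
    by (subst has_sum_reindex_bij_betw[OF bij_swap])
  then show 2: "(?f i has_sum axis_laplace S t) UNIV"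
    by (simp add: lattice_symmetric_swap[OF symS] swap_nth)
  then have "((\<lambda>x. ?f i (flip i x)) has_sum axis_laplace S t) UNIV"
    by (subst has_sum_reindex_bij_betw[OF bij_flip])
  then show "((\<lambda>x. S x * exp (- (t * real_of_int (x $ i)))) has_sum axis_laplace S t) UNIV"
    by (simp add: lattice_symmetric_flip[OF symS] flip_nth)
qed

text \<open>Some coordinate has size at least |x| / d, so the exponent is at most m / 2 times that
  size; summing over the 2 d signed axes covers every case. At half the mass the gap is still of
  order m^2, which keeps the bound useful.\<close>

lemma S_exp_norm:
  defines "f \<equiv> \<lambda>x. S x * exp (m / (2 * real CARD('n)) * norm (rvec x))"
  shows "f summable_on UNIV" "infsum f UNIV \<le> 2 * real CARD('n) * axis_laplace S (m / 2)"
proof -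
  let ?t = "m / 2"
  let ?g = "\<lambda>x. \<Sum>i\<in>(UNIV::'n set). S x * exp (?t * real_of_int (x $ i)) + S x * exp (- (?t * real_of_int (x $ i)))"
  have "(?g has_sum (\<Sum>i\<in>(UNIV::'n set). axis_laplace S ?t + axis_laplace S ?t)) UNIV"
    using mass_pos by (intro has_sum_finite_sum has_sum_add S_exp_component) auto
  then have g: "(?g has_sum (2 * real CARD('n) * axis_laplace S ?t)) UNIV"
    by (simp add: mult.assoc mult.left_commute)
  have le: "norm (f x) \<le> ?g x" for x
  proof -
    obtain i where i: "norm (rvec x) \<le> real CARD('n) * \<bar>real_of_int (x $ i)\<bar>" using norm_le_component by blast
    have "m / (2 * real CARD('n)) * norm (rvec x) \<le> m / (2 * real CARD('n)) * (real CARD('n) * \<bar>real_of_int (x $ i)\<bar>)"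
      using i mass_pos by (intro mult_left_mono) auto
    also have "\<dots> = \<bar>?t * real_of_int (x $ i)\<bar>" using mass_pos by (simp add: abs_mult)
    finally have "exp (m / (2 * real CARD('n)) * norm (rvec x)) \<le> exp \<bar>?t * real_of_int (x $ i)\<bar>" by simp
    also have "exp \<bar>y\<bar> \<le> exp y + exp (- y)" for y :: real by (simp add: abs_if)
    finally have "f x \<le> S x * exp (?t * real_of_int (x $ i)) + S x * exp (- (?t * real_of_int (x $ i)))"
      using mult_left_mono[OF _ S_nonneg[of x]] by (simp add: f_def distrib_left[symmetric])
    also have "\<dots> \<le> ?g x"
      by (rule member_le_sum[where f = "\<lambda>i. S x * exp (?t * real_of_int (x $ i)) + S x * exp (- (?t * real_of_int (x $ i)))"])
         (auto simp: S_nonneg)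
    finally show ?thesis using S_nonneg[of x] by (simp add: f_def)
  qed
  show "f summable_on UNIV" by (rule infsum_dominated(2)[OF has_sum_imp_summable[OF g] le])
  have "norm (infsum f UNIV) \<le> infsum ?g UNIV"
    by (rule infsum_dominated(3)[OF has_sum_imp_summable[OF g] le])
  then show "infsum f UNIV \<le> 2 * real CARD('n) * axis_laplace S (m / 2)"
    using infsumI[OF g] by simp
qed

end

section \<open>Near-critical asymptotics\<close>

lemma A_const_0: "A_const TYPE('n::finite) 0 = 2"
  using green1_fourier[of "0 :: real ^ 'n"] by (simp add: A_const_def pow0_def has_bochner_integral_iff)

lemma A_const_eq:
  assumes "\<phi> \<ge> 0"
  shows "A_const TYPE('n::finite) \<phi> = 2 powr (\<phi> + 1) * (Gamma ((\<phi> + 2) / 2) * Gamma ((\<phi> + real CARD('n)) / 2) / Gamma (real CARD('n) / 2))"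
\<comment> \<open>\<open>green1_moment\<close> is stated with \<open>powr\<close>, which agrees with
  \<open>pow0\<close> at the origin only for \<phi> \<noteq> 0.\<close>
proof (cases "\<phi> = 0")
  case True
  have "Gamma (real CARD('n) / 2) > 0" by (intro Gamma_real_pos) simp
  then have "Gamma (real CARD('n) / 2) \<noteq> 0" by linarith
  then show ?thesis using True by (simp add: A_const_0)
next
  case False
  then show ?thesis
    using green1_moment[OF assms, where 'n = 'n] by (simp add: A_const_def pow0_def has_bochner_integral_iff)
qed

lemma A_const_pos: "\<phi> \<ge> 0 \<Longrightarrow> A_const TYPE('n::finite) \<phi> > 0"
  unfolding A_const_eq by (intro mult_pos_pos divide_pos_pos Gamma_real_pos) (auto intro: add_nonneg_pos)

section \<open>The limit law and the rescaled lattice laws\<close>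

text \<open>Halved because \<open>green1\<close> has total mass 2.\<close>

definition green_law :: "(real ^ 'n) measure" where
  "green_law = density lborel (\<lambda>y. ennreal (green1 y / 2))"

lemma sets_green_law [simp]: "sets green_law = sets borel"
  by (simp add: green_law_def)

lemma green_law_integral:
  assumes "has_bochner_integral lborel (\<lambda>y :: real ^ 'n. f y * green1 y) I" "f \<in> borel_measurable borel"
  shows "has_bochner_integral green_law f (I / 2)"
proof -
  have "has_bochner_integral lborel (\<lambda>y. (green1 y / 2) *\<^sub>R f y) (I / 2)"
    using has_bochner_integral_divide_zero[OF assms(1), of 2] by (simp add: mult_ac)
  then show ?thesis
    unfolding green_law_def using assms(2) green1_nonneg by (intro has_bochner_integral_density) auto
qed

lemma prob_space_green_law: "prob_space (green_law :: (real ^ 'n) measure)"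
proof (rule prob_spaceI)
  have i: "has_bochner_integral lborel (\<lambda>y :: real ^ 'n. green1 y / 2) 1"
    using has_bochner_integral_divide_zero[OF green1_fourier[of "0 :: real ^ 'n"], of 2] by simp
  have "emeasure green_law (space (green_law :: (real ^ 'n) measure)) = (\<integral>\<^sup>+ y. ennreal (green1 (y :: real ^ 'n) / 2) \<partial>lborel)"
    by (simp add: green_law_def emeasure_density)
  also have "\<dots> = ennreal 1"
    using i by (subst nn_integral_eq_integral) (auto simp: has_bochner_integral_iff green1_nonneg)
  finally show "emeasure green_law (space (green_law :: (real ^ 'n) measure)) = 1" by simp
qed

definition lattice_law :: "(int ^ 'n \<Rightarrow> real) \<Rightarrow> real \<Rightarrow> (real ^ 'n) measure" where
  "lattice_law p r = distr (density (count_space UNIV) (\<lambda>x. ennreal (p x))) borel (\<lambda>x. r *\<^sub>R rvec x)"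

lemma sets_lattice_law [simp]: "sets (lattice_law p r) = sets borel"
  by (simp add: lattice_law_def)

lemma has_sum_imp_has_bochner_integral_count_space:
  fixes f :: "'a \<Rightarrow> real"
  assumes "(f has_sum s) UNIV"
  shows "has_bochner_integral (count_space UNIV) f s"
proof -
  have "(\<lambda>x. norm (f x)) summable_on UNIV"
    using has_sum_imp_summable[OF assms] summable_on_iff_abs_summable_on_real by blast
  then have "Infinite_Set_Sum.abs_summable_on f UNIV" by (simp only: abs_summable_equivalent)
  then show ?thesis
    using infsetsum_infsum[of f UNIV] infsumI[OF assms]
    by (simp add: has_bochner_integral_iff Infinite_Set_Sum.abs_summable_on_def infsetsum_def)
qed

lemma lattice_law_integral:
  fixes f :: "real ^ 'n \<Rightarrow> real"
  assumes "\<And>x. p x \<ge> 0" and "((\<lambda>x. p x * f (r *\<^sub>R rvec x)) has_sum s) UNIV" and [measurable]: "f \<in> borel_measurable borel"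
  shows "has_bochner_integral (lattice_law p r) f s"
proof -
  have "has_bochner_integral (density (count_space UNIV) (\<lambda>x. ennreal (p x))) (\<lambda>x. f (r *\<^sub>R rvec x)) s"
    using has_sum_imp_has_bochner_integral_count_space[OF assms(2)] assms(1)
    by (intro has_bochner_integral_density) auto
  then show ?thesis
    by (simp add: lattice_law_def has_bochner_integral_iff integrable_distr_eq integral_distr)
qed

lemma prob_space_lattice_law:
  assumes "\<And>x. p x \<ge> 0" and "(p has_sum 1) UNIV"
  shows "prob_space (lattice_law p r)"
  unfolding lattice_law_def
proof (rule prob_space.prob_space_distr)
  have "emeasure (density (count_space UNIV) (\<lambda>x. ennreal (p x))) UNIV = (\<integral>\<^sup>+ x. ennreal (p x) \<partial>count_space UNIV)"
    by (simp add: emeasure_density)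
  also have "\<dots> = ennreal 1"
    using has_sum_imp_has_bochner_integral_count_space[OF assms(2)] assms(1)
    by (subst nn_integral_eq_integral) (auto simp: has_bochner_integral_iff)
  finally show "prob_space (density (count_space UNIV) (\<lambda>x. ennreal (p x)))"
    by (intro prob_spaceI) simp
qed simp

text \<open>From ln u \<le> u - 1 at u = a y / q. It lets one exponential moment control all
  powers.\<close>

lemma powr_le_exp:
  assumes "q > (0::real)" "a > 0" "y \<ge> 0"
  shows "y powr q \<le> (q / a) powr q * exp (a * y)"
proof (cases "y = 0")
  case False
  then have y: "y > 0" using assms by simp
  have "ln (a * y / q) \<le> a * y / q - 1" using assms y by (intro ln_le_minus_one) simp
  also have "\<dots> \<le> a * y / q" by simp
  finally have "q * ln (a * y / q) \<le> a * y" using assms by (simp add: field_simps)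
  then have "(a * y / q) powr q \<le> exp (a * y)" using assms y by (simp add: powr_def)
  then have "(q / a) powr q * (a * y / q) powr q \<le> (q / a) powr q * exp (a * y)" by (intro mult_left_mono) auto
  moreover have "(q / a) powr q * (a * y / q) powr q = y powr q"
    using assms y by (simp add: powr_mult[symmetric])
  ultimately show ?thesis by simp
qed simp

section \<open>Limits along sequences\<close>

text \<open>An error of higher order than r^2 disappears after division. The general field covers
  both the real gap along the axis and the complex gap at imaginary frequencies.\<close>

lemma quadratic_limit:
  fixes a :: "nat \<Rightarrow> 'a::real_normed_field"
  assumes r: "\<And>n. r n > 0" "r \<longlonglongrightarrow> 0" and \<eta>: "\<eta> > 0"
    and est: "\<And>n. norm (a n - of_real ((r n)\<^sup>2 * b n)) \<le> C * r n powr (2 + \<eta>)"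
    and b: "b \<longlonglongrightarrow> \<beta>"
  shows "(\<lambda>n. a n / of_real ((r n)\<^sup>2)) \<longlonglongrightarrow> of_real \<beta>"
proof -
  have "(\<lambda>n. C * r n powr \<eta>) \<longlonglongrightarrow> C * 0 powr \<eta>"
    using r \<eta> by (intro tendsto_intros tendsto_powr') (auto intro: less_imp_le always_eventually)
  then have lim: "(\<lambda>n. C * r n powr \<eta>) \<longlonglongrightarrow> 0" using \<eta> by simp
  have "norm (a n / of_real ((r n)\<^sup>2) - of_real (b n)) \<le> C * r n powr \<eta>" for n
  proof -
    have "a n / of_real ((r n)\<^sup>2) - of_real (b n) = (a n - of_real ((r n)\<^sup>2 * b n)) / of_real ((r n)\<^sup>2)"
      using r(1)[of n] by (simp add: field_simps)
    then have "norm (a n / of_real ((r n)\<^sup>2) - of_real (b n)) = norm (a n - of_real ((r n)\<^sup>2 * b n)) / (r n)\<^sup>2"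
      by (simp only: norm_divide norm_of_real) simp
    also have "\<dots> \<le> C * r n powr (2 + \<eta>) / (r n)\<^sup>2"
      by (intro divide_right_mono est) auto
    also have "\<dots> = C * r n powr \<eta>"
      using r(1)[of n] by (simp add: powr_add powr_numeral)
    finally show ?thesis .
  qed
  then have "(\<lambda>n. a n / of_real ((r n)\<^sup>2) - of_real (b n)) \<longlonglongrightarrow> 0"
    by (intro Lim_null_comparison[OF _ lim]) (auto intro: always_eventually)
  from tendsto_add[OF this tendsto_of_real[OF b]] show ?thesis by simp
qed

text \<open>The limit is a product: that of the susceptibility times the mass squared, and the
  moment of the limit law.\<close>

lemma subcritical_moment_limit:
  fixes S J h :: "nat \<Rightarrow> int ^ 'n \<Rightarrow> real"
  assumes sub: "\<And>n. subcritical (S n) (J n) (h n) e M K \<zeta>"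
    and m0: "(\<lambda>n. mass e (S n)) \<longlonglongrightarrow> 0"
    and \<sigma>: "(\<lambda>n. sigmaJ (J n)) \<longlonglongrightarrow> \<sigma>'"
    and H: "(\<lambda>n. Re (fourier (h n) 0)) \<longlonglongrightarrow> H"
    and \<phi>: "\<phi> \<ge> 0"
  shows "\<sigma>' \<noteq> 0" "H > 0"
    and "(\<lambda>n. moment \<phi> (S n) * mass e (S n) powr (2 + \<phi>)) \<longlonglongrightarrow> A_const TYPE('n) \<phi> * (real CARD('n) * H / \<sigma>'\<^sup>2)"
proof -
  define r where "r n = mass e (S n)" for n
  define \<eta> where "\<eta> = min \<zeta> 1"
  define L where "L = subcritical.axis_laplace e"
  define b where "b n = (sigmaJ (J n))\<^sup>2 / (2 * real CARD('n))" for n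
  define c where "c = \<sigma>'\<^sup>2 / (2 * real CARD('n))"
  define X where "X n = L (S n) 0" for n
  have pos: "M > 0" "K > 0" "\<zeta> > 0" using sub[of 0] by (auto simp: subcritical_def)
  have \<eta>: "\<eta> > 0" using pos by (simp add: \<eta>_def)
  have m_eq: "subcritical.m (S n) e = r n" for n
    by (simp add: subcritical.m_def[OF sub] r_def)
  have \<eta>_eq: "subcritical.\<eta> \<zeta> = \<eta>"
    by (simp add: subcritical.\<eta>_def[OF sub] \<eta>_def)
  have b_eq: "subcritical.D2 (J n) = b n" for n
    using subcritical.D2_eq_sigmaJ[OF sub[of n]] by (simp add: b_def)
  note eqs = m_eq \<eta>_eq b_eq L_def[symmetric]
  have r: "r n > 0" for n using subcritical.mass_pos[OF sub] by (simp add: eqs)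
  have r0: "r \<longlonglongrightarrow> 0" using m0 unfolding r_def .
  have S0: "S n x \<ge> 0" for n x using subcritical.S_nonneg[OF sub] .
  have b: "b \<longlonglongrightarrow> c" unfolding b_def c_def by (intro tendsto_intros \<sigma>) auto
  \<comment> \<open>The lower bound is the same for all n, so the limiting variance cannot
    degenerate.\<close>
  have "c \<ge> K"
    using subcritical.D2_ge[OF sub] by (intro LIMSEQ_le_const[OF b]) (auto simp: eqs)
  then have c: "c > 0" using pos by simp
  then show "\<sigma>' \<noteq> 0" by (auto simp: c_def)
  have Lh0: "L (h n) 0 = Re (fourier (h n) 0)" for n
    using subcritical.axis_laplace_h_0[OF sub] by (simp add: eqs)
  have Lh: "(\<lambda>n. L (h n) 0) \<longlonglongrightarrow> H" using H by (simp add: Lh0)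
  note id = subcritical.susceptibility_identity[OF sub, unfolded eqs]
  have "H \<ge> inverse M" using id(2)[of 0] r by (intro LIMSEQ_le_const[OF Lh]) auto
  then show H0: "H > 0" using pos by (meson less_le_trans positive_imp_inverse_positive)
  have gap0: "(\<lambda>n. (1 - L (J n) 0) / (r n)\<^sup>2) \<longlonglongrightarrow> c"
  proof -
    have "(\<lambda>n. (1 - L (J n) 0) / of_real ((r n)\<^sup>2)) \<longlonglongrightarrow> of_real c"
      using subcritical.gap_axis[OF sub, unfolded eqs, of 0] r
      by (intro quadratic_limit[OF r r0 \<eta> _ b, where C = "16 * M"]) (simp add: less_imp_le)
    then show ?thesis by simp
  qed
  \<comment> \<open>The factor is 1 - (1/2)^2 = 3/4, from the tilt at half the mass.\<close>
  have gaph: "(\<lambda>n. (1 - L (J n) (r n / 2)) / (r n)\<^sup>2) \<longlonglongrightarrow> 3 / 4 * c"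
  proof -
    have "norm (1 - L (J n) (r n / 2) - of_real ((r n)\<^sup>2 * (3 / 4 * b n))) \<le> 16 * M * r n powr (2 + \<eta>)" for n
    proof -
      have "((r n)\<^sup>2 - (r n / 2)\<^sup>2) * b n = (r n)\<^sup>2 * (3 / 4 * b n)" by (simp add: power_divide algebra_simps)
      moreover have "\<bar>1 - L (J n) (r n / 2) - ((r n)\<^sup>2 - (r n / 2)\<^sup>2) * b n\<bar> \<le> 16 * M * r n powr (2 + \<eta>)"
        using r[of n] by (intro subcritical.gap_axis[OF sub, unfolded eqs]) auto
      ultimately show ?thesis
        by (simp only: of_real_eq_id id_apply real_norm_def)
    qed
    then have "(\<lambda>n. (1 - L (J n) (r n / 2)) / of_real ((r n)\<^sup>2)) \<longlonglongrightarrow> of_real (3 / 4 * c)"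
      by (rule quadratic_limit[OF r r0 \<eta>]) (intro tendsto_intros b)
    then show ?thesis by simp
  qed
  have gapk: "(\<lambda>n. (1 - laplace (J n) \<i> (r n *\<^sub>R k)) / of_real ((r n)\<^sup>2)) \<longlonglongrightarrow> of_real ((1 + (norm k)\<^sup>2) * c)" for k
  proof (rule quadratic_limit[OF r r0 \<eta>])
    show "(\<lambda>n. (1 + (norm k)\<^sup>2) * b n) \<longlonglongrightarrow> (1 + (norm k)\<^sup>2) * c" by (intro tendsto_intros b)
    fix n
    have "((r n)\<^sup>2 + (norm (r n *\<^sub>R k))\<^sup>2) * b n = (r n)\<^sup>2 * ((1 + (norm k)\<^sup>2) * b n)"
      by (simp add: power_mult_distrib algebra_simps)
    moreover have "norm (r n *\<^sub>R k) powr (2 + \<eta>) = norm k powr (2 + \<eta>) * r n powr (2 + \<eta>)"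
      using r[of n] by (simp add: powr_mult)
    then have "8 * M * (r n powr (2 + \<eta>) + norm (r n *\<^sub>R k) powr (2 + \<eta>)) = 8 * M * (1 + norm k powr (2 + \<eta>)) * r n powr (2 + \<eta>)"
      by (simp add: algebra_simps)
    ultimately show "norm (1 - laplace (J n) \<i> (r n *\<^sub>R k) - of_real ((r n)\<^sup>2 * ((1 + (norm k)\<^sup>2) * b n)))
       \<le> 8 * M * (1 + norm k powr (2 + \<eta>)) * r n powr (2 + \<eta>)"
      using subcritical.gap_imaginary[OF sub, of n "r n *\<^sub>R k", unfolded eqs] by (simp only:)
  qed
  have hk: "(\<lambda>n. laplace (h n) \<i> (r n *\<^sub>R k)) \<longlonglongrightarrow> of_real H" for k
  proof -
    have "(\<lambda>n. 2 * M * norm (r n *\<^sub>R k) powr \<eta>) \<longlonglongrightarrow> 2 * M * norm (0 *\<^sub>R k) powr \<eta>"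
      using \<eta> by (intro tendsto_intros tendsto_powr' r0) auto
    then have lim: "(\<lambda>n. 2 * M * norm (r n *\<^sub>R k) powr \<eta>) \<longlonglongrightarrow> 0" using \<eta> by simp
    have "(\<lambda>n. laplace (h n) \<i> (r n *\<^sub>R k) - of_real (L (h n) 0)) \<longlonglongrightarrow> 0"
      by (rule Lim_null_comparison[OF always_eventually lim])
         (intro allI subcritical.h_imaginary[OF sub, unfolded eqs])
    from tendsto_add[OF this tendsto_of_real[OF Lh]] show ?thesis by simp
  qed
  have X_id: "(1 - L (J n) 0) * X n = L (h n) 0" for n using id(1)[of 0 n] r[of n] by (simp add: X_def)
  have gap_pos: "1 - L (J n) t > 0" if "0 \<le> t" "t < r n" for n t
    using subcritical.axis_laplace_J_less_1[OF sub[of n], unfolded eqs, OF that] by simp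
  \<comment> \<open>Dividing the gap by r^2 first gives numerator and denominator nonzero
    limits.\<close>
  have X_eq: "X n * (r n)\<^sup>2 = L (h n) 0 / ((1 - L (J n) 0) / (r n)\<^sup>2)" for n
    using gap_pos[of 0 n] r[of n] unfolding X_id[symmetric] by simp
  have X_lim: "(\<lambda>n. X n * (r n)\<^sup>2) \<longlonglongrightarrow> H / c"
    unfolding X_eq using c by (intro tendsto_divide Lh gap0) auto
  have X_pos: "X n > 0" for n
  proof -
    have "(1 - L (J n) 0) * X n > 0"
      using id(2)[of 0 n] r[of n] pos(1) X_id[of n] by (metis less_le_trans order_refl positive_imp_inverse_positive)
    then show ?thesis using gap_pos[of 0 n] r[of n] by (simp add: zero_less_mult_iff)
  qed
  define p where "p n x = S n x / X n" for n x
  have p0: "p n x \<ge> 0" for n x using S0 X_pos by (simp add: p_def less_imp_le)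
  have p_sum: "((\<lambda>x. p n x * f x) has_sum s / X n) UNIV" if "((\<lambda>x. S n x * f x) has_sum s) UNIV" for n f s
    using has_sum_divide_const[OF that, of "X n"] by (simp add: p_def)
  have p1: "(p n has_sum 1) UNIV" for n
  proof -
    have "S n summable_on UNIV"
      using subcritical.S_summable[OF sub[of n]] S0 by simp
    then have "((\<lambda>x. S n x * 1) has_sum X n) UNIV"
      using subcritical.axis_laplace_def[OF sub[of n], of "S n" 0] by (simp add: X_def L_def)
    from p_sum[OF this] show ?thesis using X_pos[of n] by simp
  qed
  define P where "P n = lattice_law (p n) (r n)" for n
  have char: "(\<lambda>n. LINT y|P n. cos (k \<bullet> y)) \<longlonglongrightarrow> (LINT y|green_law. cos (k \<bullet> y))" for k :: "real ^ 'n"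
  proof -
    have "has_bochner_integral (P n) (\<lambda>y. cos (k \<bullet> y)) (Re (laplace (S n) \<i> (r n *\<^sub>R k)) / X n)" for n
      unfolding P_def using p_sum[OF subcritical.Re_laplace_S[OF sub[of n], of "r n *\<^sub>R k"]]
      by (intro lattice_law_integral p0) auto
    then have I: "(LINT y|P n. cos (k \<bullet> y)) = Re (laplace (S n) \<i> (r n *\<^sub>R k)) / X n" for n
      by (simp add: has_bochner_integral_iff)
    let ?D = "\<lambda>n. (1 - laplace (J n) \<i> (r n *\<^sub>R k)) / of_real ((r n)\<^sup>2)"
    have Dne: "of_real ((1 + (norm k)\<^sup>2) * c) \<noteq> (0 :: complex)"
      using c by (simp only: of_real_eq_0_iff) (metis add_pos_nonneg less_irrefl mult_pos_pos zero_le_power2 zero_less_one)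
    have "(\<lambda>n. Re ((laplace (h n) \<i> (r n *\<^sub>R k) / ?D n)) / (X n * (r n)\<^sup>2)) \<longlonglongrightarrow> Re (of_real H / of_real ((1 + (norm k)\<^sup>2) * c)) / (H / c)"
      using H0 c by (intro tendsto_intros hk gapk X_lim Dne) auto
    \<comment> \<open>The rescaled complex gap is known to be nonzero only eventually, through its
      limit.\<close>
    moreover have "eventually (\<lambda>n. Re ((laplace (h n) \<i> (r n *\<^sub>R k) / ?D n)) / (X n * (r n)\<^sup>2) = (LINT y|P n. cos (k \<bullet> y))) sequentially"
    proof -
      have "eventually (\<lambda>n. ?D n \<noteq> 0) sequentially"
        by (rule tendsto_imp_eventually_ne[OF gapk Dne])
      then show ?thesis
      proof eventually_elim
        case (elim n)
        have "laplace (h n) \<i> (r n *\<^sub>R k) / ?D n = of_real ((r n)\<^sup>2) * laplace (S n) \<i> (r n *\<^sub>R k)"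
          using elim unfolding subcritical.imaginary_identity[OF sub, of n, symmetric] by simp
        then have "Re (laplace (h n) \<i> (r n *\<^sub>R k) / ?D n) = (r n)\<^sup>2 * Re (laplace (S n) \<i> (r n *\<^sub>R k))"
          by (simp only: Re_complex_of_real times_complex.sel Im_complex_of_real)
        then show ?case unfolding I using r[of n] X_pos[of n] by (simp add: field_simps)
      qed
    qed
    ultimately have "(\<lambda>n. LINT y|P n. cos (k \<bullet> y)) \<longlonglongrightarrow> Re (of_real H / of_real ((1 + (norm k)\<^sup>2) * c)) / (H / c)"
      by (rule Lim_transform_eventually)
    also have "Re (of_real H / of_real ((1 + (norm k)\<^sup>2) * c)) / (H / c) = H / ((1 + (norm k)\<^sup>2) * c) / (H / c)"
      by (simp only: of_real_divide[symmetric] Re_complex_of_real)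
    \<comment> \<open>Written so as to match the value in \<open>green1_fourier\<close> divided by
      the total mass 2.\<close>
    also have "H / (a * c) / (H / c) = 2 / a / 2" for a using H0 c by simp
    also have "2 / (1 + (norm k)\<^sup>2) / 2 = (LINT y|green_law. cos (k \<bullet> y))"
      using green_law_integral[OF green1_fourier[of k]] by (simp add: has_bochner_integral_iff)
    finally show ?thesis .
  qed
  \<comment> \<open>The susceptibilities at tilts r / 2 and 0 are both of order 1 / r^2, so their
    ratio is bounded; a convergent majorant serves all n at once.\<close>
  obtain B where B: "\<And>n. L (S n) (r n / 2) / X n \<le> B"
  proof -
    have "(\<lambda>n. M / ((1 - L (J n) (r n / 2)) / (r n)\<^sup>2) / (X n * (r n)\<^sup>2)) \<longlonglongrightarrow> M / (3 / 4 * c) / (H / c)"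
      using c H0 by (intro tendsto_divide tendsto_const gaph X_lim) auto
    then have "Bseq (\<lambda>n. M / ((1 - L (J n) (r n / 2)) / (r n)\<^sup>2) / (X n * (r n)\<^sup>2))"
      by (intro convergent_imp_Bseq convergentI)
    then obtain B where B: "\<And>n. norm (M / ((1 - L (J n) (r n / 2)) / (r n)\<^sup>2) / (X n * (r n)\<^sup>2)) \<le> B"
      by (auto simp: Bseq_def)
    have "L (S n) (r n / 2) / X n \<le> B" for n
    proof -
      have t: "0 \<le> r n / 2" "r n / 2 < r n" using r[of n] by auto
      have "L (S n) (r n / 2) \<le> M / (1 - L (J n) (r n / 2))"
        using id(1,3)[OF t] gap_pos[OF t] by (simp add: pos_le_divide_eq mult.commute)
      then have "L (S n) (r n / 2) / X n \<le> M / (1 - L (J n) (r n / 2)) / X n"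
        using X_pos[of n] by (intro divide_right_mono) auto
      also have "\<dots> = M / ((1 - L (J n) (r n / 2)) / (r n)\<^sup>2) / (X n * (r n)\<^sup>2)"
        using r[of n] by simp
      also have "\<dots> \<le> B" using B[of n] by (simp only: real_norm_def abs_le_iff)
      finally show ?thesis .
    qed
    then show thesis using that by blast
  qed
  \<comment> \<open>The rate in \<open>S_exp_norm\<close> after rescaling by the mass: m |x| / (2 d)
    = a |r x|.\<close>
  define a where "a = 1 / (2 * real CARD('n))"
  have a: "a > 0" by (simp add: a_def)
  have mom: "has_bochner_integral (P n) (\<lambda>y. norm y powr q) (r n powr q * moment q (S n) / X n)"
    "r n powr q * moment q (S n) / X n \<le> (q / a) powr q * (2 * real CARD('n) * B)" if q: "q > 0" for n q
  proof -
    define E where "E x = S n x * exp (a * norm (r n *\<^sub>R rvec x))" for x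
    have E_eq: "E = (\<lambda>x. S n x * exp (subcritical.m (S n) e / (2 * real CARD('n)) * norm (rvec x)))"
      using r[of n] by (simp add: E_def fun_eq_iff a_def m_eq)
    have E: "E summable_on UNIV" "infsum E UNIV \<le> 2 * real CARD('n) * L (S n) (r n / 2)"
      using subcritical.S_exp_norm[OF sub[of n]] unfolding E_eq by (simp_all add: eqs)
    have le: "norm (S n x * norm (r n *\<^sub>R rvec x) powr q) \<le> (q / a) powr q * E x" for x
      using mult_left_mono[OF powr_le_exp[OF q a, of "norm (r n *\<^sub>R rvec x)"] S0[of n x]] S0[of n x]
      by (simp add: E_def abs_mult mult_ac)
    note dom = infsum_dominated[OF summable_on_cmult_right[OF E(1), of "(q / a) powr q"] le]
    have "((\<lambda>x. S n x * norm (r n *\<^sub>R rvec x) powr q) has_sum (r n powr q * moment q (S n))) UNIV"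
    proof -
      have "infsum (\<lambda>x. S n x * norm (r n *\<^sub>R rvec x) powr q) UNIV = (\<Sum>\<^sub>\<infinity>x. r n powr q * (pow0 (norm (rvec x)) q * S n x))"
        using r[of n] q by (intro infsum_cong) (simp add: powr_mult pow0_def)
      also have "\<dots> = r n powr q * moment q (S n)"
        unfolding moment_def by (rule infsum_cmult_right')
      finally show ?thesis using has_sum_infsum[OF dom(2)] by simp
    qed
    note hs = this
    show "has_bochner_integral (P n) (\<lambda>y. norm y powr q) (r n powr q * moment q (S n) / X n)"
      unfolding P_def by (intro lattice_law_integral p0 p_sum hs) auto
    have "r n powr q * moment q (S n) \<le> (q / a) powr q * infsum E UNIV"
      using dom(3) infsumI[OF hs] by (simp add: infsum_cmult_right')
    also have "\<dots> \<le> (q / a) powr q * (2 * real CARD('n) * L (S n) (r n / 2))"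
      by (intro mult_left_mono E) auto
    finally have "r n powr q * moment q (S n) / X n \<le> (q / a) powr q * (2 * real CARD('n) * L (S n) (r n / 2)) / X n"
      using X_pos[of n] by (intro divide_right_mono) auto
    also have "\<dots> = (q / a) powr q * (2 * real CARD('n) * (L (S n) (r n / 2) / X n))" by simp
    also have "\<dots> \<le> (q / a) powr q * (2 * real CARD('n) * B)"
      using B[of n] by (intro mult_left_mono) auto
    finally show "r n powr q * moment q (S n) / X n \<le> (q / a) powr q * (2 * real CARD('n) * B)" .
  qed
  \<comment> \<open>Since c = \<sigma>'^2 / (2 d), the factor H / c is 2 d H / \<sigma>'^2; its 2 is
    offset by the halved Green function.\<close>
  have eq: "A_const TYPE('n) \<phi> * (real CARD('n) * H / \<sigma>'\<^sup>2) = H / c * (A_const TYPE('n) \<phi> / 2)"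
    by (simp add: c_def)
  show "(\<lambda>n. moment \<phi> (S n) * mass e (S n) powr (2 + \<phi>)) \<longlonglongrightarrow> A_const TYPE('n) \<phi> * (real CARD('n) * H / \<sigma>'\<^sup>2)"
  \<comment> \<open>At \<phi> = 0 the moment is the susceptibility itself;
    \<open>norm_powr_moment_convergence\<close> takes a positive exponent.\<close>
  proof (cases "\<phi> = 0")
    case True
    have "X n = moment 0 (S n)" for n
      using subcritical.axis_laplace_S_0(1)[OF sub[of n]] by (simp add: X_def L_def)
    moreover have "r n powr 2 = (r n)\<^sup>2" for n
      using r[of n] by (simp add: powr_numeral)
    ultimately show ?thesis
      using X_lim True unfolding eq by (simp add: A_const_0 r_def[symmetric])
  next
    case False
    then have \<phi>': "\<phi> > 0" using \<phi> by simp
    have gm: "has_bochner_integral green_law (\<lambda>y :: real ^ 'n. norm y powr q) (A_const TYPE('n) q / 2)" if "q > 0" for q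
      using green_law_integral[OF green1_moment[of q, where 'n = 'n]] that by (simp add: A_const_eq)
    have "(\<lambda>n. LINT y|P n. norm y powr \<phi>) \<longlonglongrightarrow> (LINT y|green_law. norm (y :: real ^ 'n) powr \<phi>)"
    proof (rule norm_powr_moment_convergence)
      show "prob_space (P n)" for n unfolding P_def by (rule prob_space_lattice_law[OF p0 p1])
      show "\<exists>B. \<forall>n. integrable (P n) (\<lambda>x. norm x powr q) \<and> (LINT x|P n. norm x powr q) \<le> B" if "q > 0" for q
        using mom[OF that] by (auto simp: has_bochner_integral_iff)
      show "integrable green_law (\<lambda>x :: real ^ 'n. norm x powr q)" if "q > 0" for q
        using gm[OF that] by (simp add: has_bochner_integral_iff)
    qed (use char \<phi>' prob_space_green_law in \<open>auto simp: P_def\<close>)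
    then have "(\<lambda>n. r n powr \<phi> * moment \<phi> (S n) / X n) \<longlonglongrightarrow> A_const TYPE('n) \<phi> / 2"
      by (simp only: has_bochner_integral_integral_eq[OF mom(1)[OF \<phi>']] has_bochner_integral_integral_eq[OF gm[OF \<phi>']])
    from tendsto_mult[OF X_lim this]
    have "(\<lambda>n. X n * (r n)\<^sup>2 * (r n powr \<phi> * moment \<phi> (S n) / X n)) \<longlonglongrightarrow> H / c * (A_const TYPE('n) \<phi> / 2)" .
    moreover have "X n * (r n)\<^sup>2 * (r n powr \<phi> * moment \<phi> (S n) / X n) = moment \<phi> (S n) * r n powr (2 + \<phi>)" for n
      using r[of n] X_pos[of n] by (simp add: powr_add powr_numeral)
    ultimately show ?thesis unfolding eq by (simp add: r_def)
  qed
qed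

section \<open>From sequences to the one-sided limit\<close>

theorem theorem2p5:
  fixes S J h :: "real \<Rightarrow> int ^ 'n \<Rightarrow> real"
    and zc \<delta> M K \<zeta> :: real
    and e :: 'n
  assumes "\<delta> > 0"
    and "M > 0" and "K > 0" and "\<zeta> > 0"
    and "\<And>z x. z \<in> {zc - \<delta>..<zc} \<Longrightarrow> S z x \<ge> 0"
    and "\<And>z. z \<in> {zc - \<delta>..<zc} \<Longrightarrow> assumption1 e (S z)"
    and "\<And>z. z \<in> {zc - \<delta>..<zc} \<Longrightarrow> assumption2 (S z) (J z) (h z)"
    and "((\<lambda>z. mass e (S z)) \<longlongrightarrow> 0) (at_left zc)"
    and "\<And>z \<mu>. \<lbrakk>z \<in> {zc - \<delta>..<zc}; \<mu> \<in> closure (Omega (S z))\<rbrakk> \<Longrightarrow>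
           (tilt \<mu> (J z), tilt \<mu> (h z)) \<in> class_Q M K \<zeta> \<and>
           Re (fourier (tilt \<mu> (h z)) 0) \<ge> inverse M"
    and "((\<lambda>z. sigmaJ (J z)) \<longlongrightarrow> sigmaJ (J zc)) (at_left zc)"
    and "((\<lambda>z. fourier (h z) 0) \<longlongrightarrow> fourier (h zc) 0) (at_left zc)"
  shows "(\<forall>\<phi> \<ge> 0.
            (\<lambda>z. moment \<phi> (S z)) \<sim>[at_left zc]
            (\<lambda>z. A_const TYPE('n) \<phi>
                   * (real CARD('n) * Re (fourier (h zc) 0) / (sigmaJ (J zc))\<^sup>2)
                   * (1 / mass e (S z) powr (2 + \<phi>)))) \<and>
         (\<forall>\<phi> > 0.
            (\<lambda>z. corr_length \<phi> (S z)) \<sim>[at_left zc]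
            (\<lambda>z. (A_const TYPE('n) \<phi> / A_const TYPE('n) 0) powr (1 / \<phi>)
                   * (1 / mass e (S z))) \<and>
            (A_const TYPE('n) \<phi> / A_const TYPE('n) 0) powr (1 / \<phi>) =
              2 * (Gamma ((\<phi> + 2) / 2) * Gamma ((\<phi> + real CARD('n)) / 2)
                     / Gamma (real CARD('n) / 2)) powr (1 / \<phi>))"
proof -
  let ?m = "\<lambda>z. mass e (S z)"
  let ?C = "real CARD('n) * Re (fourier (h zc) 0) / (sigmaJ (J zc))\<^sup>2"
  have sub: "subcritical (S z) (J z) (h z) e M K \<zeta>" if "zc - \<delta> < z" "z < zc" for z
  proof
    have z: "z \<in> {zc - \<delta>..<zc}" using that by simp
    show "S z x \<ge> 0" for x by (rule assms(5)[OF z])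
    show "assumption1 e (S z)" by (rule assms(6)[OF z])
    show "S z x = h z x + conv (J z) (S z) x" "lattice_symmetric (J z)" for x
      using assms(7)[OF z] by (auto simp: assumption2_def)
    show "(tilt \<mu> (J z), tilt \<mu> (h z)) \<in> class_Q M K \<zeta>" "inverse M \<le> Re (fourier (tilt \<mu> (h z)) 0)"
      if "\<mu> \<in> closure (Omega (S z))" for \<mu>
      using assms(9)[OF z that] by auto
  qed (use assms in auto)
  have near: "eventually (\<lambda>z. zc - \<delta> < z \<and> z < zc) (at_left zc)"
    using eventually_at_left_real[of "zc - \<delta>" zc] assms(1) by simp
  have m_pos: "?m z > 0" if "zc - \<delta> < z" "z < zc" for z
    using subcritical.mass_pos[OF sub[OF that]] by (simp add: subcritical.m_def[OF sub[OF that]])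
  \<comment> \<open>Positivity at \<open>zc\<close> is not among the hypotheses, so it is returned
    together with the limit.\<close>
  have seq: "sigmaJ (J zc) \<noteq> 0 \<and> Re (fourier (h zc) 0) > 0 \<and>
      (\<lambda>n. moment \<phi> (S (u n)) * ?m (u n) powr (2 + \<phi>)) \<longlonglongrightarrow> A_const TYPE('n) \<phi> * ?C"
    if "\<And>n. u n < zc" "\<And>n. zc - \<delta> < u n" "u \<longlonglongrightarrow> zc" "\<phi> \<ge> 0" for u \<phi>
  proof -
    have u: "filterlim u (at_left zc) sequentially"
      using that by (intro tendsto_imp_filterlim_at_left) (auto intro: always_eventually)
    have lims: "(\<lambda>n. ?m (u n)) \<longlonglongrightarrow> 0" "(\<lambda>n. sigmaJ (J (u n))) \<longlonglongrightarrow> sigmaJ (J zc)"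
      "(\<lambda>n. Re (fourier (h (u n)) 0)) \<longlonglongrightarrow> Re (fourier (h zc) 0)"
      using filterlim_compose[OF assms(8) u] filterlim_compose[OF assms(10) u]
        filterlim_compose[OF tendsto_Re[OF assms(11)] u] by auto
    show ?thesis
      using subcritical_moment_limit[OF sub[OF that(2,1)] lims that(4)] by blast
  qed
  have lim: "((\<lambda>z. moment \<phi> (S z) * ?m z powr (2 + \<phi>)) \<longlongrightarrow> A_const TYPE('n) \<phi> * ?C) (at_left zc)" if "\<phi> \<ge> 0" for \<phi>
    using seq[OF _ _ _ that] assms(1) by (intro tendsto_at_left_sequentially[of "zc - \<delta>"]) auto
  have C: "?C > 0"
  proof -
    \<comment> \<open>Any admissible sequence would do. With 1 in place of 2, its first term would
      be zc - \<delta> itself, which \<open>sub\<close> excludes.\<close>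
    define u where "u n = zc - \<delta> / (real n + 2)" for n
    have "(\<lambda>n. zc - \<delta> / (real n + 2)) \<longlonglongrightarrow> zc" by real_asymp
    moreover have "\<delta> / (real n + 2) < \<delta>" for n
      using assms(1) by (simp add: divide_less_eq)
    ultimately have "sigmaJ (J zc) \<noteq> 0 \<and> Re (fourier (h zc) 0) > 0"
      using seq[of u 0] assms(1) unfolding u_def by fastforce
    then show ?thesis by simp
  qed
  have A: "A_const TYPE('n) \<phi> > 0" if "\<phi> \<ge> 0" for \<phi> using A_const_pos[OF that] .
  have moment: "(\<lambda>z. moment \<phi> (S z)) \<sim>[at_left zc] (\<lambda>z. A_const TYPE('n) \<phi> * ?C * (1 / ?m z powr (2 + \<phi>)))"
    if "\<phi> \<ge> 0" for \<phi>
  proof (rule asymp_equivI')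
    let ?a = "A_const TYPE('n) \<phi> * ?C"
    have a: "?a > 0" using A[OF that] C by (rule mult_pos_pos)
    have "((\<lambda>z. moment \<phi> (S z) * ?m z powr (2 + \<phi>) / ?a) \<longlongrightarrow> ?a / ?a) (at_left zc)"
      by (rule tendsto_divide[OF lim[OF that] tendsto_const]) (use a in linarith)
    also have "?a / ?a = 1" by (rule divide_self) (use a in linarith)
    finally have lim1: "((\<lambda>z. moment \<phi> (S z) * ?m z powr (2 + \<phi>) / ?a) \<longlongrightarrow> 1) (at_left zc)" .
    \<comment> \<open>True for w = 0 and b = 0 as well, as division by zero gives 0.\<close>
    have "x * w / b = x / (b * (1 / w))" for x w b :: real by simp
    then have "moment \<phi> (S z) * ?m z powr (2 + \<phi>) / ?a = moment \<phi> (S z) / (?a * (1 / ?m z powr (2 + \<phi>)))" for z .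
    with lim1 show "((\<lambda>z. moment \<phi> (S z) / (?a * (1 / ?m z powr (2 + \<phi>)))) \<longlongrightarrow> 1) (at_left zc)"
      by (simp only:)
  qed
  have corr: "(\<lambda>z. corr_length \<phi> (S z)) \<sim>[at_left zc] (\<lambda>z. (A_const TYPE('n) \<phi> / A_const TYPE('n) 0) powr (1 / \<phi>) * (1 / ?m z))"
    if "\<phi> > 0" for \<phi>
  proof (rule asymp_equivI')
    let ?A = "A_const TYPE('n) \<phi> / A_const TYPE('n) 0"
    have A': "?A > 0" using A[of \<phi>] A[of 0] that by simp
    then have A'': "?A powr (1 / \<phi>) \<noteq> 0" by (simp only: powr_eq_0_iff)
    \<comment> \<open>Both moments carry the factor \<open>?C\<close> and two powers of the mass;
      these cancel and leave the mass to the power \<phi>.\<close>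
    have "((\<lambda>z. (moment \<phi> (S z) * ?m z powr (2 + \<phi>)) / (moment 0 (S z) * ?m z powr (2 + 0))) \<longlongrightarrow>
        (A_const TYPE('n) \<phi> * ?C) / (A_const TYPE('n) 0 * ?C)) (at_left zc)"
    proof (intro tendsto_divide lim)
      have "A_const TYPE('n) 0 * ?C > 0" using A[of 0] C by (intro mult_pos_pos) auto
      then show "A_const TYPE('n) 0 * ?C \<noteq> 0" by linarith
    qed (use that in auto)
    also have "(A_const TYPE('n) \<phi> * ?C) / (A_const TYPE('n) 0 * ?C) = ?A"
      by (rule mult_divide_mult_cancel_right) (use C in linarith)
    finally have ratio: "((\<lambda>z. (moment \<phi> (S z) * ?m z powr (2 + \<phi>)) / (moment 0 (S z) * ?m z powr (2 + 0))) \<longlongrightarrow> ?A) (at_left zc)" .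
    have "((\<lambda>z. ((moment \<phi> (S z) * ?m z powr (2 + \<phi>)) / (moment 0 (S z) * ?m z powr (2 + 0))) powr (1 / \<phi>) / ?A powr (1 / \<phi>)) \<longlongrightarrow>
        ?A powr (1 / \<phi>) / ?A powr (1 / \<phi>)) (at_left zc)"
    proof (rule tendsto_divide[OF tendsto_powr[OF ratio tendsto_const] tendsto_const])
      show "?A \<noteq> 0" using A' by linarith
    qed (rule A'')
    also have "?A powr (1 / \<phi>) / ?A powr (1 / \<phi>) = 1"
      by (rule divide_self[OF A''])
    finally show "((\<lambda>z. corr_length \<phi> (S z) / (?A powr (1 / \<phi>) * (1 / ?m z))) \<longlongrightarrow> 1) (at_left zc)"
    proof (rule Lim_transform_eventually)
      show "\<forall>\<^sub>F z in at_left zc. ((moment \<phi> (S z) * ?m z powr (2 + \<phi>)) / (moment 0 (S z) * ?m z powr (2 + 0))) powr (1 / \<phi>) / ?A powr (1 / \<phi>)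
          = corr_length \<phi> (S z) / (?A powr (1 / \<phi>) * (1 / ?m z))"
        using near
      proof eventually_elim
        case (elim z)
        have m: "?m z > 0" using m_pos elim by blast
        have nn: "moment \<phi> (S z) \<ge> 0" "moment 0 (S z) \<ge> 0"
          using subcritical.S_nonneg[OF sub] elim by (auto simp: moment_def pow0_def intro!: infsum_nonneg)
        have "(moment \<phi> (S z) * ?m z powr (2 + \<phi>)) / (moment 0 (S z) * ?m z powr (2 + 0)) = (1 / moment 0 (S z) * moment \<phi> (S z)) * ?m z powr \<phi>"
          using m by (simp add: powr_add)
        also have "\<dots> powr (1 / \<phi>) = (1 / moment 0 (S z) * moment \<phi> (S z)) powr (1 / \<phi>) * (?m z powr \<phi>) powr (1 / \<phi>)"
          by (subst powr_mult) (use nn in auto)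
        also have "(1 / moment 0 (S z) * moment \<phi> (S z)) powr (1 / \<phi>) = corr_length \<phi> (S z)"
          using subcritical.axis_laplace_S_0(2)[OF sub] elim by (simp add: corr_length_def)
        also have "(?m z powr \<phi>) powr (1 / \<phi>) = ?m z" using m that by (simp add: powr_powr)
        finally show ?case by simp
      qed
    qed
  qed
  have const: "(A_const TYPE('n) \<phi> / A_const TYPE('n) 0) powr (1 / \<phi>) =
      2 * (Gamma ((\<phi> + 2) / 2) * Gamma ((\<phi> + real CARD('n)) / 2) / Gamma (real CARD('n) / 2)) powr (1 / \<phi>)" if "\<phi> > 0" for \<phi>
  proof -
    let ?G = "Gamma ((\<phi> + 2) / 2) * Gamma ((\<phi> + real CARD('n)) / 2) / Gamma (real CARD('n) / 2)"
    have "A_const TYPE('n) \<phi> / A_const TYPE('n) 0 = 2 powr \<phi> * ?G"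
      using that by (simp add: A_const_eq[of \<phi>] A_const_0 powr_add)
    moreover have "?G \<ge> 0"
      using that by (intro divide_nonneg_nonneg mult_nonneg_nonneg less_imp_le[OF Gamma_real_pos]) (auto intro: add_pos_pos)
    \<comment> \<open>The root turns 2 powr \<phi>, the quotient of 2 powr (\<phi> + 1) by the
      zeroth constant 2, into the prefactor 2.\<close>
    moreover have "(2 powr \<phi> * g) powr (1 / \<phi>) = 2 * g powr (1 / \<phi>)" if "g \<ge> 0" for g
      using that \<open>\<phi> > 0\<close> by (simp add: powr_mult powr_powr)
    ultimately show ?thesis by (simp only:)
  qed
  show ?thesis
    using moment corr const by blast
qed

end
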